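(* Let $k$ be a field. The Minimal Resolution Conjecture fails for the general set of $\gamma$ points in $\mathbb{P}^r=\mathbb{P}^r_k$ whenever $r\geq 6$, $r\neq 9$, and $$r+2+\sqrt{r+2}\;\leq\;\gamma\;\leq\; r+\frac{3+\sqrt{8r+1}}{2},$$ and also when $(r,\gamma)=(8,13)$ or $(r,\gamma)=(15,21)$.
   Context: Let $S=k[x_0,\dots,x_r]$ be the homogeneous coordinate ring of $\mathbb{P}^r$, standard graded. For a set $\Gamma$ of $\gamma$ points in $\mathbb{P}^r$ with homogeneous ideal $I_\Gamma\subset S$, the graded betti numbers are $\beta_{i,j}(S/I_\Gamma)=\dim_k \operatorname{Tor}_i^S(S/I_\Gamma,k)_j$. "A general set of $\gamma$ points has a property" means that the property holds for all $\Gamma=\{p_1,\dots,p_\gamma\}$ with $(p_1,\dots,p_\gamma)$ in some nonempty Zariski-open subset of $(\mathbb{P}^r)^\gamma$. A general set $\Gamma$ has Hilbert function $\dim_k(S/I_\Gamma)_t=\min\{\gamma,\binom{r+t}{r}\}$. Define integers $b_j$ by $$\sum_{t\ge 0}\dim_k (S/I_\Gamma)_t\, z^t=\frac{\sum_j b_j z^j}{(1-z)^{r+1}}.$$ Let $d$ be the least integer with $\gamma<\binom{r+d}{r}$. For a general $\Gamma$, and $i\geq 1$, the number $\beta_{i,j}(S/I_\Gamma)$ can be nonzero only for $j\in\{i+d-1,i+d\}$, and for such $(i,j)$ the Hilbert function gives the lower bound $\beta_{i,j}(S/I_\Gamma)\geq \max\{0,(-1)^i b_j\}$ (the expected graded betti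 number). The Minimal Resolution Conjecture (for $\gamma$ general points in $\mathbb{P}^r$) is the statement that for a general $\Gamma$ all these lower bounds are equalities. It fails for the general set of $\gamma$ points if, for a general set $\Gamma$, there are $i\ge 1$ and $j\in\{i+d-1,i+d\}$ with $\beta_{i,j}(S/I_\Gamma)>\max\{0,(-1)^i b_j\}$. *)

theory Defs
  imports
    Complex_Main
    "HOL-Library.Poly_Mapping"
    "HOL-Library.FuncSet"
    "HOL-Library.Function_Algebras"
    "HOL-Computational_Algebra.Formal_Power_Series"
    "HOL-Algebra.Algebraic_Closure_Type"
begin

section \<open>Polynomials\<close>

type_synonym ('v, 'k) mpoly = "('v \<Rightarrow>\<^sub>0 nat) \<Rightarrow>\<^sub>0 'k"

definition mdeg :: "('v \<Rightarrow>\<^sub>0 nat) \<Rightarrow> nat" where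
  "mdeg m = (\<Sum>v\<in>Poly_Mapping.keys m. Poly_Mapping.lookup m v)"

definition field_embedding :: "('k::field \<Rightarrow> 'l::field) \<Rightarrow> bool" where
  "field_embedding \<iota> \<longleftrightarrow>
     \<iota> 1 = 1 \<and> (\<forall>a b. \<iota> (a + b) = \<iota> a + \<iota> b) \<and> (\<forall>a b. \<iota> (a * b) = \<iota> a * \<iota> b)"

text \<open>The value at \<open>x\<close> of a polynomial whose coefficients are carried along \<open>\<iota>\<close> to the field
  containing the coordinates of \<open>x\<close>.\<close>

definition mpoly_eval :: "('k::field \<Rightarrow> 'l::field) \<Rightarrow> ('v \<Rightarrow> 'l) \<Rightarrow> ('v, 'k) mpoly \<Rightarrow> 'l" where
  "mpoly_eval \<iota> x f =
     (\<Sum>m\<in>Poly_Mapping.keys f. \<iota> (Poly_Mapping.lookup f m) *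
        (\<Prod>v\<in>Poly_Mapping.keys m. x v ^ Poly_Mapping.lookup m v))"

definition hom_part :: "nat \<Rightarrow> ('v, 'k::field) mpoly \<Rightarrow> ('v, 'k) mpoly" where
  "hom_part t f =
     (\<Sum>m\<in>{m \<in> Poly_Mapping.keys f. mdeg m = t}. Poly_Mapping.single m (Poly_Mapping.lookup f m))"

text \<open>\<open>S = k[x_0, ..., x_r]\<close> and its graded pieces, inside the polynomials in the variables
  \<open>x_0, x_1, ...\<close>.\<close>

definition coord_ring :: "nat \<Rightarrow> (nat, 'k::field) mpoly set" where
  "coord_ring r = {f. \<forall>m\<in>Poly_Mapping.keys f. Poly_Mapping.keys m \<subseteq> {..r}}"

definition coord_ring_deg :: "nat \<Rightarrow> nat \<Rightarrow> (nat, 'k::field) mpoly set" where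
  "coord_ring_deg r t = {f \<in> coord_ring r. \<forall>m\<in>Poly_Mapping.keys f. mdeg m = t}"

definition poly_scale :: "'k::field \<Rightarrow> ('v, 'k) mpoly \<Rightarrow> ('v, 'k) mpoly" where
  "poly_scale c f = Poly_Mapping.single 0 c * f"

definition fun_scale :: "'k::field \<Rightarrow> (nat \<Rightarrow> 'k) \<Rightarrow> nat \<Rightarrow> 'k" where
  "fun_scale c v = (\<lambda>l. c * v l)"

lemma vector_space_poly_scale: "vector_space poly_scale"
  by unfold_locales
     (simp_all add: poly_scale_def distrib_left distrib_right single_add mult_single
        flip: mult.assoc)

lemma vector_space_fun_scale: "vector_space fun_scale"
  by unfold_locales (simp_all add: fun_scale_def fun_eq_iff algebra_simps)

text \<open>The dimension of \<open>V / W\<close>; used for subspaces \<open>W \<subseteq> V\<close> with \<open>V\<close> of finite dimension.\<close>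

definition quot_dim :: "('k::field \<Rightarrow> 'b::ab_group_add \<Rightarrow> 'b) \<Rightarrow> 'b set \<Rightarrow> 'b set \<Rightarrow> nat" where
  "quot_dim scale V W = vector_space.dim scale V - vector_space.dim scale W"


section \<open>Points of projective space\<close>

text \<open>A point is the set of its homogeneous coordinate vectors \<open>(x_0, ..., x_r)\<close>, which are
  extended by \<open>0\<close>.\<close>

definition proj_space :: "nat \<Rightarrow> (nat \<Rightarrow> 'k::field) set set" where
  "proj_space r = {{fun_scale c x | c. c \<noteq> 0} | x. (\<forall>l>r. x l = 0) \<and> (\<exists>l\<le>r. x l \<noteq> 0)}"

text \<open>The homogeneous ideal consists of the polynomials all of whose homogeneous components vanish
  on \<open>\<Gamma>\<close>; over a finite field this is smaller than the set of the polynomials that vanish at all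
  coordinate vectors.\<close>

definition vanishing_ideal :: "nat \<Rightarrow> (nat \<Rightarrow> 'k::field) set set \<Rightarrow> (nat, 'k) mpoly set" where
  "vanishing_ideal r \<Gamma> =
     {f \<in> coord_ring r. \<forall>t. \<forall>P\<in>\<Gamma>. \<forall>x\<in>P. mpoly_eval id x (hom_part t f) = 0}"


section \<open>Hilbert function\<close>

definition hilbert_fun :: "nat \<Rightarrow> (nat, 'k::field) mpoly set \<Rightarrow> nat \<Rightarrow> nat" where
  "hilbert_fun r I t = quot_dim poly_scale (coord_ring_deg r t) (I \<inter> coord_ring_deg r t)"

definition hilbert_numerator :: "nat \<Rightarrow> (nat, 'k::field) mpoly set \<Rightarrow> nat \<Rightarrow> int" where
  "hilbert_numerator r I j =
     fps_nth (Abs_fps (\<lambda>t. int (hilbert_fun r I t)) * (1 - fps_X) ^ (r + 1)) j"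


section \<open>Graded free resolutions and graded betti numbers\<close>

text \<open>A complex \<open>F_0 \<leftarrow> F_1 \<leftarrow> ...\<close> of free graded \<open>S\<close>-modules of finite rank:
  \<open>F_i\<close> has a basis indexed by \<open>l < fr_rank i\<close>, the \<open>l\<close>-th basis element being of degree
  \<open>fr_shift i l\<close>, and for \<open>i \<ge> 1\<close> the matrix \<open>fr_diff i\<close> (first index: rows) represents
  \<open>F_i \<rightarrow> F_{i-1}\<close>.\<close>

record (overloaded) 'k free_complex =
  fr_rank :: "nat \<Rightarrow> nat"
  fr_shift :: "nat \<Rightarrow> nat \<Rightarrow> nat"
  fr_diff :: "nat \<Rightarrow> nat \<Rightarrow> nat \<Rightarrow> (nat, 'k) mpoly"

definition mat_apply ::
    "nat \<Rightarrow> nat \<Rightarrow> (nat \<Rightarrow> nat \<Rightarrow> 'a::comm_ring_1) \<Rightarrow> (nat \<Rightarrow> 'a) \<Rightarrow> nat \<Rightarrow> 'a" where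
  "mat_apply p q M v = (\<lambda>a. if a < p then \<Sum>l<q. M a l * v l else 0)"

definition fr_module :: "nat \<Rightarrow> 'k::field free_complex \<Rightarrow> nat \<Rightarrow> (nat \<Rightarrow> (nat, 'k) mpoly) set" where
  "fr_module r F i =
     {v. (\<forall>l < fr_rank F i. v l \<in> coord_ring r) \<and> (\<forall>l \<ge> fr_rank F i. v l = 0)}"

definition fr_map ::
    "'k::field free_complex \<Rightarrow> nat \<Rightarrow> (nat \<Rightarrow> (nat, 'k) mpoly) \<Rightarrow> nat \<Rightarrow> (nat, 'k) mpoly" where
  "fr_map F i = mat_apply (fr_rank F (i - 1)) (fr_rank F i) (fr_diff F i)"

text \<open>\<open>F\<close> is a graded free resolution of \<open>S / I\<close>, with \<open>F_0 = S\<close> and the canonical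
  projection \<open>S \<rightarrow> S / I\<close> as augmentation.\<close>

definition graded_free_resolution ::
    "nat \<Rightarrow> (nat, 'k::field) mpoly set \<Rightarrow> 'k free_complex \<Rightarrow> bool" where
  "graded_free_resolution r I F \<longleftrightarrow>
     fr_rank F 0 = 1 \<and> fr_shift F 0 0 = 0 \<and>
     (\<forall>i\<ge>1. \<forall>a < fr_rank F (i - 1). \<forall>l < fr_rank F i.
        fr_diff F i a l \<in> coord_ring r \<and>
        (\<forall>m\<in>Poly_Mapping.keys (fr_diff F i a l).
           mdeg m + fr_shift F (i - 1) a = fr_shift F i l)) \<and>
     (\<lambda>v. fr_map F 1 v 0) ` fr_module r F 1 = I \<and>
     (\<forall>i\<ge>1. fr_map F (i + 1) ` fr_module r F (i + 1) = {v \<in> fr_module r F i. fr_map F i v = 0})"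

text \<open>The homology of \<open>F \<otimes>\<^sub>S k\<close>: the module \<open>F_i \<otimes>\<^sub>S k\<close> has the \<open>k\<close>-basis
  given by the basis of \<open>F_i\<close>, and the differentials are given by the constant terms of the
  matrix entries.\<close>

definition tensor_module :: "'k::field free_complex \<Rightarrow> nat \<Rightarrow> nat \<Rightarrow> (nat \<Rightarrow> 'k) set" where
  "tensor_module F i j = {v. \<forall>l. \<not> (l < fr_rank F i \<and> fr_shift F i l = j) \<longrightarrow> v l = 0}"

definition tensor_map :: "'k::field free_complex \<Rightarrow> nat \<Rightarrow> (nat \<Rightarrow> 'k) \<Rightarrow> nat \<Rightarrow> 'k" where
  "tensor_map F i = mat_apply (fr_rank F (i - 1)) (fr_rank F i)
     (\<lambda>a l. Poly_Mapping.lookup (fr_diff F i a l) 0)"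

definition tensor_cycles :: "'k::field free_complex \<Rightarrow> nat \<Rightarrow> nat \<Rightarrow> (nat \<Rightarrow> 'k) set" where
  "tensor_cycles F i j = {v \<in> tensor_module F i j. i = 0 \<or> tensor_map F i v = 0}"

definition tensor_boundaries :: "'k::field free_complex \<Rightarrow> nat \<Rightarrow> nat \<Rightarrow> (nat \<Rightarrow> 'k) set" where
  "tensor_boundaries F i j = tensor_map F (i + 1) ` tensor_module F (i + 1) j"

text \<open>\<open>\<beta>_{i,j}(S/I)\<close>, the dimension of \<open>Tor_i(S/I, k)_j\<close> computed from a graded free resolution
  of \<open>S/I\<close>; it does not depend on the resolution.\<close>

definition betti :: "nat \<Rightarrow> (nat, 'k::field) mpoly set \<Rightarrow> nat \<Rightarrow> nat \<Rightarrow> nat" where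
  "betti r I i j =
     (let F = (SOME F. graded_free_resolution r I F)
      in quot_dim fun_scale (tensor_cycles F i j) (tensor_boundaries F i j))"


section \<open>General sets of points\<close>

definition multihomogeneous :: "nat \<Rightarrow> nat \<Rightarrow> (nat \<times> nat, 'k::field) mpoly set" where
  "multihomogeneous r \<gamma> =
     {f. \<exists>e. \<forall>m\<in>Poly_Mapping.keys f. Poly_Mapping.keys m \<subseteq> {..<\<gamma>} \<times> {..r} \<and>
            (\<forall>s<\<gamma>. (\<Sum>l\<le>r. Poly_Mapping.lookup m (s, l)) = e s)}"

text \<open>For a field extension \<open>\<iota> : k \<rightarrow> L\<close> and a set \<open>A\<close> of multihomogeneous polynomials over
  \<open>k\<close>, the set of \<open>L\<close>-valued points of the Zariski-open subset of \<open>(P^r)^\<gamma>\<close> which is the complement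
  of the common zeros of \<open>A\<close>.\<close>

definition open_points ::
    "('k::field \<Rightarrow> 'l::field) \<Rightarrow> nat \<Rightarrow> nat \<Rightarrow> (nat \<times> nat, 'k) mpoly set
      \<Rightarrow> (nat \<Rightarrow> (nat \<Rightarrow> 'l) set) set" where
  "open_points \<iota> r \<gamma> A =
     {p \<in> {..<\<gamma>} \<rightarrow>\<^sub>E proj_space r.
        \<exists>f\<in>A. \<exists>x. (\<forall>s<\<gamma>. x s \<in> p s) \<and> mpoly_eval \<iota> (\<lambda>(s, l). x s l) f \<noteq> 0}"

text \<open>A general set of \<open>\<gamma>\<close> points of \<open>P^r\<close> with coordinates in \<open>L\<close> has the property \<open>Q\<close>, the
  open set being defined over \<open>k\<close>. As \<open>k\<close> may be finite, an open set can be nonempty without having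
  any \<open>k\<close>-rational point; it is nonempty if it has a point over the algebraic closure of \<open>k\<close>.\<close>

definition general_points ::
    "('k::field \<Rightarrow> 'l::field) \<Rightarrow> nat \<Rightarrow> nat \<Rightarrow> ((nat \<Rightarrow> 'l) set set \<Rightarrow> bool) \<Rightarrow> bool" where
  "general_points \<iota> r \<gamma> Q \<longleftrightarrow>
     (\<exists>A \<subseteq> multihomogeneous r \<gamma>.
        open_points to_ac r \<gamma> A \<noteq> {} \<and> (\<forall>p \<in> open_points \<iota> r \<gamma> A. Q (p ` {..<\<gamma>})))"

definition exceeds_expected_betti :: "nat \<Rightarrow> nat \<Rightarrow> (nat \<Rightarrow> 'l::field) set set \<Rightarrow> bool" where
  "exceeds_expected_betti r \<gamma> \<Gamma> \<longleftrightarrow>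
     (let I = vanishing_ideal r \<Gamma>; d = (LEAST d. \<gamma> < (r + d) choose r)
      in \<exists>i\<ge>1. \<exists>j\<in>{i + d - 1, i + d}.
           int (betti r I i j) > max 0 ((-1) ^ i * hilbert_numerator r I j))"

definition MRC_fails :: "('k::field \<Rightarrow> 'l::field) \<Rightarrow> nat \<Rightarrow> nat \<Rightarrow> bool" where
  "MRC_fails \<iota> r \<gamma> \<longleftrightarrow> general_points \<iota> r \<gamma> (exceeds_expected_betti r \<gamma>)"

end

theory Submission
  imports Defs "Jordan_Normal_Form.Determinant"
begin

text \<open>Put \<open>s = \<gamma> - r - 2\<close>. In linearly general position the \<open>\<gamma>\<close> points impose independent conditions
  on quadrics, so \<open>d = 2\<close>, and it suffices to bound \<open>\<beta>\<^sub>i\<^sub>,\<^sub>j\<close> from below for \<open>i = r - s\<close> and \<open>j = i + 2\<close>,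
  where \<open>(-1)\<^sup>i b\<^sub>j\<close> is a positive multiple of \<open>r - (s\<^sup>2 - 2)\<close>. Let \<open>V\<close> be the space of linear forms
  and \<open>W\<close> the Gale transform, both inside the space \<open>k\<^sup>\<gamma>\<close> of functions on the points, \<open>W\<close> being the
  annihilator of \<open>V\<close>. Counting dimensions, if \<open>s (s + 1) \<le> 2 r\<close> there is a nonzero function \<open>c\<close> that
  annihilates \<open>W \<cdot> W\<close>, and hence \<open>c W \<subseteq> V\<close>. The map \<open>(c w) \<otimes> w' \<mapsto> c w w'\<close> is symmetric, and so the Koszul
  complex of \<open>W\<close> maps to the linear strand of the canonical module of the points, which is dual to the
  strand of the \<open>\<beta>\<^sub>i\<^sub>,\<^sub>i\<^sub>+\<^sub>2\<close>; its last nonzero term gives \<open>\<beta>\<^sub>i\<^sub>,\<^sub>j > 0\<close>. In the cases \<open>(8, 13)\<close> and \<open>(15, 21)\<close>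
  the expected values are \<open>8\<close> and \<open>105\<close>, but the functions \<open>c\<close> form a space of dimension \<open>3\<close> or \<open>6\<close>, the
  classes depend on \<open>c\<close> like forms of degree \<open>s\<close>, and for general points they span a space of dimension
  \<open>10\<close> or \<open>126\<close>.\<close>

section \<open>Exterior multiplication and contraction\<close>

text \<open>\<open>betti\<close> evaluates a resolution picked by choice, so the existence of a
  resolution has to be proved, and Tor has to be moved from that unknown resolution to the Koszul
  complex; only a lower bound for its dimension is carried over. The duality with the canonical
  module appears as an explicit pairing: there are Koszul cycles \<open>z b\<close>, each supported
  at one point \<open>p0 b\<close>, and families \<open>\<xi> a\<close> of forms indexed by the
  points, and the matrix of their pairings turns out diagonal. At the point q, \<open>\<xi>\<close>
  should be x_q wedged with the contraction of the volume form by lifts of s + 1 products c w,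
  divided by the value of c at q. As c may vanish, and in the sporadic cases is made to vanish at
  chosen points, the division is carried out formally; this is the purpose of
  \<open>omit_ctr\<close>. The forms \<open>\<xi>\<close> have degree r + 1 - s, one more than the
  index r - s of the cycles. The open conditions are polynomials over k, whose nonvanishing
  somewhere is shown over the algebraic closure because that field is infinite.\<close>

text \<open>A form on the free module with basis \<open>A\<close> is the function giving its coefficient at each finite
  subset of \<open>A\<close>, the elements of a subset being wedged in increasing order.\<close>

definition sg :: "nat \<Rightarrow> nat set \<Rightarrow> 'a::comm_ring_1" where
  "sg l T = (-1) ^ card {m \<in> T. m < l}"

definition ctr :: "nat set \<Rightarrow> (nat \<Rightarrow> 'a::comm_ring_1) \<Rightarrow> (nat set \<Rightarrow> 'a) \<Rightarrow> nat set \<Rightarrow> 'a" where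
  "ctr A g \<phi> T = (\<Sum>l\<in>A - T. sg l T * g l * \<phi> (insert l T))"

definition ext :: "(nat \<Rightarrow> 'a::comm_ring_1) \<Rightarrow> (nat set \<Rightarrow> 'a) \<Rightarrow> nat set \<Rightarrow> 'a" where
  "ext p \<phi> T = (\<Sum>l\<in>T. sg l T * p l * \<phi> (T - {l}))"

lemma sg_square [simp]: "sg l T * sg l T = (1::'a::comm_ring_1)"
  by (simp add: sg_def flip: power_add) 

lemma sg_square' [simp]: "sg l T * (sg l T * x) = (x::'a::comm_ring_1)"
  by (simp flip: mult.assoc)

lemma sg_insert_same [simp]: "sg l (insert l T) = sg l T"
  by (auto simp: sg_def intro!: arg_cong[where f = card] arg_cong2[where f = "(^)"])

lemma sg_remove_same [simp]: "sg l (T - {l}) = sg l T"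
  by (auto simp: sg_def intro!: arg_cong[where f = card] arg_cong2[where f = "(^)"])

lemma sg_insert:
  assumes "finite T" "l \<notin> T" "l \<noteq> m"
  shows "sg m (insert l T) = (if l < m then - sg m T else (sg m T :: 'a::comm_ring_1))"
proof -
  have "{k \<in> insert l T. k < m} = (if l < m then insert l {k \<in> T. k < m} else {k \<in> T. k < m})"
    by auto
  then show ?thesis using assms by (auto simp: sg_def)
qed

lemma sg_remove:
  assumes "finite T" "l \<in> T" "l \<noteq> m"
  shows "sg m (T - {l}) = (if l < m then - sg m T else (sg m T :: 'a::comm_ring_1))"
  using sg_insert[of "T - {l}" l m, where 'a = 'a] assms
  by (auto simp: insert_absorb split: if_splits)

lemma sg_greatest: 
  assumes "\<And>m. m \<in> T \<Longrightarrow> m < n"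
  shows "sg n T = (-1) ^ card T"
proof -
  have "{m \<in> T. m < n} = T" using assms by auto
  then show ?thesis by (simp add: sg_def)
qed

text \<open>Comparing the sum with its negative would prove nothing in characteristic 2, so the
  pairs (l, m) and (m, l) are cancelled explicitly, by induction on \<open>B\<close>.\<close>

lemma sum_antisymmetric:
  fixes f :: "'b \<Rightarrow> 'b \<Rightarrow> 'a::ab_group_add"
  assumes "finite B" "\<And>l m. l \<in> B \<Longrightarrow> m \<in> B \<Longrightarrow> l \<noteq> m \<Longrightarrow> f l m = - f m l"
  shows "(\<Sum>l\<in>B. \<Sum>m\<in>B - {l}. f l m) = 0"
  using assms
proof (induction B rule: finite_induct)
  case (insert b B)
  have "(\<Sum>m\<in>insert b B - {l}. f l m) = f l b + (\<Sum>m\<in>B - {l}. f l m)" if "l \<in> B" for l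
  proof -
    have "insert b B - {l} = insert b (B - {l})" using insert.hyps that by auto
    then show ?thesis using insert.hyps by simp
  qed
  moreover have "(\<Sum>m\<in>insert b B - {b}. f b m) = (\<Sum>m\<in>B. - f m b)"
    using insert.hyps by (intro sum.cong) (auto intro!: insert.prems)
  ultimately have "(\<Sum>l\<in>insert b B. \<Sum>m\<in>insert b B - {l}. f l m)
      = (\<Sum>m\<in>B. - f m b) + (\<Sum>l\<in>B. f l b + (\<Sum>m\<in>B - {l}. f l m))"
    using insert.hyps by simp
  also have "\<dots> = 0"
    using insert.IH[OF insert.prems] by (simp add: sum.distrib sum_negf)
  finally show ?case .
qed simp

text \<open>The Koszul differential squares to zero: inserting l and m in the two orders produces
  opposite signs.\<close>

lemma ctr_ctr:
  assumes "finite A" "T \<subseteq> A"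
  shows "ctr A g (ctr A g \<phi>) T = 0"
proof -
  have fT: "finite T" using assms finite_subset by auto
  define f where "f = (\<lambda>l m. sg l T * sg m (insert l T) * (g l * g m) * \<phi> (insert l (insert m T)))"
  have "ctr A g (ctr A g \<phi>) T = (\<Sum>l\<in>A - T. \<Sum>m\<in>(A - T) - {l}. f l m)"
    unfolding ctr_def f_def sum_distrib_left
    by (intro sum.cong) (auto simp: algebra_simps insert_commute)
  also have "\<dots> = 0"
  proof (rule sum_antisymmetric)
    fix l m assume "l \<in> A - T" "m \<in> A - T" "l \<noteq> m"
    then show "f l m = - f m l"
      using fT by (auto simp: f_def sg_insert insert_commute)
  qed (use assms in auto)
  finally show ?thesis .
qed

text \<open>The Koszul homotopy formula. Equal indices contribute the terms with l in
  \<open>T\<close> through the first composite and those with l outside \<open>T\<close> through the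
  second; the mixed terms, which remove l and insert m in the two orders, cancel.\<close>

lemma ext_ctr:
  assumes "finite A" "T \<subseteq> A"
  shows "ext p (ctr A g \<phi>) T + ctr A g (ext p \<phi>) T = (\<Sum>l\<in>A. p l * g l) * \<phi> T"
proof -
  have fT: "finite T" using assms finite_subset by auto
  define f where "f = (\<lambda>l m. sg l T * sg m (T - {l}) * (p l * g m) * \<phi> (insert m (T - {l})))"
  have 1: "ext p (ctr A g \<phi>) T = (\<Sum>l\<in>T. p l * g l * \<phi> T) + (\<Sum>l\<in>T. \<Sum>m\<in>A - T. f l m)"
  proof -
    have "sg l T * p l * ctr A g \<phi> (T - {l}) = p l * g l * \<phi> T + (\<Sum>m\<in>A - T. f l m)" if "l \<in> T" for l
    proof -
      have "A - (T - {l}) = insert l (A - T)" "insert l (T - {l}) = T" using assms that by auto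
      then show ?thesis using that assms
        by (simp add: ctr_def f_def algebra_simps sum_distrib_left)
    qed
    then show ?thesis by (simp add: ext_def sum.distrib)
  qed
  have 2: "ctr A g (ext p \<phi>) T = (\<Sum>m\<in>A - T. p m * g m * \<phi> T) - (\<Sum>m\<in>A - T. \<Sum>l\<in>T. f l m)"
  proof -
    have "sg m T * g m * ext p \<phi> (insert m T) = p m * g m * \<phi> T - (\<Sum>l\<in>T. f l m)" if "m \<in> A - T" for m
    proof -
      have "sg m T * g m * (sg l (insert m T) * p l * \<phi> (insert m T - {l})) = - f l m" if "l \<in> T" for l
      proof -
        have "insert m T - {l} = insert m (T - {l})" "l \<noteq> m" using that \<open>m \<in> A - T\<close> by auto
        then show ?thesis using that fT \<open>m \<in> A - T\<close>
          by (auto simp: f_def sg_insert sg_remove algebra_simps)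
      qed
      moreover have "insert m T - {m} = T" using that by auto
      ultimately show ?thesis using that fT
        by (simp add: ext_def algebra_simps sum_distrib_left sum_negf)
    qed
    then show ?thesis by (simp add: ctr_def sum_subtractf)
  qed
  have "(\<Sum>l\<in>A. p l * g l * \<phi> T) = (\<Sum>l\<in>A - T. p l * g l * \<phi> T) + (\<Sum>l\<in>T. p l * g l * \<phi> T)"
    by (rule sum.subset_diff[OF assms(2,1)])
  moreover have "(\<Sum>m\<in>A - T. \<Sum>l\<in>T. f l m) = (\<Sum>l\<in>T. \<Sum>m\<in>A - T. f l m)"
    by (rule sum.swap)
  ultimately show ?thesis unfolding 1 2 sum_distrib_right by simp
qed

text \<open>Pairs (T, l) with l outside T correspond to pairs with l in T by inserting l, and
  \<open>sg l\<close> does not see whether l belongs to its argument.\<close>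

lemma ctr_ext_adjoint:
  assumes "finite A"
  shows "(\<Sum>T\<in>Pow A. \<phi> T * ctr A p \<psi> T) = (\<Sum>T\<in>Pow A. ext p \<phi> T * \<psi> T)"
proof -
  have "(\<Sum>T\<in>Pow A. \<phi> T * ctr A p \<psi> T)
      = (\<Sum>(T, l)\<in>Sigma (Pow A) (\<lambda>T. A - T). \<phi> T * (sg l T * p l * \<psi> (insert l T)))"
    unfolding ctr_def sum_distrib_left using assms by (subst sum.Sigma) auto
  also have "\<dots> = (\<Sum>(T, l)\<in>Sigma (Pow A) (\<lambda>T. T). sg l T * p l * \<phi> (T - {l}) * \<psi> T)"
    by (rule sum.reindex_bij_witness[where i = "\<lambda>(T, l). (T - {l}, l)" and j = "\<lambda>(T, l). (insert l T, l)"])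
      (auto simp: insert_absorb algebra_simps)
  also have "\<dots> = (\<Sum>T\<in>Pow A. ext p \<phi> T * \<psi> T)"
    unfolding ext_def sum_distrib_right using assms by (subst sum.Sigma) (auto intro: finite_subset)
  finally show ?thesis .
qed

lemma ctr_diff: "ctr A g (\<lambda>T. \<phi> T - \<psi> T) T = ctr A g \<phi> T - ctr A g \<psi> T"
  by (simp add: ctr_def algebra_simps sum_subtractf)

lemma ctr_scale: "ctr A g (\<lambda>T. c * \<phi> T) T = c * ctr A g \<phi> T"
  by (simp add: ctr_def algebra_simps sum_distrib_left)

lemma ctr_sum: "ctr A g (\<lambda>T. \<Sum>i\<in>I. \<phi> i T) T = (\<Sum>i\<in>I. ctr A g (\<phi> i) T)"
  by (simp add: ctr_def sum_distrib_left sum.swap[of _ I])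

lemma ctr_cong:
  assumes "T \<subseteq> A" "\<And>l. l \<in> A - T \<Longrightarrow> \<phi> (insert l T) = \<psi> (insert l T)"
  shows "ctr A g \<phi> T = ctr A g \<psi> T"
  using assms by (auto simp: ctr_def intro!: sum.cong)

lemma ext_cong:
  assumes "\<And>l. l \<in> T \<Longrightarrow> \<phi> (T - {l}) = \<psi> (T - {l})"
  shows "ext p \<phi> T = ext p \<psi> T"
  using assms by (auto simp: ext_def intro!: sum.cong)

lemma ext_diff: "ext p (\<lambda>T. \<phi> T - \<psi> T) T = ext p \<phi> T - ext p \<psi> T"
  by (simp add: ext_def algebra_simps sum_subtractf)

lemma ext_scale: "ext p (\<lambda>T. c * \<phi> T) T = c * ext p \<phi> T"
  by (simp add: ext_def algebra_simps sum_distrib_left)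

lemma ctr_zero [simp]: "ctr A g (\<lambda>T. 0) T = 0"
  by (simp add: ctr_def)

text \<open>Since \<open>ext_ctr\<close> makes exterior multiplication with a dual vector of \<open>p\<close> a contracting homotopy,
  \<open>\<psi>\<close> is itself a contraction with \<open>p\<close>.\<close>

lemma pairing_vanishes:
  fixes p :: "nat \<Rightarrow> 'a::field"
  assumes "finite A" "k \<in> A" "p k \<noteq> 0"
    and "\<And>T. T \<subseteq> A \<Longrightarrow> ext p \<xi> T = 0" "\<And>T. T \<subseteq> A \<Longrightarrow> ctr A p \<psi> T = 0"
  shows "(\<Sum>T\<in>Pow A. \<xi> T * \<psi> T) = 0"
proof -
  define e where "e = (\<lambda>l. if l = k then 1 / p k else 0)"
  have 1: "ctr A p (ext e \<psi>) T = \<psi> T" if "T \<subseteq> A" for T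
  proof -
    have "ext e (ctr A p \<psi>) T = ext e (\<lambda>T. 0) T"
      by (intro ext_cong assms) (use that in auto)
    then have "ext e (ctr A p \<psi>) T = 0" by (simp add: ext_def)
    moreover have "(\<Sum>l\<in>A. e l * p l) = 1"
      using assms by (simp add: e_def if_distrib[of "\<lambda>x. x * _"] sum.delta cong: if_cong)
    ultimately show ?thesis
      using ext_ctr[OF assms(1) that, of e p \<psi>] by simp
  qed
  have "(\<Sum>T\<in>Pow A. \<xi> T * \<psi> T) = (\<Sum>T\<in>Pow A. \<xi> T * ctr A p (ext e \<psi>) T)"
    using 1 by (intro sum.cong) auto
  also have "\<dots> = (\<Sum>T\<in>Pow A. ext p \<xi> T * ext e \<psi> T)"
    by (rule ctr_ext_adjoint[OF assms(1)])
  also have "\<dots> = 0" using assms(4) by (intro sum.neutral) auto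
  finally show ?thesis .
qed

text \<open>If \<open>p\<close> pairs with every \<open>g\<close> in the list to \<open>c\<close> times its scalar \<open>a\<close>, then exterior multiplication
  with \<open>p\<close> maps \<open>full_ctr\<close> to \<open>c\<close> times \<open>omit_ctr\<close>. So \<open>omit_ctr\<close> is the quotient by \<open>c\<close>, which makes
  sense and has the expected properties for \<open>c = 0\<close> also.\<close>

fun full_ctr :: "nat set \<Rightarrow> ((nat \<Rightarrow> 'a::comm_ring_1) \<times> 'a) list \<Rightarrow> nat set \<Rightarrow> 'a" where
  "full_ctr A [] = (\<lambda>T. if T = A then 1 else 0)"
| "full_ctr A ((g, a) # ks) = ctr A g (full_ctr A ks)"

fun omit_ctr :: "nat set \<Rightarrow> ((nat \<Rightarrow> 'a::comm_ring_1) \<times> 'a) list \<Rightarrow> nat set \<Rightarrow> 'a" where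
  "omit_ctr A [] = (\<lambda>T. 0)"
| "omit_ctr A ((g, a) # ks) = (\<lambda>T. a * full_ctr A ks T - ctr A g (omit_ctr A ks) T)"

lemma full_ctr_card: 
  "finite A \<Longrightarrow> T \<subseteq> A \<Longrightarrow> card T + length ks \<noteq> card A \<Longrightarrow> full_ctr A ks T = 0"
proof (induction ks arbitrary: T rule: full_ctr.induct)
  case (2 A g a ks)
  have "full_ctr A ks (insert l T) = 0" if "l \<in> A - T" for l
    using 2 that finite_subset[OF 2(3) 2(2)] by (intro "2.IH") auto
  then show ?case by (simp add: ctr_def)
qed auto

text \<open>Moving \<open>ext p\<close> past a contraction by \<open>ext_ctr\<close> adds the scalar
  product c a and changes the sign of the rest. This is c times the recursion that defines
  \<open>omit_ctr\<close>.\<close>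

lemma ext_full_ctr:
  assumes "finite A" "\<And>g a. (g, a) \<in> set ks \<Longrightarrow> (\<Sum>l\<in>A. p l * g l) = c * a" "T \<subseteq> A"
  shows "ext p (full_ctr A ks) T = c * omit_ctr A ks T"
  using assms(2,3)
proof (induction ks arbitrary: T)
  case Nil
  have "(T - {l} = A) = False" if "l \<in> T" for l using that Nil by auto
  then show ?case by (simp add: ext_def)
next
  case (Cons ga ks)
  obtain g a where ga: "ga = (g, a)" by force
  have "ctr A g (ext p (full_ctr A ks)) T = ctr A g (\<lambda>T. c * omit_ctr A ks T) T"
    using Cons by (intro ctr_cong) auto
  moreover have "(\<Sum>l\<in>A. p l * g l) = c * a" using Cons ga by auto
  ultimately show ?case
    using ext_ctr[OF assms(1) Cons.prems(2), of p g "full_ctr A ks"]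
    by (simp add: ga ctr_scale algebra_simps)
qed

text \<open>For c = 0 this cannot be deduced from \<open>ext_full_ctr\<close> by wedging with p once
  more, so the induction is repeated: the two terms with the factor a c cancel, and only the shorter
  list remains.\<close>

lemma ext_omit_ctr:
  assumes "finite A" "\<And>g a. (g, a) \<in> set ks \<Longrightarrow> (\<Sum>l\<in>A. p l * g l) = c * a" "T \<subseteq> A"
  shows "ext p (omit_ctr A ks) T = 0"
  using assms(2,3)
proof (induction ks arbitrary: T)
  case Nil
  then show ?case by (simp add: ext_def)
next
  case (Cons ga ks)
  obtain g a where ga: "ga = (g, a)" by force
  have "ctr A g (ext p (omit_ctr A ks)) T = ctr A g (\<lambda>T. 0) T"
    using Cons by (intro ctr_cong) auto
  moreover have "(\<Sum>l\<in>A. p l * g l) = c * a" using Cons ga by auto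
  moreover have "ext p (full_ctr A ks) T = c * omit_ctr A ks T"
    using Cons by (intro ext_full_ctr[OF assms(1)]) auto
  ultimately show ?case
    using ext_ctr[OF assms(1) Cons.prems(2), of p g "omit_ctr A ks"]
    by (simp add: ga ext_diff ext_scale algebra_simps)
qed

text \<open>\<open>full_ctr\<close> depends on the vectors alone, so \<open>omit_ctr\<close> is
  linear in the scalars and inherits the linear relations between them. The scalars will be the
  values of Gale vectors, with the points as index set.\<close>

lemma sum_omit_ctr:
  fixes ks :: "'i list"
  assumes "finite P" "\<And>k. k \<in> set ks \<Longrightarrow> (\<Sum>p\<in>P. x p * w k p) = 0"
  shows "(\<Sum>p\<in>P. x p * omit_ctr A (map (\<lambda>k. (g k, w k p)) ks) T) = 0"
  using assms(2)
proof (induction ks arbitrary: T)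
  case (Cons k ks)
  have *: "full_ctr A (map (\<lambda>k. (g k, w k p)) ks) = full_ctr A (map (\<lambda>k. (g k, 0)) ks)" for p
    by (induction ks) auto
  have "(\<Sum>p\<in>P. x p * omit_ctr A (map (\<lambda>k. (g k, w k p)) (k # ks)) T)
     = (\<Sum>p\<in>P. x p * w k p) * full_ctr A (map (\<lambda>k. (g k, 0)) ks) T 
       - ctr A (g k) (\<lambda>T. \<Sum>p\<in>P. x p * omit_ctr A (map (\<lambda>k. (g k, w k p)) ks) T) T"
    by (simp add: * algebra_simps sum_subtractf sum_distrib_left sum_distrib_right ctr_sum ctr_scale)
  then show ?case using Cons by simp
qed simp

text \<open>If the p and the g are dual up to the factors c, each wedge with \<open>p k\<close>
  undoes exactly the contraction with \<open>g k\<close>, and only the volume form is left.\<close>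

lemma iterated_ext_full_ctr:
  assumes "finite A" "distinct ks"
    and "\<And>k m. k \<in> set ks \<Longrightarrow> m \<in> set ks \<Longrightarrow> (\<Sum>l\<in>A. p m l * g k l) = (if k = m then c k else 0)"
    and "T \<subseteq> A"
  shows "fold (\<lambda>m. ext (p m)) ks (full_ctr A (map (\<lambda>k. (g k, b k)) ks)) T
    = prod_list (map c ks) * (if T = A then 1 else 0)"
  using assms(2-)
proof (induction ks arbitrary: T)
  case (Cons k ks)
  have lin: "fold (\<lambda>m. ext (p m)) ms (\<lambda>T. d * \<phi> T) T = d * fold (\<lambda>m. ext (p m)) ms \<phi> T" for ms d \<phi> T
    by (induction ms arbitrary: \<phi>) (simp_all add: ext_scale[abs_def])
  have cong: "fold (\<lambda>m. ext (p m)) ms \<phi> T = fold (\<lambda>m. ext (p m)) ms \<psi> T" 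
    if "\<And>T. T \<subseteq> A \<Longrightarrow> \<phi> T = \<psi> T" "T \<subseteq> A" for ms \<phi> \<psi> T
    using that
  proof (induction ms arbitrary: \<phi> \<psi> T)
    case (Cons m ms)
    show ?case unfolding fold_Cons comp_apply
      by (rule Cons.IH[OF _ Cons.prems(2)]) (intro ext_cong Cons.prems, auto)
  qed auto
  let ?F = "full_ctr A (map (\<lambda>k. (g k, b k)) ks)"
  \<comment> \<open>The remaining vectors all pair to 0 with \<open>p k\<close> because the list is
    distinct, so \<open>ext_full_ctr\<close> applies with c = 0.\<close>
  have van: "ext (p k) ?F S = 0" if "S \<subseteq> A" for S
  proof -
    have "(\<Sum>l\<in>A. p k l * h l) = 0 * a" if "(h, a) \<in> set (map (\<lambda>k. (g k, b k)) ks)" for h a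
    proof -
      obtain j where "j \<in> set ks" "h = g j" using \<open>(h, a) \<in> _\<close> by auto
      then show ?thesis using Cons.prems(1) Cons.prems(2)[of j k] by auto
    qed
    then have "ext (p k) ?F S = 0 * omit_ctr A (map (\<lambda>k. (g k, b k)) ks) S"
      by (intro ext_full_ctr[OF assms(1) _ that])
    then show ?thesis by simp
  qed
  have "ext (p k) (ctr A (g k) ?F) S = c k * ?F S" if "S \<subseteq> A" for S
  proof -
    have "ctr A (g k) (ext (p k) ?F) S = ctr A (g k) (\<lambda>T. 0) S"
      using that van by (intro ctr_cong) auto
    then show ?thesis using ext_ctr[OF assms(1) that, of "p k" "g k" ?F] Cons.prems by simp
  qed
  then have "fold (\<lambda>m. ext (p m)) ks (ext (p k) (ctr A (g k) ?F)) T
     = fold (\<lambda>m. ext (p m)) ks (\<lambda>S. c k * ?F S) T"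
    using Cons.prems by (intro cong) auto
  also have "\<dots> = c k * (prod_list (map c ks) * (if T = A then 1 else 0))"
    unfolding lin using Cons by simp
  finally show ?case by simp
qed simp

section \<open>Polynomials\<close>

abbreviation xv :: "'v \<Rightarrow> ('v, 'k::field) mpoly" where
  "xv l \<equiv> Poly_Mapping.single (Poly_Mapping.single l (Suc 0)) 1"

abbreviation coef :: "('v, 'k::field) mpoly \<Rightarrow> ('v \<Rightarrow>\<^sub>0 nat) \<Rightarrow> 'k" where
  "coef \<equiv> Poly_Mapping.lookup"

definition homog :: "nat \<Rightarrow> ('v, 'k::field) mpoly \<Rightarrow> bool" where
  "homog t f \<longleftrightarrow> (\<forall>m\<in>Poly_Mapping.keys f. mdeg m = t)"

lemma mpoly_sum_monomials: 
  assumes "finite S" "Poly_Mapping.keys f \<subseteq> S"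
  shows "(\<Sum>m\<in>S. Poly_Mapping.single m (coef f m)) = f"
proof (rule poly_mapping_eqI)
  fix k
  have "coef (\<Sum>m\<in>S. Poly_Mapping.single m (coef f m)) k = (\<Sum>m\<in>S. if m = k then coef f k else 0)"
    by (simp add: lookup_sum lookup_single when_def) (rule sum.cong, auto)
  also have "\<dots> = coef f k"
    using assms by (auto simp: sum.delta in_keys_iff)
  finally show "coef (\<Sum>m\<in>S. Poly_Mapping.single m (coef f m)) k = coef f k" .
qed

lemma single_mult_eq_sum:
  "Poly_Mapping.single k c * f = (\<Sum>m\<in>Poly_Mapping.keys f. Poly_Mapping.single (k + m) (c * coef f m))"
proof -
  have "Poly_Mapping.single k c * f
      = Poly_Mapping.single k c * (\<Sum>m\<in>Poly_Mapping.keys f. Poly_Mapping.single m (coef f m))"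
    by (simp add: mpoly_sum_monomials)
  then show ?thesis by (simp only: sum_distrib_left mult_single)
qed

lemma coef_single_mult: "coef (Poly_Mapping.single k c * f) (k + m) = c * coef f m"
proof -
  have "coef (Poly_Mapping.single k c * f) (k + m)
      = (\<Sum>m'\<in>Poly_Mapping.keys f. if m' = m then c * coef f m else 0)"
    unfolding single_mult_eq_sum by (simp add: lookup_sum lookup_single when_def)
  then show ?thesis by (auto simp: sum.delta in_keys_iff)
qed

lemma keys_single_mult: 
  "Poly_Mapping.keys (Poly_Mapping.single k c * f) \<subseteq> (+) k ` Poly_Mapping.keys f"
  using keys_mult[of "Poly_Mapping.single k c" f] by (auto split: if_splits)

lemma coef_mult_0: "coef (f * g) 0 = coef f 0 * coef g 0"
proof -
  let ?S = "insert 0 (Poly_Mapping.keys f)"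
  have *: "coef (Poly_Mapping.single m (coef f m) * g) 0 = (if m = 0 then coef f 0 * coef g 0 else 0)" for m
  proof (cases "m = 0")
    case True
    then show ?thesis using coef_single_mult[of 0 "coef f 0" g 0] by simp
  next
    case False
    have "m + m' \<noteq> 0" for m'
    proof
      assume "m + m' = 0"
      then have "Poly_Mapping.lookup (m + m') v = 0" for v by simp
      then have "m = 0" by (intro poly_mapping_eqI) (simp add: lookup_add)
      then show False using False by simp
    qed
    then have "0 \<notin> Poly_Mapping.keys (Poly_Mapping.single m (coef f m) * g)"
      using keys_single_mult[of m "coef f m" g] by (metis (no_types, opaque_lifting) imageE subsetD)
    then show ?thesis using False by (simp add: in_keys_iff)
  qed
  have "f * g = (\<Sum>m\<in>?S. Poly_Mapping.single m (coef f m)) * g"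
    by (subst mpoly_sum_monomials) auto
  then have "coef (f * g) 0 = (\<Sum>m\<in>?S. coef (Poly_Mapping.single m (coef f m) * g) 0)"
    by (simp only: sum_distrib_right lookup_sum)
  then show ?thesis by (simp only: *) (simp add: sum.delta)
qed

lemma mdeg_superset: "finite S \<Longrightarrow> Poly_Mapping.keys m \<subseteq> S \<Longrightarrow> mdeg m = (\<Sum>v\<in>S. Poly_Mapping.lookup m v)"
  unfolding mdeg_def by (rule sum.mono_neutral_left) (auto simp: in_keys_iff)

lemma mdeg_add: "mdeg (m + m') = mdeg m + mdeg m'"
proof -
  let ?S = "Poly_Mapping.keys m \<union> Poly_Mapping.keys m'"
  have "Poly_Mapping.keys (m + m') \<subseteq> ?S" by (rule keys_add)
  then show ?thesis
    by (subst (1 2 3) mdeg_superset[of ?S]) (auto simp: lookup_add sum.distrib)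
qed

lemma mdeg_0 [simp]: "mdeg 0 = 0"
  by (simp add: mdeg_def)

lemma mdeg_single [simp]: "mdeg (Poly_Mapping.single l n) = n"
  by (cases "n = 0") (simp_all add: mdeg_def)

lemma mdeg_eq_0_iff: "mdeg m = 0 \<longleftrightarrow> m = 0"
  by (auto simp: mdeg_def in_keys_iff intro!: poly_mapping_eqI)

lemma homog_0 [simp]: "homog t 0"
  by (simp add: homog_def)

lemma homog_add: "homog t f \<Longrightarrow> homog t g \<Longrightarrow> homog t (f + g)"
  using keys_add[of f g] by (auto simp: homog_def)

lemma keys_uminus_mpoly [simp]: "Poly_Mapping.keys (- f) = Poly_Mapping.keys (f :: ('v, 'k::field) mpoly)"
  by (auto simp: in_keys_iff)

lemma homog_uminus: "homog t f \<Longrightarrow> homog t (- f)"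
  by (simp add: homog_def)

lemma homog_diff: "homog t f \<Longrightarrow> homog t g \<Longrightarrow> homog t (f - g)"
  using homog_add[of t f "- g"] homog_uminus by auto

lemma homog_sum: "(\<And>i. i \<in> I \<Longrightarrow> homog t (f i)) \<Longrightarrow> homog t (\<Sum>i\<in>I. f i)"
  by (induction I rule: infinite_finite_induct) (auto intro: homog_add)

lemma homog_mult: "homog s f \<Longrightarrow> homog t g \<Longrightarrow> homog (s + t) (f * g)"
  using keys_mult[of f g] by (auto simp: homog_def mdeg_add dest!: subsetD)

lemma homog_single: "mdeg m = t \<Longrightarrow> homog t (Poly_Mapping.single m c)"
  by (simp add: homog_def)

lemma homog_xv [simp]: "homog (Suc 0) (xv l)"
  by (rule homog_single) simp

lemma homog_const [simp]: "homog 0 (Poly_Mapping.single 0 c)"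
  by (rule homog_single) simp

lemma homog_scale: "homog t f \<Longrightarrow> homog t (Poly_Mapping.single 0 c * f)"
  using homog_mult[of 0 "Poly_Mapping.single 0 c" t f] by simp

lemma coef_hom_part: "coef (hom_part t f) m = (if mdeg m = t then coef f m else 0)"
proof -
  have "coef (hom_part t f) m = (\<Sum>m'\<in>{m \<in> Poly_Mapping.keys f. mdeg m = t}. if m' = m then coef f m else 0)"
    unfolding hom_part_def by (simp add: lookup_sum lookup_single when_def)
  then show ?thesis by (auto simp: sum.delta in_keys_iff)
qed

lemma hom_part_add: "hom_part t (f + g) = hom_part t f + hom_part t g"
  by (rule poly_mapping_eqI) (simp add: coef_hom_part lookup_add)

lemma hom_part_0 [simp]: "hom_part t 0 = 0"
  by (rule poly_mapping_eqI) (simp add: coef_hom_part)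

lemma hom_part_diff: "hom_part t (f - g) = hom_part t f - hom_part t g"
  by (rule poly_mapping_eqI) (simp add: coef_hom_part lookup_minus)

lemma hom_part_sum: "hom_part t (\<Sum>i\<in>I. f i) = (\<Sum>i\<in>I. hom_part t (f i))"
  by (induction I rule: infinite_finite_induct) (auto simp: hom_part_add)

lemma keys_hom_part: "Poly_Mapping.keys (hom_part t f) = {m \<in> Poly_Mapping.keys f. mdeg m = t}"
  by (auto simp: in_keys_iff coef_hom_part split: if_splits)

lemma homog_hom_part [simp]: "homog t (hom_part t f)"
  by (auto simp: homog_def keys_hom_part)

lemma hom_part_homog: "homog s f \<Longrightarrow> hom_part t f = (if s = t then f else 0)"
  
proof (rule poly_mapping_eqI)
  fix k assume "homog s f"
  then have "coef f k = 0 \<or> mdeg k = s" by (auto simp: homog_def in_keys_iff)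
  then show "coef (hom_part t f) k = coef (if s = t then f else 0) k" by (auto simp: coef_hom_part)
qed

lemma sum_hom_parts: "(\<And>m. m \<in> Poly_Mapping.keys f \<Longrightarrow> mdeg m \<le> D) \<Longrightarrow> (\<Sum>t\<le>D. hom_part t f) = f"
  by (rule poly_mapping_eqI) (auto simp: lookup_sum coef_hom_part sum.delta' in_keys_iff)

lemma hom_part_mult_homog:
  assumes "homog s g"
  shows "hom_part t (g * f) = (if s \<le> t then g * hom_part (t - s) f else 0)"
proof -
  \<comment> \<open>A bound for the degrees in f; adding t keeps the index t - s within the range of
    summation even if f has small degree.\<close>
  define D where "D = Max (mdeg ` Poly_Mapping.keys f) + t"
  have D: "mdeg m \<le> D" if "m \<in> Poly_Mapping.keys f" for m
    unfolding D_def using that by (intro trans_le_add1) (auto intro: Max_ge)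
  have "hom_part t (g * f) = hom_part t (g * (\<Sum>u\<le>D. hom_part u f))"
    by (subst sum_hom_parts) (use D in auto)
  also have "\<dots> = (\<Sum>u\<le>D. if s + u = t then g * hom_part u f else 0)"
    by (simp only: sum_distrib_left hom_part_sum hom_part_homog[OF homog_mult[OF assms homog_hom_part]])
  also have "\<dots> = (\<Sum>u\<le>D. if u = t - s then (if s \<le> t then g * hom_part u f else 0) else 0)"
    by (intro sum.cong) auto
  also have "\<dots> = (if s \<le> t then g * hom_part (t - s) f else 0)"
    by (auto simp: sum.delta' sum.delta D_def)
  finally show ?thesis .
qed

lemma coord_ring_0 [simp]: "0 \<in> coord_ring r"
  by (simp add: coord_ring_def)

lemma coord_ring_add: "f \<in> coord_ring r \<Longrightarrow> g \<in> coord_ring r \<Longrightarrow> f + g \<in> coord_ring r"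
  using keys_add[of f g] unfolding coord_ring_def by blast

lemma coord_ring_uminus: "f \<in> coord_ring r \<Longrightarrow> - f \<in> coord_ring r"
  by (simp add: coord_ring_def)

lemma coord_ring_diff: "f \<in> coord_ring r \<Longrightarrow> g \<in> coord_ring r \<Longrightarrow> f - g \<in> coord_ring r"
  using coord_ring_add[of f r "- g"] coord_ring_uminus by auto

lemma coord_ring_sum: "(\<And>i. i \<in> I \<Longrightarrow> f i \<in> coord_ring r) \<Longrightarrow> (\<Sum>i\<in>I. f i) \<in> coord_ring r"
  by (induction I rule: infinite_finite_induct) (auto intro: coord_ring_add)

lemma coord_ring_mult:
  assumes "f \<in> coord_ring r" "g \<in> coord_ring r"
  shows "f * g \<in> coord_ring r"
  unfolding coord_ring_def
proof (intro CollectI ballI)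
  fix m assume "m \<in> Poly_Mapping.keys (f * g)"
  then obtain a b where "m = a + b" "a \<in> Poly_Mapping.keys f" "b \<in> Poly_Mapping.keys g"
    using keys_mult[of f g] by blast
  then show "Poly_Mapping.keys m \<subseteq> {..r}"
    using assms keys_add[of a b] unfolding coord_ring_def by blast
qed

lemma coord_ring_single: "Poly_Mapping.keys m \<subseteq> {..r} \<Longrightarrow> Poly_Mapping.single m c \<in> coord_ring r"
  by (simp add: coord_ring_def)

lemma coord_ring_const [simp]: "Poly_Mapping.single 0 c \<in> coord_ring r"
  by (rule coord_ring_single) simp

lemma coord_ring_1 [simp]: "1 \<in> coord_ring r"
  by (simp add: coord_ring_def)

lemma coord_ring_xv: "l \<le> r \<Longrightarrow> xv l \<in> coord_ring r"
  by (rule coord_ring_single) simp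

lemma coord_ring_minus_one_power: "(-1) ^ n \<in> coord_ring r"
  by (induction n) (auto intro: coord_ring_uminus)

lemma coord_ring_hom_part: "f \<in> coord_ring r \<Longrightarrow> hom_part t f \<in> coord_ring r"
  by (auto simp: coord_ring_def keys_hom_part)

lemma coord_ring_deg_iff: "f \<in> coord_ring_deg r t \<longleftrightarrow> f \<in> coord_ring r \<and> homog t f"
  by (auto simp: coord_ring_deg_def homog_def)

text \<open>Each monomial of f is assigned to one of the first n variables dividing it, and
  \<open>h l\<close> collects the quotients of the monomials assigned to l.\<close>

lemma variables_decomposition:
  assumes "f \<in> coord_ring r" "\<And>m. m \<in> Poly_Mapping.keys f \<Longrightarrow> \<exists>l<n. l \<in> Poly_Mapping.keys m"
  shows "\<exists>h. (\<forall>l<n. h l \<in> coord_ring r) \<and> f = (\<Sum>l<n. xv l * h l)"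
proof -
  obtain s where s: "\<And>m. m \<in> Poly_Mapping.keys f \<Longrightarrow> s m < n \<and> s m \<in> Poly_Mapping.keys m"
    using assms(2) by metis
  define e where "e = (\<lambda>m. m - Poly_Mapping.single (s m) (Suc 0))"
  define h where "h = (\<lambda>l. \<Sum>m\<in>{m \<in> Poly_Mapping.keys f. s m = l}. Poly_Mapping.single (e m) (coef f m))"
  have e: "Poly_Mapping.single (s m) (Suc 0) + e m = m" if "m \<in> Poly_Mapping.keys f" for m
  proof (rule poly_mapping_eqI)
    fix k
    have "Poly_Mapping.lookup m (s m) \<noteq> 0" using s[OF that] by (simp add: in_keys_iff)
    then show "Poly_Mapping.lookup (Poly_Mapping.single (s m) (Suc 0) + e m) k = Poly_Mapping.lookup m k"
      by (auto simp: e_def lookup_add lookup_minus lookup_single when_def)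
  qed
  have "Poly_Mapping.keys (e m) \<subseteq> {..r}" if "m \<in> Poly_Mapping.keys f" for m
  proof -
    have "Poly_Mapping.keys (e m) \<subseteq> Poly_Mapping.keys m"
      by (auto simp: e_def in_keys_iff lookup_minus)
    then show ?thesis using assms(1) that by (auto simp: coord_ring_def)
  qed
  then have "h l \<in> coord_ring r" for l
    unfolding h_def by (intro coord_ring_sum coord_ring_single) auto
  moreover have "f = (\<Sum>l<n. xv l * h l)"
  proof -
    have "xv l * h l = (\<Sum>m\<in>{m \<in> Poly_Mapping.keys f. s m = l}. Poly_Mapping.single m (coef f m))" for l
      unfolding h_def sum_distrib_left by (rule sum.cong) (use e in \<open>auto simp: mult_single\<close>)
    then have "(\<Sum>l<n. xv l * h l) = (\<Sum>m\<in>Poly_Mapping.keys f. Poly_Mapping.single m (coef f m))"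
      using s by (simp only:) (rule sum.group, auto)
    then show ?thesis by (simp add: mpoly_sum_monomials)
  qed
  ultimately show ?thesis by (intro exI[of _ h] conjI allI impI)
qed

text \<open>The variables form a regular sequence: a monomial that becomes divisible by an earlier
  variable after multiplication with variable n was divisible by it before. This is the algebraic
  input of Koszul exactness.\<close>

lemma variables_colon:
  assumes "f \<in> coord_ring r" "xv n * f = (\<Sum>l<n. xv l * g l)"
  shows "\<exists>h. (\<forall>l<n. h l \<in> coord_ring r) \<and> f = (\<Sum>l<n. xv l * h l)"
proof (rule variables_decomposition[OF assms(1)])
  fix m assume m: "m \<in> Poly_Mapping.keys f"
  let ?m = "Poly_Mapping.single n (Suc 0) + m"
  have "coef (xv n * f) ?m = coef f m"
    using coef_single_mult[of "Poly_Mapping.single n (Suc 0)" 1 f m] by simp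
  then have "?m \<in> Poly_Mapping.keys (\<Sum>l<n. xv l * g l)"
    using m assms(2) by (simp add: in_keys_iff)
  then have "\<not> (\<forall>l<n. coef (xv l * g l) ?m = 0)"
    by (auto simp: in_keys_iff lookup_sum intro: sum.neutral)
  then obtain l where l: "l < n" "?m \<in> Poly_Mapping.keys (xv l * g l)"
    by (auto simp: in_keys_iff)
  then obtain m' where "?m = Poly_Mapping.single l (Suc 0) + m'"
    using keys_single_mult[of "Poly_Mapping.single l (Suc 0)" 1 "g l"] by auto
  then have "Poly_Mapping.lookup ?m l = Poly_Mapping.lookup (Poly_Mapping.single l (Suc 0) + m') l" by simp
  then have "Poly_Mapping.lookup m l \<noteq> 0"
    using l(1) by (simp add: lookup_add lookup_single when_def)
  then show "\<exists>l<n. l \<in> Poly_Mapping.keys m" using l(1) by (auto simp: in_keys_iff)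
qed

section \<open>Evaluation\<close>

lemma field_embedding_facts:
  assumes "field_embedding \<iota>"
  shows "\<iota> 0 = 0" "\<iota> 1 = 1" "\<iota> (a + b) = \<iota> a + \<iota> b" "\<iota> (a * b) = \<iota> a * \<iota> b" "\<iota> (- a) = - \<iota> a"
proof -
  have add: "\<iota> (a + b) = \<iota> a + \<iota> b" for a b using assms by (simp add: field_embedding_def)
  show 0: "\<iota> 0 = 0" using add[of 0 0] by (metis add_cancel_right_right)
  show "\<iota> (- a) = - \<iota> a" using add[of a "- a"] 0 by (simp add: eq_neg_iff_add_eq_0 add.commute)
qed (use assms in \<open>auto simp: field_embedding_def\<close>)

lemma field_embedding_id: "field_embedding id"
  by (simp add: field_embedding_def)

definition mon_eval :: "('v \<Rightarrow> 'l::field) \<Rightarrow> ('v \<Rightarrow>\<^sub>0 nat) \<Rightarrow> 'l" where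
  "mon_eval x m = (\<Prod>v\<in>Poly_Mapping.keys m. x v ^ Poly_Mapping.lookup m v)"

lemma mon_eval_superset: 
  "finite S \<Longrightarrow> Poly_Mapping.keys m \<subseteq> S \<Longrightarrow> mon_eval x m = (\<Prod>v\<in>S. x v ^ Poly_Mapping.lookup m v)"
  unfolding mon_eval_def by (rule prod.mono_neutral_left) (auto simp: in_keys_iff)

lemma mon_eval_add: "mon_eval x (m + m') = mon_eval x m * mon_eval x m'"
proof -
  let ?S = "Poly_Mapping.keys m \<union> Poly_Mapping.keys m'"
  have "Poly_Mapping.keys (m + m') \<subseteq> ?S" by (rule keys_add)
  then show ?thesis
    by (subst (1 2 3) mon_eval_superset[of ?S]) (auto simp: lookup_add power_add prod.distrib)
qed

lemma mon_eval_scale: "mon_eval (\<lambda>v. c * x v) m = c ^ mdeg m * mon_eval x m"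
  by (simp add: mon_eval_def mdeg_def power_mult_distrib prod.distrib power_sum)

lemma mpoly_eval_superset:
  assumes "field_embedding \<iota>" "finite S" "Poly_Mapping.keys f \<subseteq> S"
  shows "mpoly_eval \<iota> x f = (\<Sum>m\<in>S. \<iota> (coef f m) * mon_eval x m)"
  unfolding mpoly_eval_def mon_eval_def
  by (rule sum.mono_neutral_left) (use assms in \<open>auto simp: in_keys_iff field_embedding_facts\<close>)

context
  fixes \<iota> :: "'k::field \<Rightarrow> 'l::field"
  assumes emb: "field_embedding \<iota>"
begin

lemma eval_add: "mpoly_eval \<iota> x (f + g) = mpoly_eval \<iota> x f + mpoly_eval \<iota> x g"
proof -
  let ?S = "Poly_Mapping.keys f \<union> Poly_Mapping.keys g"
  have "Poly_Mapping.keys (f + g) \<subseteq> ?S" by (rule keys_add)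
  then show ?thesis
    by (subst (1 2 3) mpoly_eval_superset[OF emb, of ?S]) 
      (auto simp: lookup_add field_embedding_facts[OF emb] sum.distrib algebra_simps)
qed

lemma eval_0 [simp]: "mpoly_eval \<iota> x 0 = 0"
  by (simp add: mpoly_eval_def)

lemma eval_uminus: "mpoly_eval \<iota> x (- f) = - mpoly_eval \<iota> x f"
  using eval_add[of x f "- f"] by (simp add: eq_neg_iff_add_eq_0 add.commute)

lemma eval_diff: "mpoly_eval \<iota> x (f - g) = mpoly_eval \<iota> x f - mpoly_eval \<iota> x g"
  using eval_add[of x f "- g"] by (simp add: eval_uminus)

lemma eval_sum: "mpoly_eval \<iota> x (\<Sum>i\<in>I. f i) = (\<Sum>i\<in>I. mpoly_eval \<iota> x (f i))"
  by (induction I rule: infinite_finite_induct) (auto simp: eval_add)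

lemma eval_single: "mpoly_eval \<iota> x (Poly_Mapping.single m c) = \<iota> c * mon_eval x m"
  by (subst mpoly_eval_superset[OF emb, of "{m}"]) auto

lemma eval_mult: "mpoly_eval \<iota> x (f * g) = mpoly_eval \<iota> x f * mpoly_eval \<iota> x g"
proof -
  have "f * g = (\<Sum>m\<in>Poly_Mapping.keys f. Poly_Mapping.single m (coef f m))
      * (\<Sum>m\<in>Poly_Mapping.keys g. Poly_Mapping.single m (coef g m))"
    by (simp only: mpoly_sum_monomials finite_keys subset_refl)
  then have "mpoly_eval \<iota> x (f * g) = (\<Sum>m\<in>Poly_Mapping.keys f. \<Sum>m'\<in>Poly_Mapping.keys g.
      (\<iota> (coef f m) * mon_eval x m) * (\<iota> (coef g m') * mon_eval x m'))"
    by (simp add: sum_product mult_single eval_sum eval_single field_embedding_facts[OF emb] 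
        mon_eval_add algebra_simps)
  then show ?thesis by (simp add: mpoly_eval_def sum_product mon_eval_def)
qed

lemma eval_const [simp]: "mpoly_eval \<iota> x (Poly_Mapping.single 0 c) = \<iota> c"
  by (simp add: eval_single mon_eval_def)

lemma eval_1 [simp]: "mpoly_eval \<iota> x 1 = 1"
  using eval_const[of x 1] field_embedding_facts[OF emb] by simp

lemma eval_xv [simp]: "mpoly_eval \<iota> x (xv l) = x l"
  using eval_single[of x "Poly_Mapping.single l (Suc 0)" 1] field_embedding_facts[OF emb]
  by (simp add: mon_eval_def)

lemma eval_prod: "mpoly_eval \<iota> x (\<Prod>i\<in>I. f i) = (\<Prod>i\<in>I. mpoly_eval \<iota> x (f i))"
  by (induction I rule: infinite_finite_induct) (auto simp: eval_mult)

lemma eval_power: "mpoly_eval \<iota> x (f ^ n) = mpoly_eval \<iota> x f ^ n"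
  by (induction n) (auto simp: eval_mult)

end

lemma eval_homog_scale:
  assumes "homog t f" "field_embedding \<iota>"
  shows "mpoly_eval \<iota> (\<lambda>v. c * x v) f = c ^ t * mpoly_eval \<iota> x f"
  unfolding mpoly_eval_superset[OF assms(2) finite_keys subset_refl] sum_distrib_left
  by (rule sum.cong) (use assms(1) in \<open>auto simp: mon_eval_scale homog_def algebra_simps\<close>)

section \<open>Exactness of the Koszul complex of the variables\<close>

text \<open>The degree q part of the Koszul complex on the first n variables, with coefficients in
  all r + 1 variables so that n can grow by induction. Values at sets not contained in {..<n} are
  left free.\<close>

definition koszul_chain :: "nat \<Rightarrow> nat \<Rightarrow> nat \<Rightarrow> (nat set \<Rightarrow> (nat, 'k::field) mpoly) \<Rightarrow> bool" where
  "koszul_chain r n q \<psi> \<longleftrightarrow> (\<forall>T\<subseteq>{..<n}. \<psi> T \<in> coord_ring r \<and> (card T \<noteq> q \<longrightarrow> \<psi> T = 0))"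

lemma koszul_chainD:
  assumes "koszul_chain r n q \<psi>" "T \<subseteq> {..<n}"
  shows "\<psi> T \<in> coord_ring r" "card T \<noteq> q \<Longrightarrow> \<psi> T = 0"
  using assms by (auto simp: koszul_chain_def)

lemma coord_ring_sg: "sg l T \<in> coord_ring r"
  unfolding sg_def by (rule coord_ring_minus_one_power)

text \<open>Splitting off the last index: a chain is the pair of its coefficients at T and at T with
  n inserted, and the differential is that of the mapping cone of multiplication by
  \<open>g n\<close>.\<close>

lemma ctr_lessThan_Suc:
  fixes g :: "nat \<Rightarrow> 'a::comm_ring_1"
  assumes "T \<subseteq> {..<n}"
  shows "ctr {..<Suc n} g \<psi> T = ctr {..<n} g \<psi> T + (-1) ^ card T * g n * \<psi> (insert n T)"
    and "ctr {..<Suc n} g \<psi> (insert n T) = ctr {..<n} g (\<lambda>T. \<psi> (insert n T)) T"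
proof -
  have fT: "finite T" and nT: "n \<notin> T" using assms by (auto intro: finite_subset)
  have "{..<Suc n} - T = insert n ({..<n} - T)" using nT by auto
  moreover have "sg n T = ((-1) ^ card T :: 'a)" by (rule sg_greatest) (use assms in auto)
  ultimately show "ctr {..<Suc n} g \<psi> T = ctr {..<n} g \<psi> T + (-1) ^ card T * g n * \<psi> (insert n T)"
    by (simp add: ctr_def)
  have "{..<Suc n} - insert n T = {..<n} - T" by auto
  then show "ctr {..<Suc n} g \<psi> (insert n T) = ctr {..<n} g (\<lambda>T. \<psi> (insert n T)) T"
    using fT nT by (auto simp: ctr_def sg_insert insert_commute intro!: sum.cong)
qed

text \<open>Degree 0 is where homology survives; the boundaries there are the elements of the ideal
  generated by the variables.\<close>

lemma koszul_boundary_degree_0: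
  assumes "\<And>l. l < n \<Longrightarrow> h l \<in> coord_ring r"
  shows "\<exists>\<phi>. koszul_chain r n 1 \<phi> \<and>
    (\<forall>T\<subseteq>{..<n}. ctr {..<n} xv \<phi> T = (if T = {} then \<Sum>l<n. xv l * h l else 0))"
proof -
  define \<phi> where "\<phi> = (\<lambda>T::nat set. if card T = 1 \<and> T \<subseteq> {..<n} then h (the_elem T) else 0)"
  have "koszul_chain r n 1 \<phi>"
    using assms by (auto simp: koszul_chain_def \<phi>_def card_1_singleton_iff)
  moreover have "ctr {..<n} xv \<phi> T = (if T = {} then \<Sum>l<n. xv l * h l else 0)" if T: "T \<subseteq> {..<n}" for T
  proof (cases "T = {}")
    case True
    then show ?thesis by (auto simp: ctr_def \<phi>_def sg_def intro!: sum.cong)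
  next
    case False
    have "finite T" using T finite_subset by blast
    then show ?thesis using False by (auto simp: ctr_def \<phi>_def intro!: sum.neutral)
  qed
  ultimately show ?thesis by blast
qed

text \<open>Induction along the mapping cone. The part \<open>\<psi>'\<close> with n inserted is a
  cycle of degree q - 1 and is filled by \<open>u\<close>; the part without n, corrected by
  \<open>u\<close>, is a cycle of degree q and is filled by \<open>v\<close>; \<open>u\<close> and
  \<open>v\<close> together fill \<open>\<psi>\<close>.\<close>

lemma koszul_exact:
  assumes "n \<le> Suc r" "0 < q" "koszul_chain r n q \<psi>" "\<And>T. T \<subseteq> {..<n} \<Longrightarrow> ctr {..<n} xv \<psi> T = 0"
  shows "\<exists>\<phi>. koszul_chain r n (Suc q) \<phi> \<and> (\<forall>T\<subseteq>{..<n}. ctr {..<n} xv \<phi> T = \<psi> T)"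
  using assms
proof (induction n arbitrary: q \<psi>)
  case 0
  then show ?case
    by (intro exI[of _ "\<lambda>T. 0"]) (auto simp: koszul_chain_def)
next
  case (Suc n)
  note chain = koszul_chainD[OF Suc.prems(3)]
  define \<psi>' where "\<psi>' = (\<lambda>T. \<psi> (insert n T))"
  have sub: "insert n T \<subseteq> {..<Suc n}" "T \<subseteq> {..<Suc n}" "finite T" "n \<notin> T" "card (insert n T) = Suc (card T)" 
    if "T \<subseteq> {..<n}" for T
  proof -
    show "finite T" "n \<notin> T" using that finite_subset by auto
    then show "card (insert n T) = Suc (card T)" by simp
  qed (use that in auto)
  have \<psi>'_chain: "koszul_chain r n (q - 1) \<psi>'"
    unfolding koszul_chain_def \<psi>'_def
  proof (intro allI impI conjI)
    fix T :: "nat set" assume T: "T \<subseteq> {..<n}"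
    show "\<psi> (insert n T) \<in> coord_ring r" by (rule chain(1)[OF sub(1)[OF T]])
    show "card T \<noteq> q - 1 \<Longrightarrow> \<psi> (insert n T) = 0"
      using chain(2)[OF sub(1)[OF T]] sub(5)[OF T] Suc.prems(2) by auto
  qed
  have \<psi>'_closed: "ctr {..<n} xv \<psi>' T = 0" if "T \<subseteq> {..<n}" for T
    using Suc.prems(4)[OF sub(1)[OF that]] ctr_lessThan_Suc(2)[OF that, of xv \<psi>] by (simp add: \<psi>'_def)
  have \<psi>_closed: "ctr {..<n} xv \<psi> T + (-1) ^ card T * xv n * \<psi>' T = 0" if "T \<subseteq> {..<n}" for T
    using Suc.prems(4)[OF sub(2)[OF that]] ctr_lessThan_Suc(1)[OF that, of xv \<psi>] by (simp add: \<psi>'_def)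
  have "\<exists>u. koszul_chain r n q u \<and> (\<forall>T\<subseteq>{..<n}. ctr {..<n} xv u T = \<psi>' T)"
  proof (cases "q = 1")
    case True
    have "xv n * \<psi>' {} = (\<Sum>l<n. xv l * (- \<psi> {l}))"
      using \<psi>_closed[of "{}"] by (simp add: ctr_def sg_def sum_negf eq_neg_iff_add_eq_0 add.commute)
    moreover have "\<psi>' {} \<in> coord_ring r" using koszul_chainD(1)[OF \<psi>'_chain, of "{}"] by simp
    ultimately obtain h where h: "\<And>l. l < n \<Longrightarrow> h l \<in> coord_ring r" "\<psi>' {} = (\<Sum>l<n. xv l * h l)"
      using variables_colon[of "\<psi>' {}" r n "\<lambda>l. - \<psi> {l}"] by blast
    obtain u where u: "koszul_chain r n 1 u"
      "\<And>T. T \<subseteq> {..<n} \<Longrightarrow> ctr {..<n} xv u T = (if T = {} then \<Sum>l<n. xv l * h l else 0)"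
      using koszul_boundary_degree_0[of n h r] h(1) by blast
    have "\<psi>' T = 0" if "T \<subseteq> {..<n}" "T \<noteq> {}" for T
      using koszul_chainD(2)[OF \<psi>'_chain that(1)] that sub(3)[OF that(1)] True by auto
    then show ?thesis using u h(2) True by (intro exI[of _ u]) auto
  next
    case False
    then have "0 < q - 1" using Suc.prems(2) by auto
    from Suc.IH[OF _ this \<psi>'_chain \<psi>'_closed] show ?thesis using Suc.prems(1,2) by auto
  qed
  then obtain u where u: "koszul_chain r n q u" "\<And>T. T \<subseteq> {..<n} \<Longrightarrow> ctr {..<n} xv u T = \<psi>' T" by blast
  \<comment> \<open>The sign is the one that \<open>ctr_lessThan_Suc\<close> attaches to
    \<open>u\<close> at sets of q elements, so that the correction is undone when \<open>u\<close>
    and \<open>v\<close> are glued.\<close>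
  define \<chi> where "\<chi> = (\<lambda>T. \<psi> T - (-1) ^ q * xv n * u T)"
  have \<chi>_chain: "koszul_chain r n q \<chi>"
    unfolding koszul_chain_def \<chi>_def
  proof (intro allI impI conjI)
    fix T :: "nat set" assume T: "T \<subseteq> {..<n}"
    show "\<psi> T - (-1) ^ q * xv n * u T \<in> coord_ring r"
      using Suc.prems(1) T sub(2)[OF T]
      by (intro coord_ring_diff coord_ring_mult coord_ring_minus_one_power coord_ring_xv chain(1) 
          koszul_chainD(1)[OF u(1)]) auto
    show "card T \<noteq> q \<Longrightarrow> \<psi> T - (-1) ^ q * xv n * u T = 0"
      using chain(2)[OF sub(2)[OF T]] koszul_chainD(2)[OF u(1) T] by simp
  qed
  have \<chi>_closed: "ctr {..<n} xv \<chi> T = 0" if T: "T \<subseteq> {..<n}" for T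
  proof -
    have 1: "ctr {..<n} xv \<chi> T = ctr {..<n} xv \<psi> T - (-1) ^ q * xv n * \<psi>' T"
      by (simp add: \<chi>_def ctr_diff ctr_scale u(2)[OF T])
    show ?thesis
    proof (cases "card T = q - 1")
      case True
      then have "q = Suc (card T)" using Suc.prems(2) by simp
      then have "(-1) ^ q * xv n * \<psi>' T = - ((-1) ^ card T * xv n * \<psi>' T)" by simp
      then show ?thesis using \<psi>_closed[OF T] unfolding 1 by (metis diff_minus_eq_add)
    next
      case False
      then show ?thesis using \<psi>_closed[OF T] koszul_chainD(2)[OF \<psi>'_chain T] by (simp add: 1)
    qed
  qed
  obtain v where v: "koszul_chain r n (Suc q) v" "\<And>T. T \<subseteq> {..<n} \<Longrightarrow> ctr {..<n} xv v T = \<chi> T"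
    using Suc.IH[OF _ Suc.prems(2) \<chi>_chain \<chi>_closed] Suc.prems(1) by auto
  define \<phi> where "\<phi> = (\<lambda>T. if n \<in> T then u (T - {n}) else v T)"
  have split: "T \<subseteq> {..<n} \<or> (\<exists>S\<subseteq>{..<n}. T = insert n S)" if "T \<subseteq> {..<Suc n}" for T
  proof (cases "n \<in> T")
    case True
    then have "T - {n} \<subseteq> {..<n}" "T = insert n (T - {n})" using that by auto
    then show ?thesis by (intro disjI2 exI[of _ "T - {n}"] conjI)
  next
    case False
    then have "T \<subseteq> {..<n}" using that by (simp add: lessThan_Suc subset_insert)
    then show ?thesis by simp
  qed
  have ins: "insert n T - {n} = T" if "T \<subseteq> {..<n}" for T
    using that by auto
  have "koszul_chain r (Suc n) (Suc q) \<phi>"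
    unfolding koszul_chain_def
  proof (intro allI impI)
    fix T :: "nat set" assume "T \<subseteq> {..<Suc n}"
    then consider "T \<subseteq> {..<n}" | S where "S \<subseteq> {..<n}" "T = insert n S" using split by blast
    then show "\<phi> T \<in> coord_ring r \<and> (card T \<noteq> Suc q \<longrightarrow> \<phi> T = 0)"
    proof cases
      case 1
      then show ?thesis using koszul_chainD[OF v(1) 1] sub(4)[OF 1] by (simp add: \<phi>_def)
    next
      case 2
      then show ?thesis using koszul_chainD[OF u(1) 2(1)] ins[OF 2(1)] sub(5)[OF 2(1)]
        by (simp add: \<phi>_def del: card_insert_disjoint)
    qed
  qed
  moreover have "ctr {..<Suc n} xv \<phi> T = \<psi> T" if T: "T \<subseteq> {..<Suc n}" for T
  proof -
    consider "T \<subseteq> {..<n}" | S where "S \<subseteq> {..<n}" "T = insert n S" using split[OF T] by blast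
    then show ?thesis
    proof cases
      case 1
      have "ctr {..<n} xv \<phi> T = ctr {..<n} xv v T"
        by (rule ctr_cong[OF 1]) (use sub(4)[OF 1] in \<open>auto simp: \<phi>_def\<close>)
      then have *: "ctr {..<Suc n} xv \<phi> T = \<psi> T - (-1) ^ q * xv n * u T + (-1) ^ card T * xv n * u T"
        using ctr_lessThan_Suc(1)[OF 1, of xv \<phi>] v(2)[OF 1] ins[OF 1] by (simp add: \<phi>_def \<chi>_def)
      show ?thesis
      proof (cases "card T = q")
        case False
        then show ?thesis unfolding * using koszul_chainD(2)[OF u(1) 1] by simp
      qed (simp add: *)
    next
      case 2
      have "ctr {..<n} xv (\<lambda>T. \<phi> (insert n T)) S = ctr {..<n} xv u S"
      proof (rule ctr_cong[OF 2(1)])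
        fix l assume "l \<in> {..<n} - S"
        then have "insert l S \<subseteq> {..<n}" using 2(1) by auto
        then show "\<phi> (insert n (insert l S)) = u (insert l S)"
          using ins[of "insert l S"] by (simp add: \<phi>_def)
      qed
      then show ?thesis using ctr_lessThan_Suc(2)[OF 2(1), of xv \<phi>] u(2)[OF 2(1)]
        by (simp add: 2(2) \<psi>'_def)
    qed
  qed
  ultimately show ?case by blast
qed

text \<open>On all r + 1 variables the augmented complex resolves k: positive degrees are
  \<open>koszul_exact\<close>, and in degree 0 the constant term is the only obstruction.\<close>

lemma koszul_augmented_exact:
  assumes "koszul_chain r (Suc r) q \<psi>" "\<And>T. T \<subseteq> {..<Suc r} \<Longrightarrow> ctr {..<Suc r} xv \<psi> T = 0"
    and "coef (\<psi> {}) 0 = 0"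
  shows "\<exists>\<phi>. koszul_chain r (Suc r) (Suc q) \<phi> \<and> (\<forall>T\<subseteq>{..<Suc r}. ctr {..<Suc r} xv \<phi> T = \<psi> T)"
proof (cases "q = 0")
  case True
  have *: "\<psi> {} \<in> coord_ring r" using koszul_chainD(1)[OF assms(1), of "{}"] by simp
  have "\<exists>l<Suc r. l \<in> Poly_Mapping.keys m" if m: "m \<in> Poly_Mapping.keys (\<psi> {})" for m
  proof -
    have "m \<noteq> 0" using m assms(3) by (auto simp: in_keys_iff)
    then obtain l where "l \<in> Poly_Mapping.keys m" by (metis keys_eq_empty all_not_in_conv)
    moreover have "Poly_Mapping.keys m \<subseteq> {..r}" using * m by (auto simp: coord_ring_def)
    ultimately show ?thesis by (intro exI[of _ l]) auto
  qed
  from variables_decomposition[OF * this] obtain h where h: "\<And>l. l < Suc r \<Longrightarrow> h l \<in> coord_ring r" 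
    "\<psi> {} = (\<Sum>l<Suc r. xv l * h l)" by blast
  have "\<psi> T = 0" if "T \<subseteq> {..<Suc r}" "T \<noteq> {}" for T
  proof -
    have "finite T" using that finite_subset by blast
    then show ?thesis using koszul_chainD(2)[OF assms(1) that(1)] that(2) True by auto
  qed
  then show ?thesis using koszul_boundary_degree_0[of "Suc r" h r, OF h(1)] h(2) True 
    by (metis (no_types, lifting) One_nat_def)
qed (use assms(1,2) koszul_exact[of "Suc r" r q \<psi>] in auto)

section \<open>Linear algebra\<close>

lemma sum_fun_apply: "(\<Sum>i\<in>I. f i) x = (\<Sum>i\<in>I. f i x)"
  by (induction I rule: infinite_finite_induct) auto

lemma (in vector_space) subspace_linear_combinations: "subspace {\<Sum>k<n. c k *s v k | c. True}"
proof (rule subspaceI)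
  have "(\<Sum>k<n. 0 *s v k) = 0" by (simp add: scale_zero_left)
  then show "0 \<in> {\<Sum>k<n. c k *s v k | c. True}"
    by (intro CollectI exI[of _ "\<lambda>k. 0"] conjI) simp_all
next
  fix x y assume "x \<in> {\<Sum>k<n. c k *s v k | c. True}" "y \<in> {\<Sum>k<n. c k *s v k | c. True}"
  then obtain a b where "x = (\<Sum>k<n. a k *s v k)" "y = (\<Sum>k<n. b k *s v k)" by auto
  then have "x + y = (\<Sum>k<n. (a k + b k) *s v k)" by (simp add: scale_left_distrib sum.distrib)
  then show "x + y \<in> {\<Sum>k<n. c k *s v k | c. True}" by (intro CollectI exI[of _ "\<lambda>k. a k + b k"] conjI) simp_all
next
  fix a x assume "x \<in> {\<Sum>k<n. c k *s v k | c. True}"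
  then obtain b where "x = (\<Sum>k<n. b k *s v k)" by auto
  then have "a *s x = (\<Sum>k<n. (a * b k) *s v k)" by (simp add: scale_sum_right)
  then show "a *s x \<in> {\<Sum>k<n. c k *s v k | c. True}" by (intro CollectI exI[of _ "\<lambda>k. a * b k"] conjI) simp_all
qed

text \<open>Independence modulo \<open>B\<close> is stated through families of coefficients, which
  also excludes repetitions in v; hence the cardinalities add up.\<close>

lemma (in vector_space) basis_modulo:
  fixes v :: "nat \<Rightarrow> 'b"
  assumes B: "subspace B" and \<beta>: "\<beta> \<subseteq> B" "independent \<beta>" "finite \<beta>"
    and v: "\<And>c. (\<Sum>k<n. c k *s v k) \<in> B \<Longrightarrow> \<forall>k<n. c k = 0"
  shows "independent (\<beta> \<union> v ` {..<n}) \<and> card (\<beta> \<union> v ` {..<n}) = card \<beta> + n"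
  using v
proof (induction n)
  case 0
  then show ?case using \<beta> by simp
next
  case (Suc n)
  have "\<forall>k<n. c k = 0" if "(\<Sum>k<n. c k *s v k) \<in> B" for c
  proof -
    have "(\<Sum>k<Suc n. (if k < n then c k else 0) *s v k) \<in> B"
      using that by simp
    from Suc.prems[OF this] have *: "k < Suc n \<Longrightarrow> (if k < n then c k else 0) = 0" for k by blast
    show ?thesis
    proof (intro allI impI)
      fix k assume "k < n"
      then show "c k = 0" using *[of k] by simp
    qed
  qed
  then have IH: "independent (\<beta> \<union> v ` {..<n})" "card (\<beta> \<union> v ` {..<n}) = card \<beta> + n"
    using Suc.IH by blast+
  have "v n \<notin> span (\<beta> \<union> v ` {..<n})"
  proof
    assume "v n \<in> span (\<beta> \<union> v ` {..<n})"
    then obtain x y where xy: "v n = x + y" "x \<in> span \<beta>" "y \<in> span (v ` {..<n})"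
      unfolding span_Un by auto
    have x: "x \<in> B" using xy(2) span_minimal[OF \<beta>(1) B] by blast
    have "v ` {..<n} \<subseteq> {\<Sum>k<n. c k *s v k | c. True}"
    proof clarify
      fix j assume "j < n"
      then have "v j = (\<Sum>k<n. (if k = j then 1 else 0) *s v k)"
        by (simp add: if_distrib[of "\<lambda>c. c *s _"] sum.delta cong: if_cong)
      then show "\<exists>c. v j = (\<Sum>k<n. c k *s v k) \<and> True" 
        by (intro exI[of _ "\<lambda>k. if k = j then 1 else 0"]) (simp only: simp_thms)
    qed
    then have "y \<in> {\<Sum>k<n. c k *s v k | c. True}"
      using xy(3) span_minimal[OF _ subspace_linear_combinations] by blast
    then obtain c where c: "y = (\<Sum>k<n. c k *s v k)" by auto
    have "(\<Sum>k<Suc n. (if k < n then - c k else 1) *s v k) = x"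
      unfolding sum.lessThan_Suc using c xy(1) by (simp add: sum_negf)
    then have "(\<Sum>k<Suc n. (if k < n then - c k else 1) *s v k) \<in> B" using x by (simp only:)
    from Suc.prems[OF this] have "(if n < n then - c n else 1) = 0" by blast
    then show False by simp
  qed
  then have "independent (insert (v n) (\<beta> \<union> v ` {..<n}))"
    by (rule independent_insertI) (rule IH(1))
  moreover have "v n \<notin> \<beta> \<union> v ` {..<n}"
    using \<open>v n \<notin> span _\<close> by (rule contrapos_nn) (rule span_base)
  moreover have "\<beta> \<union> v ` {..<Suc n} = insert (v n) (\<beta> \<union> v ` {..<n})"
    by (auto simp: lessThan_Suc)
  ultimately show ?case using IH(2) \<beta>(3) by simp
qed

text \<open>\<open>quot_dim\<close> subtracts two values of \<open>dim\<close>, which are meaningful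
  for spaces of finite dimension; the finite spanning set \<open>S\<close> guarantees this.\<close>

lemma quot_dim_ge:
  fixes scale :: "'k::field \<Rightarrow> 'b::ab_group_add \<Rightarrow> 'b" and v :: "nat \<Rightarrow> 'b"
  assumes "vector_space scale" "module.subspace scale B" "module.subspace scale Z" "B \<subseteq> Z"
    and "finite S" "Z \<subseteq> module.span scale S" "\<And>k. k < n \<Longrightarrow> v k \<in> Z"
    and "\<And>c. (\<Sum>k<n. scale (c k) (v k)) \<in> B \<Longrightarrow> \<forall>k<n. c k = 0"
  shows "n \<le> quot_dim scale Z B"
proof -
  interpret vector_space scale by fact
  obtain \<beta> where \<beta>: "\<beta> \<subseteq> B" "independent \<beta>" "B \<subseteq> span \<beta>" "card \<beta> = dim B"
    by (rule basis_exists)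
  have "finite \<beta>" using independent_span_bound[OF assms(5) \<beta>(2)] \<beta>(1) assms(4,6) by blast
  from basis_modulo[OF assms(2) \<beta>(1,2) this assms(8)]
  have ind: "independent (\<beta> \<union> v ` {..<n})" and card: "card (\<beta> \<union> v ` {..<n}) = dim B + n"
    using \<beta>(4) by auto
  have sub: "\<beta> \<union> v ` {..<n} \<subseteq> Z" using \<beta>(1) assms(4,7) by auto
  obtain \<zeta> where \<zeta>: "\<beta> \<union> v ` {..<n} \<subseteq> \<zeta>" "\<zeta> \<subseteq> Z" "independent \<zeta>" "Z \<subseteq> span \<zeta>"
    using maximal_independent_subset_extend[OF sub ind] by blast
  have "finite \<zeta>" using independent_span_bound[OF assms(5) \<zeta>(3)] \<zeta>(2) assms(6) by blast
  then have "dim B + n \<le> card \<zeta>" using card card_mono[OF _ \<zeta>(1)] by simp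
  also have "card \<zeta> = dim Z" using basis_card_eq_dim[OF \<zeta>(2,4,3)] .
  finally show ?thesis by (simp add: quot_dim_def)
qed

lemma quot_dim_eq:
  fixes scale :: "'k::field \<Rightarrow> 'b::ab_group_add \<Rightarrow> 'b" and v :: "nat \<Rightarrow> 'b"
  assumes "vector_space scale" "module.subspace scale B" "module.subspace scale Z" "B \<subseteq> Z"
    and "finite S" "Z \<subseteq> module.span scale S" "\<And>k. k < n \<Longrightarrow> v k \<in> Z"
    and "\<And>c. (\<Sum>k<n. scale (c k) (v k)) \<in> B \<Longrightarrow> \<forall>k<n. c k = 0"
    and "\<And>z. z \<in> Z \<Longrightarrow> \<exists>c. z - (\<Sum>k<n. scale (c k) (v k)) \<in> B"
  shows "quot_dim scale Z B = n"
proof -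
  interpret vector_space scale by fact
  obtain \<beta> where \<beta>: "\<beta> \<subseteq> B" "independent \<beta>" "B \<subseteq> span \<beta>" "card \<beta> = dim B"
    by (rule basis_exists)
  have "finite \<beta>" using independent_span_bound[OF assms(5) \<beta>(2)] \<beta>(1) assms(4,6) by blast
  from basis_modulo[OF assms(2) \<beta>(1,2) this assms(8)]
  have ind: "independent (\<beta> \<union> v ` {..<n})" and card: "card (\<beta> \<union> v ` {..<n}) = dim B + n"
    using \<beta>(4) by auto
  have sub: "\<beta> \<union> v ` {..<n} \<subseteq> Z" using \<beta>(1) assms(4,7) by auto
  have "Z \<subseteq> span (\<beta> \<union> v ` {..<n})"
  proof
    fix z assume "z \<in> Z"
    then obtain c where c: "z - (\<Sum>k<n. scale (c k) (v k)) \<in> B" using assms(9) by blast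
    have "z - (\<Sum>k<n. scale (c k) (v k)) \<in> span (\<beta> \<union> v ` {..<n})"
      using c \<beta>(3) span_mono[of \<beta> "\<beta> \<union> v ` {..<n}"] by blast
    moreover have "(\<Sum>k<n. scale (c k) (v k)) \<in> span (\<beta> \<union> v ` {..<n})"
      by (intro span_sum span_scale span_base) auto
    ultimately show "z \<in> span (\<beta> \<union> v ` {..<n})"
      by (metis diff_add_cancel span_add)
  qed
  from basis_card_eq_dim[OF sub this ind] show ?thesis using card by (simp add: quot_dim_def)
qed

text \<open>Gaussian elimination by induction on the equations: an equation with a nonzero
  coefficient at j expresses the unknown j through the others.\<close>

lemma nonzero_solution:
  fixes A :: "'e \<Rightarrow> 'i \<Rightarrow> 'a::field"
  assumes "finite E" "finite I" "card E < card I"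
  shows "\<exists>c. (\<exists>i\<in>I. c i \<noteq> 0) \<and> (\<forall>e\<in>E. (\<Sum>i\<in>I. A e i * c i) = 0)"
  using assms
proof (induction E arbitrary: I A rule: finite_induct)
  case empty
  then obtain i where "i \<in> I" by (metis card.empty card_gt_0_iff ex_in_conv)
  then show ?case by (intro exI[of _ "\<lambda>i. 1"]) auto
next
  case (insert e E)
  show ?case
  proof (cases "\<exists>j\<in>I. A e j \<noteq> 0")
    case False
    have "card E < card I" using insert by simp
    then obtain c where "\<exists>i\<in>I. c i \<noteq> 0" "\<forall>e\<in>E. (\<Sum>i\<in>I. A e i * c i) = 0"
      using insert.IH[OF insert.prems(1)] by blast
    then show ?thesis using False by (intro exI[of _ c]) auto
  next
    case True
    then obtain j where j: "j \<in> I" "A e j \<noteq> 0" by auto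
    define A' where "A' = (\<lambda>f i. A f i - A f j * A e i / A e j)"
    have "card E < card (I - {j})" using insert j by simp
    then obtain c where c: "\<exists>i\<in>I - {j}. c i \<noteq> 0" "\<And>f. f \<in> E \<Longrightarrow> (\<Sum>i\<in>I - {j}. A' f i * c i) = 0"
      using insert.IH[of "I - {j}" A'] insert.prems(1) by blast
    define s where "s = (\<Sum>i\<in>I - {j}. A e i * c i)"
    define c' where "c' = (\<lambda>i. if i = j then - s / A e j else c i)"
    have split: "(\<Sum>i\<in>I. A f i * c' i) = (\<Sum>i\<in>I - {j}. A f i * c i) - A f j * s / A e j" for f
    proof -
      have "(\<Sum>i\<in>I - {j}. A f i * c' i) = (\<Sum>i\<in>I - {j}. A f i * c i)"
        by (intro sum.cong) (auto simp: c'_def)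
      then show ?thesis using sum.remove[OF insert.prems(1) j(1), of "\<lambda>i. A f i * c' i"]
        by (simp add: c'_def)
    qed
    have "(\<Sum>i\<in>I. A e i * c' i) = 0" using j unfolding split by (simp add: s_def)
    moreover have "(\<Sum>i\<in>I. A f i * c' i) = 0" if "f \<in> E" for f
    proof -
      have "(\<Sum>i\<in>I - {j}. A' f i * c i) = (\<Sum>i\<in>I - {j}. A f i * c i) - A f j * s / A e j"
        by (simp add: A'_def s_def left_diff_distrib sum_subtractf sum_distrib_left sum_divide_distrib mult.assoc)
      then show ?thesis using c(2)[OF that] split by simp
    qed
    moreover have "\<exists>i\<in>I. c' i \<noteq> 0" using c(1) by (auto simp: c'_def)
    ultimately show ?thesis by blast
  qed
qed

text \<open>The right-hand side becomes the coefficient of one more unknown \<open>None\<close>. The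
  enlarged homogeneous system has a nonzero solution, injectivity makes its value at
  \<open>None\<close> nonzero, and one divides by it.\<close>

lemma square_system_solvable:
  fixes A :: "'e \<Rightarrow> 'i \<Rightarrow> 'a::field"
  assumes "finite E" "finite I" "card E = card I"
    and inj: "\<And>c. (\<And>e. e \<in> E \<Longrightarrow> (\<Sum>i\<in>I. A e i * c i) = 0) \<Longrightarrow> \<forall>i\<in>I. c i = 0"
  shows "\<exists>c. \<forall>e\<in>E. (\<Sum>i\<in>I. A e i * c i) = b e"
proof -
  let ?A = "\<lambda>e i. case i of None \<Rightarrow> - b e | Some i \<Rightarrow> A e i"
  let ?I = "insert None (Some ` I)"
  have "card E < card ?I" using assms by (simp add: card_image)
  then obtain c where c: "\<exists>i\<in>?I. c i \<noteq> 0" "\<forall>e\<in>E. (\<Sum>i\<in>?I. ?A e i * c i) = 0"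
    using nonzero_solution[of E ?I ?A] assms by blast
  have eq: "(\<Sum>i\<in>I. A e i * c (Some i)) = b e * c None" if "e \<in> E" for e
    using c(2) that assms(2) by (auto simp: sum.reindex)
  have "c None \<noteq> 0"
  proof
    assume "c None = 0"
    then have "\<forall>i\<in>I. c (Some i) = 0" using inj[of "\<lambda>i. c (Some i)"] eq by simp
    then show False using c(1) \<open>c None = 0\<close> by auto
  qed
  then have "(\<Sum>i\<in>I. A e i * (c (Some i) / c None)) = b e" if "e \<in> E" for e
    using eq[OF that] by (simp flip: sum_divide_distrib)
  then show ?thesis by (intro exI[of _ "\<lambda>i. c (Some i) / c None"]) auto
qed

text \<open>A square injective system is surjective: its solution for the unit vector at
  \<open>e0\<close>, paired with d, computes \<open>d e0\<close>.\<close>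

lemma transposed_injective:
  fixes A :: "'e \<Rightarrow> 'i \<Rightarrow> 'a::field"
  assumes "finite E" "finite I" "card E = card I"
    and inj: "\<And>c. (\<And>e. e \<in> E \<Longrightarrow> (\<Sum>i\<in>I. A e i * c i) = 0) \<Longrightarrow> \<forall>i\<in>I. c i = 0"
    and d: "\<And>i. i \<in> I \<Longrightarrow> (\<Sum>e\<in>E. A e i * d e) = 0"
  shows "\<forall>e\<in>E. d e = 0"
proof
  fix e0 assume e0: "e0 \<in> E"
  have "\<exists>c. \<forall>e\<in>E. (\<Sum>i\<in>I. A e i * c i) = (if e = e0 then 1 else 0)"
    by (rule square_system_solvable[OF assms(1-3)]) (rule inj)
  then obtain c where c: "\<And>e. e \<in> E \<Longrightarrow> (\<Sum>i\<in>I. A e i * c i) = (if e = e0 then 1 else 0)"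
    by auto
  have "d e0 = (\<Sum>e\<in>E. d e * (\<Sum>i\<in>I. A e i * c i))"
    using e0 assms(1) by (simp add: c if_distrib[of "(*) _"] sum.delta cong: if_cong)
  also have "\<dots> = (\<Sum>i\<in>I. c i * (\<Sum>e\<in>E. A e i * d e))"
    unfolding sum_distrib_left by (subst sum.swap) (simp add: mult_ac)
  also have "\<dots> = 0" using d by simp
  finally show "d e0 = 0" .
qed

section \<open>Existence of graded free resolutions\<close>

definition free_mod :: "nat \<Rightarrow> nat \<Rightarrow> (nat \<Rightarrow> (nat, 'k::field) mpoly) set" where
  "free_mod r n = {v. (\<forall>l<n. v l \<in> coord_ring r) \<and> (\<forall>l\<ge>n. v l = 0)}"

text \<open>Subtraction of naturals truncates, so an entry whose basis element has degree above t
  must be required to vanish separately.\<close>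

definition vec_homog :: "nat \<Rightarrow> (nat \<Rightarrow> nat) \<Rightarrow> nat \<Rightarrow> (nat \<Rightarrow> (nat, 'k::field) mpoly) \<Rightarrow> bool" where
  "vec_homog n s t v \<longleftrightarrow> (\<forall>a<n. if s a \<le> t then homog (t - s a) (v a) else v a = 0)"

definition vec_hom_part :: "nat \<Rightarrow> (nat \<Rightarrow> nat) \<Rightarrow> nat \<Rightarrow> (nat \<Rightarrow> (nat, 'k::field) mpoly) \<Rightarrow> nat \<Rightarrow> (nat, 'k) mpoly" where
  "vec_hom_part n s t v = (\<lambda>a. if a < n \<and> s a \<le> t then hom_part (t - s a) (v a) else 0)"

lemma free_modD:
  assumes "v \<in> free_mod r n"
  shows "v a \<in> coord_ring r" "n \<le> a \<Longrightarrow> v a = 0"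
  using assms by (cases "a < n"; simp add: free_mod_def)+

lemma vec_hom_part_free_mod: "v \<in> free_mod r n \<Longrightarrow> vec_hom_part n s t v \<in> free_mod r n"
  by (auto simp: vec_hom_part_def free_mod_def coord_ring_hom_part)

lemma vec_homog_hom_part: "vec_homog n s t (vec_hom_part n s t v)"
  by (simp add: vec_homog_def vec_hom_part_def)

lemma vec_hom_part_homog: 
  assumes "vec_homog n s t v" "v \<in> free_mod r n" 
  shows "vec_hom_part n s t v = v"
proof
  fix a
  show "vec_hom_part n s t v a = v a"
    using assms(1) free_modD(2)[OF assms(2), of a]
    by (cases "a < n") (auto simp: vec_homog_def vec_hom_part_def hom_part_homog)
qed

text \<open>A nonzero entry forces the row shift to be at most the column shift, which makes the
  truncated subtractions on both sides consistent.\<close>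

lemma mat_apply_vec_hom_part:
  assumes D: "\<And>a l m. a < p \<Longrightarrow> l < n \<Longrightarrow> m \<in> Poly_Mapping.keys (D a l) \<Longrightarrow> mdeg m + s a = s' l"
  shows "mat_apply p n D (vec_hom_part n s' t v) = vec_hom_part p s t (mat_apply p n D v)"
proof
  fix a
  show "mat_apply p n D (vec_hom_part n s' t v) a = vec_hom_part p s t (mat_apply p n D v) a"
  proof (cases "a < p")
    case True
    have "D a l * vec_hom_part n s' t v l = (if s a \<le> t then hom_part (t - s a) (D a l * v l) else 0)"
      if l: "l < n" for l
    proof (cases "D a l = 0")
      case False
      then obtain m where m: "m \<in> Poly_Mapping.keys (D a l)" by (metis keys_eq_empty all_not_in_conv)
      have D': "homog (s' l - s a) (D a l)" unfolding homog_def using D[OF True l] by force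
      have "s a \<le> s' l" using D[OF True l m] by simp
      then show ?thesis using l
        by (auto simp: vec_hom_part_def hom_part_mult_homog[OF D'])
    qed simp
    then show ?thesis
      using True by (auto simp: mat_apply_def vec_hom_part_def[of p] hom_part_sum)
  qed (simp add: mat_apply_def vec_hom_part_def)
qed

section \<open>Dickson's lemma, leading terms and finite generation\<close>

lemma finite_monomials: "finite {m :: nat \<Rightarrow>\<^sub>0 nat. Poly_Mapping.keys m \<subseteq> {..r} \<and> mdeg m = d}"
proof -
  let ?M = "{m :: nat \<Rightarrow>\<^sub>0 nat. Poly_Mapping.keys m \<subseteq> {..r} \<and> mdeg m = d}"
  let ?f = "\<lambda>m. restrict (Poly_Mapping.lookup m) {..r}"
  have "inj_on ?f ?M"
  proof (rule inj_onI, rule poly_mapping_eqI)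
    fix m m' :: "nat \<Rightarrow>\<^sub>0 nat" and k 
    assume mm: "m \<in> ?M" "m' \<in> ?M" "?f m = ?f m'"
    show "Poly_Mapping.lookup m k = Poly_Mapping.lookup m' k"
    proof (cases "k \<le> r")
      case True
      then show ?thesis using fun_cong[OF mm(3), of k] by simp
    next
      case False
      then have "k \<notin> Poly_Mapping.keys m" "k \<notin> Poly_Mapping.keys m'" using mm(1,2) by auto
      then show ?thesis by (simp add: in_keys_iff)
    qed
  qed
  moreover have "?f ` ?M \<subseteq> {..r} \<rightarrow>\<^sub>E {..d}"
  proof clarify
    fix m :: "nat \<Rightarrow>\<^sub>0 nat" assume m: "Poly_Mapping.keys m \<subseteq> {..r}"
    have "Poly_Mapping.lookup m k \<le> mdeg m" if "k \<le> r" for k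
      unfolding mdeg_superset[OF finite_atMost m] using that by (intro member_le_sum) auto
    then show "?f m \<in> {..r} \<rightarrow>\<^sub>E {..mdeg m}" by auto
  qed
  moreover have "finite ({..r} \<rightarrow>\<^sub>E {..d})" by (intro finite_PiE) auto
  ultimately show ?thesis using finite_imageD finite_subset by blast
qed

text \<open>A finite \<open>B\<close> for the coordinates other than x dominates all elements whose
  x-coordinate is at least \<open>K\<close>, the maximum of the x-coordinates in \<open>B\<close>.
  Each of the finitely many slices below \<open>K\<close> gets its own finite set.\<close>

lemma dickson:
  fixes S :: "('v \<Rightarrow> nat) set"
  assumes "finite V"
  shows "\<exists>B\<subseteq>S. finite B \<and> (\<forall>f\<in>S. \<exists>g\<in>B. \<forall>i\<in>V. g i \<le> f i)"
  using assms
proof (induction V arbitrary: S rule: finite_induct)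
  case empty
  show ?case
  proof (cases "S = {}")
    case False
    then obtain f where "f \<in> S" by blast
    then show ?thesis by (intro exI[of _ "{f}"]) auto
  qed auto
next
  case (insert x V)
  obtain B where B: "B \<subseteq> S" "finite B" "\<And>f. f \<in> S \<Longrightarrow> \<exists>g\<in>B. \<forall>i\<in>V. g i \<le> f i"
    using insert.IH[of S] by auto
  define K where "K = Max (insert 0 ((\<lambda>g. g x) ` B))"
  have K: "g x \<le> K" if "g \<in> B" for g
    unfolding K_def using that B(2) by (intro Max_ge) auto
  have "\<forall>k. \<exists>C. C \<subseteq> {f \<in> S. f x = k} \<and> finite C \<and> (\<forall>f\<in>{f \<in> S. f x = k}. \<exists>g\<in>C. \<forall>i\<in>V. g i \<le> f i)"
    using insert.IH by blast
  from choice[OF this] obtain C where C0: "\<forall>k. C k \<subseteq> {f \<in> S. f x = k} \<and> finite (C k) \<and> 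
    (\<forall>f\<in>{f \<in> S. f x = k}. \<exists>g\<in>C k. \<forall>i\<in>V. g i \<le> f i)" ..
  have C: "C k \<subseteq> {f \<in> S. f x = k}" "finite (C k)" 
    "f \<in> S \<Longrightarrow> f x = k \<Longrightarrow> \<exists>g\<in>C k. \<forall>i\<in>V. g i \<le> f i" for k f
    using C0[rule_format, of k] by blast+
  have "\<exists>g\<in>B \<union> (\<Union>k<K. C k). \<forall>i\<in>insert x V. g i \<le> f i" if f: "f \<in> S" for f
  proof (cases "f x < K")
    case True
    obtain g where g: "g \<in> C (f x)" "\<forall>i\<in>V. g i \<le> f i" using C(3)[OF f refl] by auto
    then have "g x = f x" using C(1) by auto
    then show ?thesis using g True by (intro bexI[of _ g]) auto
  next
    case False
    obtain g where g: "g \<in> B" "\<forall>i\<in>V. g i \<le> f i" using B(3)[OF f] by auto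
    then show ?thesis using K[OF g(1)] False by (intro bexI[of _ g]) auto
  qed
  moreover have "B \<union> (\<Union>k<K. C k) \<subseteq> S" using B(1) C(1) by blast
  moreover have "finite (B \<union> (\<Union>k<K. C k))" using B(2) C(2) by auto
  ultimately show ?case by blast
qed

lemma dickson_monomials:
  assumes "\<And>m. m \<in> M \<Longrightarrow> Poly_Mapping.keys m \<subseteq> {..r}"
  shows "\<exists>B\<subseteq>M. finite B \<and> (\<forall>m\<in>M. \<exists>b\<in>B. \<exists>k. m = b + (k :: nat \<Rightarrow>\<^sub>0 nat))"
proof -
  obtain B where B: "B \<subseteq> Poly_Mapping.lookup ` M" "finite B"
    "\<And>f. f \<in> Poly_Mapping.lookup ` M \<Longrightarrow> \<exists>g\<in>B. \<forall>i\<in>{..r}. g i \<le> f i"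
    using dickson[of "{..r}" "Poly_Mapping.lookup ` M"] by auto
  obtain C where C: "C \<subseteq> M" "finite C" "B = Poly_Mapping.lookup ` C"
    using finite_subset_image[OF B(2,1)] by blast
  have "\<exists>b\<in>C. \<exists>k. m = b + k" if m: "m \<in> M" for m
  proof -
    obtain b where b: "b \<in> C" "\<And>i. i \<le> r \<Longrightarrow> Poly_Mapping.lookup b i \<le> Poly_Mapping.lookup m i"
      using B(3)[of "Poly_Mapping.lookup m"] m C(3) by auto
    have "m = b + (m - b)"
    proof (rule poly_mapping_eqI)
      fix i
      have "Poly_Mapping.lookup b i \<le> Poly_Mapping.lookup m i"
      proof (cases "i \<le> r")
        case False
        then have "i \<notin> Poly_Mapping.keys b" using assms[of b] b(1) C(1) by auto
        then show ?thesis by (simp add: in_keys_iff)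
      qed (rule b(2))
      then show "Poly_Mapping.lookup m i = Poly_Mapping.lookup (b + (m - b)) i"
        by (simp add: lookup_add lookup_minus)
    qed
    then show ?thesis using b(1) by blast
  qed
  then show ?thesis using C(1,2) by blast
qed

text \<open>Terms are ordered by position first; within the last nonzero component the greatest
  monomial leads, in a linear order compatible with addition.\<close>

definition lead_pos :: "(nat \<Rightarrow> (nat, 'k::field) mpoly) \<Rightarrow> nat" where
  "lead_pos v = Max {l. v l \<noteq> 0}"

definition lead_mon :: "(nat \<Rightarrow> (nat, 'k::field) mpoly) \<Rightarrow> nat \<Rightarrow>\<^sub>0 nat" where
  "lead_mon v = Max (Poly_Mapping.keys (v (lead_pos v)))"

lemma lead_term:
  assumes "v \<in> free_mod r n" "v \<noteq> (\<lambda>a. 0)"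
  shows "lead_pos v < n" "v (lead_pos v) \<noteq> 0" "\<And>l. v l \<noteq> 0 \<Longrightarrow> l \<le> lead_pos v"
    "lead_mon v \<in> Poly_Mapping.keys (v (lead_pos v))"
    "\<And>m. m \<in> Poly_Mapping.keys (v (lead_pos v)) \<Longrightarrow> m \<le> lead_mon v"
proof -
  have sub: "{l. v l \<noteq> 0} \<subseteq> {..<n}" using free_modD(2)[OF assms(1)] by (auto simp: not_le[symmetric])
  have fin: "finite {l. v l \<noteq> 0}" using finite_subset[OF sub] by simp
  have ne: "{l. v l \<noteq> 0} \<noteq> {}" using assms(2) by auto
  have "lead_pos v \<in> {l. v l \<noteq> 0}" unfolding lead_pos_def by (rule Max_in[OF fin ne])
  then show 1: "v (lead_pos v) \<noteq> 0" and "lead_pos v < n" using sub by auto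
  show "l \<le> lead_pos v" if "v l \<noteq> 0" for l
    unfolding lead_pos_def using that fin by (intro Max_ge) auto
  have ne': "Poly_Mapping.keys (v (lead_pos v)) \<noteq> {}" using 1 by simp
  show "lead_mon v \<in> Poly_Mapping.keys (v (lead_pos v))"
    unfolding lead_mon_def by (rule Max_in[OF finite_keys ne'])
  show "m \<le> lead_mon v" if "m \<in> Poly_Mapping.keys (v (lead_pos v))" for m
    unfolding lead_mon_def using that by (intro Max_ge) auto
qed

definition graded_submodule :: "nat \<Rightarrow> nat \<Rightarrow> (nat \<Rightarrow> nat) \<Rightarrow> (nat \<Rightarrow> (nat, 'k::field) mpoly) set \<Rightarrow> bool" where
  "graded_submodule r n s N \<longleftrightarrow> N \<subseteq> free_mod r n \<and> (\<lambda>a. 0) \<in> N \<and>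
     (\<forall>u\<in>N. \<forall>v\<in>N. (\<lambda>a. u a + v a) \<in> N) \<and>
     (\<forall>f\<in>coord_ring r. \<forall>v\<in>N. (\<lambda>a. f * v a) \<in> N) \<and>
     (\<forall>t. \<forall>v\<in>N. vec_hom_part n s t v \<in> N)"

text \<open>Division by the w: subtracting a multiple of some \<open>w b\<close> cancels the leading
  term. In a fixed degree only finitely many terms lie below it, and counting them gives
  termination.\<close>

lemma homogeneous_elements_generated:
  fixes N :: "(nat \<Rightarrow> (nat, 'k::field) mpoly) set" and w :: "nat \<Rightarrow> nat \<Rightarrow> (nat, 'k) mpoly"
  assumes N: "graded_submodule r n s N"
    and w: "\<And>b. b < p \<Longrightarrow> w b \<in> N \<and> w b \<noteq> (\<lambda>a. 0) \<and> vec_homog n s (s' b) (w b)"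
    and dom: "\<And>v t. v \<in> N \<Longrightarrow> v \<noteq> (\<lambda>a. 0) \<Longrightarrow> vec_homog n s t v \<Longrightarrow> 
      \<exists>b<p. \<exists>k. lead_pos v = lead_pos (w b) \<and> lead_mon v = lead_mon (w b) + k"
    and v: "v \<in> N" "vec_homog n s t v"
  shows "\<exists>h. (\<forall>b<p. h b \<in> coord_ring r) \<and> v = (\<lambda>a. \<Sum>b<p. h b * w b a)"
proof -
  \<comment> \<open>All terms of degree t. Positions with shift above t contribute a spurious
    monomial 1, which only enlarges a finite set.\<close>
  define Tm where "Tm = Sigma {..<n} (\<lambda>l. {m :: nat \<Rightarrow>\<^sub>0 nat. Poly_Mapping.keys m \<subseteq> {..r} \<and> mdeg m = t - s l})"
  define below where "below = (\<lambda>v :: nat \<Rightarrow> (nat, 'k) mpoly. 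
    {(l, m) \<in> Tm. l < lead_pos v \<or> l = lead_pos v \<and> m < lead_mon v})"
  have finTm: "finite Tm" unfolding Tm_def using finite_monomials by blast
  have NM: "N \<subseteq> free_mod r n" using N by (simp add: graded_submodule_def)
  show ?thesis using v
  proof (induction "card (below v)" arbitrary: v rule: less_induct)
    case less
    show ?case
    proof (cases "v = (\<lambda>a. 0)")
      case True
      then show ?thesis by (intro exI[of _ "\<lambda>b. 0"]) auto
    next
      case False
      note lv = lead_term[OF subsetD[OF NM less.prems(1)] False]
      obtain b k where b: "b < p" "lead_pos v = lead_pos (w b)" "lead_mon v = lead_mon (w b) + k"
        using dom[OF less.prems(1) False less.prems(2)] by blast
      note lw = lead_term[OF subsetD[OF NM conjunct1[OF w[OF b(1)]]] conjunct1[OF conjunct2[OF w[OF b(1)]]]]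
      define l where "l = lead_pos v"
      have sl: "s l \<le> t" "homog (t - s l) (v l)"
        using less.prems(2) lv(1,2) unfolding vec_homog_def l_def by (auto split: if_splits)
      have degv: "mdeg (lead_mon v) = t - s l" using lv(4) sl(2) by (auto simp: homog_def l_def)
      have slw: "s l \<le> s' b" "homog (s' b - s l) (w b l)"
        using w[OF b(1)] lw(1,2) b(2) unfolding vec_homog_def l_def by (auto split: if_splits)
      have degw: "mdeg (lead_mon (w b)) = s' b - s l" using lw(4) slw(2) b(2) by (auto simp: homog_def l_def)
      have degk: "mdeg k + s' b = t" using degv degw b(3) sl(1) slw(1) by (simp add: mdeg_add)
      have keysk: "Poly_Mapping.keys k \<subseteq> {..r}"
      proof -
        have "Poly_Mapping.keys (lead_mon v) \<subseteq> {..r}"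
          using lv(4) free_modD(1)[OF subsetD[OF NM less.prems(1)]] by (auto simp: coord_ring_def)
        moreover have "Poly_Mapping.keys k \<subseteq> Poly_Mapping.keys (lead_mon v)"
          by (auto simp: b(3) in_keys_iff lookup_add)
        ultimately show ?thesis by blast
      qed
      define c where "c = coef (v l) (lead_mon v) / coef (w b l) (lead_mon (w b))"
      define g where "g = Poly_Mapping.single k c"
      have g: "g \<in> coord_ring r" "homog (mdeg k) g" 
        unfolding g_def using keysk by (auto intro: coord_ring_single homog_single)
      define u where "u = (\<lambda>a. v a - g * w b a)"
      have "u = (\<lambda>a. v a + (- g) * w b a)" by (simp add: u_def)
      moreover have "(\<lambda>a. (- g) * w b a) \<in> N"
        using N w[OF b(1)] coord_ring_uminus[OF g(1)] unfolding graded_submodule_def by blast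
      moreover have "(\<lambda>a. x a + y a) \<in> N" if "x \<in> N" "y \<in> N" for x y
        using N that unfolding graded_submodule_def by blast
      ultimately have uN: "u \<in> N" using less.prems(1) by blast
      have uh: "vec_homog n s t u"
        unfolding vec_homog_def
      proof (intro allI impI)
        fix a assume a: "a < n"
        have 1: "if s a \<le> s' b then homog (s' b - s a) (w b a) else w b a = 0"
          using w[OF b(1)] a by (simp add: vec_homog_def)
        have 2: "if s a \<le> t then homog (t - s a) (v a) else v a = 0"
          using less.prems(2) a by (simp add: vec_homog_def)
        show "if s a \<le> t then homog (t - s a) (u a) else u a = 0"
        proof (cases "s a \<le> s' b")
          case True
          then have "homog (mdeg k + (s' b - s a)) (g * w b a)" using 1 by (intro homog_mult g(2)) simp
          moreover have "mdeg k + (s' b - s a) = t - s a" "s a \<le> t" using True degk by auto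
          ultimately show ?thesis using 2 by (simp add: u_def homog_diff)
        next
          case False
          then show ?thesis using 1 2 by (simp add: u_def)
        qed
      qed
      have u_pos: "a \<le> l" if "u a \<noteq> 0" for a
      proof -
        have "v a \<noteq> 0 \<or> w b a \<noteq> 0" using that by (auto simp: u_def)
        then show ?thesis using lv(3)[of a] lw(3)[of a] b(2) by (auto simp: l_def)
      qed
      have u_mon: "m < lead_mon v" if m: "m \<in> Poly_Mapping.keys (u l)" for m
      proof -
        have "coef (u l) (lead_mon v) = coef (v l) (lead_mon v) - c * coef (w b l) (lead_mon (w b))"
          unfolding u_def g_def b(3) by (simp add: lookup_minus coef_single_mult add.commute[of _ k])
        also have "\<dots> = 0" using lw(4) b(2) by (simp add: c_def l_def in_keys_iff)
        finally have "m \<noteq> lead_mon v" using m by (auto simp: in_keys_iff)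
        moreover have "m \<le> lead_mon v"
        proof -
          have "m \<in> Poly_Mapping.keys (v l) \<or> m \<in> Poly_Mapping.keys (g * w b l)"
            using m by (auto simp: u_def in_keys_iff lookup_minus)
          then show ?thesis
          proof
            assume "m \<in> Poly_Mapping.keys (g * w b l)"
            then obtain m' where m': "m = k + m'" "m' \<in> Poly_Mapping.keys (w b l)"
              using keys_single_mult[of k c "w b l"] unfolding g_def by blast
            have "m' \<le> lead_mon (w b)" using lw(5) m'(2) b(2) by (simp add: l_def)
            then show ?thesis unfolding m'(1) b(3) by (simp add: add.commute[of _ k])
          qed (use lv(5) in \<open>simp add: l_def\<close>)
        qed
        ultimately show ?thesis by simp
      qed
      have "\<exists>h. (\<forall>b<p. h b \<in> coord_ring r) \<and> u = (\<lambda>a. \<Sum>b<p. h b * w b a)"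
      proof (cases "u = (\<lambda>a. 0)")
        case True
        then show ?thesis by (intro exI[of _ "\<lambda>b. 0"]) auto
      next
        case False
        note lu = lead_term[OF subsetD[OF NM uN] False]
        have ul: "lead_pos u < l \<or> lead_pos u = l \<and> lead_mon u < lead_mon v"
          using u_pos[OF lu(2)] u_mon lu(4) by (cases "lead_pos u = l") auto
        have "(lead_pos u, lead_mon u) \<in> Tm"
        proof -
          have "homog (t - s (lead_pos u)) (u (lead_pos u))"
            using uh lu(1,2) unfolding vec_homog_def by (auto split: if_splits)
          then have "mdeg (lead_mon u) = t - s (lead_pos u)" using lu(4) by (auto simp: homog_def)
          moreover have "Poly_Mapping.keys (lead_mon u) \<subseteq> {..r}"
            using lu(4) free_modD(1)[OF subsetD[OF NM uN]] by (auto simp: coord_ring_def)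
          ultimately show ?thesis using lu(1) by (simp add: Tm_def)
        qed
        then have "(lead_pos u, lead_mon u) \<in> below v" using ul by (simp add: below_def l_def)
        moreover have "(lead_pos u, lead_mon u) \<notin> below u" by (simp add: below_def)
        moreover have "below u \<subseteq> below v"
          using ul by (auto simp: below_def l_def)
        ultimately have "below u \<subset> below v" by blast
        moreover have "finite (below v)" using finTm by (rule rev_finite_subset) (auto simp: below_def)
        ultimately have "card (below u) < card (below v)" by (intro psubset_card_mono)
        from less.hyps[OF this uN uh] show ?thesis .
      qed
      then obtain h where h: "\<And>b. b < p \<Longrightarrow> h b \<in> coord_ring r" "u = (\<lambda>a. \<Sum>b<p. h b * w b a)" by blast
      define h' where "h' = (\<lambda>b'. h b' + (if b' = b then g else 0))"
      have "v a = (\<Sum>b'<p. h' b' * w b' a)" for a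
      proof -
        have "(\<Sum>b'<p. h' b' * w b' a) = u a + (\<Sum>b'<p. (if b' = b then g * w b a else 0))"
          unfolding h(2) h'_def sum.distrib[symmetric] by (intro sum.cong) (auto simp: algebra_simps)
        then show ?thesis using b(1) by (simp add: u_def)
      qed
      moreover have "h' b' \<in> coord_ring r" if "b' < p" for b'
        using h(1)[OF that] g(1) by (auto simp: h'_def coord_ring_add)
      ultimately show ?thesis by (intro exI[of _ h']) auto
    qed
  qed
qed

lemma vec_sum_hom_parts:
  assumes "v \<in> free_mod r n"
  shows "\<exists>D. v = (\<lambda>a. \<Sum>t\<le>D. vec_hom_part n s t v a)"
proof -
  \<comment> \<open>Sums instead of maxima bound all the degrees without a case distinction for zero
    entries.\<close>
  define D where "D = (\<Sum>a<n. s a + (\<Sum>m\<in>Poly_Mapping.keys (v a). mdeg m))"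
  have "v a = (\<Sum>t\<le>D. vec_hom_part n s t v a)" for a
  proof (cases "a < n")
    case True
    have "coef (\<Sum>t\<le>D. vec_hom_part n s t v a) m = coef (v a) m" for m
    proof (cases "m \<in> Poly_Mapping.keys (v a)")
      case m: True
      have "mdeg m \<le> (\<Sum>m\<in>Poly_Mapping.keys (v a). mdeg m)" using m by (intro member_le_sum) auto
      then have "mdeg m + s a \<le> s a + (\<Sum>m\<in>Poly_Mapping.keys (v a). mdeg m)" by simp
      also have "\<dots> \<le> D" unfolding D_def using True by (intro member_le_sum) auto
      finally have D: "mdeg m + s a \<le> D" .
      have "coef (\<Sum>t\<le>D. vec_hom_part n s t v a) m = (\<Sum>t\<le>D. if t = mdeg m + s a then coef (v a) m else 0)"
        unfolding lookup_sum using True by (intro sum.cong) (auto simp: vec_hom_part_def coef_hom_part)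
      then show ?thesis using D by simp
    next
      case False
      then show ?thesis
        unfolding lookup_sum using True by (auto simp: vec_hom_part_def coef_hom_part in_keys_iff intro!: sum.neutral)
    qed
    then show ?thesis by (intro poly_mapping_eqI) simp
  next
    case False
    then show ?thesis using free_modD(2)[OF assms, of a] by (simp add: vec_hom_part_def)
  qed
  then show ?thesis by (intro exI[of _ D]) (rule HOL.ext)
qed

text \<open>Hilbert's basis theorem in graded form: Dickson's lemma is applied to the leading
  monomials at each leading position. Homogeneous elements are enough because N contains the
  components of its elements.\<close>

lemma graded_submodule_finitely_generated:
  fixes N :: "(nat \<Rightarrow> (nat, 'k::field) mpoly) set"
  assumes N: "graded_submodule r n s N"
  shows "\<exists>p s' D. (\<forall>a<n. \<forall>b<p. D a b \<in> coord_ring r \<and> (\<forall>m\<in>Poly_Mapping.keys (D a b). mdeg m + s a = s' b)) \<and>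
    mat_apply n p D ` free_mod r p = N"
proof -
  have NM: "N \<subseteq> free_mod r n" using N by (simp add: graded_submodule_def)
  define H where "H = {v \<in> N. v \<noteq> (\<lambda>a. 0) \<and> (\<exists>t. vec_homog n s t v)}"
  have "\<exists>B\<subseteq>H. finite B \<and> (\<forall>v\<in>H. lead_pos v = l \<longrightarrow> (\<exists>w\<in>B. lead_pos w = l \<and> (\<exists>k. lead_mon v = lead_mon w + k)))" for l
  proof -
    have "Poly_Mapping.keys m \<subseteq> {..r}" if m: "m \<in> lead_mon ` {v \<in> H. lead_pos v = l}" for m
    proof -
      obtain v where v: "v \<in> H" "m = lead_mon v" using m by auto
      then have "v \<in> free_mod r n" "v \<noteq> (\<lambda>a. 0)" using NM by (auto simp: H_def)
      from lead_term(4)[OF this] free_modD(1)[OF this(1)] show ?thesis by (auto simp: v(2) coord_ring_def)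
    qed
    from dickson_monomials[of "lead_mon ` {v \<in> H. lead_pos v = l}", OF this]
    obtain B where B: "B \<subseteq> lead_mon ` {v \<in> H. lead_pos v = l}" "finite B"
      "\<And>m. m \<in> lead_mon ` {v \<in> H. lead_pos v = l} \<Longrightarrow> \<exists>b\<in>B. \<exists>k. m = b + k" by auto
    obtain C where C: "C \<subseteq> {v \<in> H. lead_pos v = l}" "finite C" "B = lead_mon ` C"
      using finite_subset_image[OF B(2,1)] by blast
    have "\<exists>w\<in>C. lead_pos w = l \<and> (\<exists>k. lead_mon v = lead_mon w + k)" if "v \<in> H" "lead_pos v = l" for v
    proof -
      have "lead_mon v \<in> lead_mon ` {v \<in> H. lead_pos v = l}" using that by simp
      from B(3)[OF this] obtain w k where "w \<in> C" "lead_mon v = lead_mon w + k" using C(3) by auto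
      then show ?thesis using C(1) by auto
    qed
    then show ?thesis using C(1,2) by (intro exI[of _ C]) auto
  qed
  then have "\<forall>l. \<exists>B. B \<subseteq> H \<and> finite B \<and> (\<forall>v\<in>H. lead_pos v = l \<longrightarrow> (\<exists>w\<in>B. lead_pos w = l \<and> (\<exists>k. lead_mon v = lead_mon w + k)))"
    by auto
  from choice[OF this] obtain B where B0: "\<forall>l. B l \<subseteq> H \<and> finite (B l) \<and> 
    (\<forall>v\<in>H. lead_pos v = l \<longrightarrow> (\<exists>w\<in>B l. lead_pos w = l \<and> (\<exists>k. lead_mon v = lead_mon w + k)))" ..
  have B: "B l \<subseteq> H" "finite (B l)" for l
    using B0[rule_format, of l] by blast+
  have B3: "\<exists>w\<in>B (lead_pos v). lead_pos w = lead_pos v \<and> (\<exists>k. lead_mon v = lead_mon w + k)" if "v \<in> H" for v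
    using B0[rule_format, of "lead_pos v"] that by blast
  have "finite (\<Union>l<n. B l)" using B(2) by auto
  then obtain p w where w: "(\<Union>l<n. B l) = w ` {..<p::nat}"
    using finite_imp_nat_seg_image_inj_on[of "\<Union>l<n. B l"] by (auto simp: lessThan_def)
  have wH: "w b \<in> H" if "b < p" for b
    using w B(1) that by (metis (no_types, lifting) UN_E imageI lessThan_iff subsetD)
  then have "\<forall>b. \<exists>t. b < p \<longrightarrow> vec_homog n s t (w b)" by (auto simp: H_def)
  from choice[OF this] obtain s' where s': "\<And>b. b < p \<Longrightarrow> vec_homog n s (s' b) (w b)" by auto
  have wp: "w b \<in> N \<and> w b \<noteq> (\<lambda>a. 0) \<and> vec_homog n s (s' b) (w b)" if "b < p" for b
    using wH[OF that] s'[OF that] by (auto simp: H_def)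
  have dom: "\<exists>b<p. \<exists>k. lead_pos v = lead_pos (w b) \<and> lead_mon v = lead_mon (w b) + k"
    if v: "v \<in> N" "v \<noteq> (\<lambda>a. 0)" "vec_homog n s t v" for v t
  proof -
    have "v \<in> H" using v by (auto simp: H_def)
    from B3[OF this] obtain x k where x: "x \<in> B (lead_pos v)" "lead_pos x = lead_pos v" "lead_mon v = lead_mon x + k"
      by auto
    have "lead_pos v < n" using lead_term(1) NM v(1,2) by blast
    then have "x \<in> (\<Union>l<n. B l)" using x(1) by auto
    then obtain b where "b < p" "x = w b" using w by auto
    then show ?thesis using x(2,3) by auto
  qed
  define G where "G = {(\<lambda>a. \<Sum>b<p. h b * w b a) | h. \<forall>b<p. h b \<in> coord_ring r}"
  have "N \<subseteq> G"
  proof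
    fix v assume v: "v \<in> N"
    then obtain D where D: "v = (\<lambda>a. \<Sum>t\<le>D. vec_hom_part n s t v a)" 
      using vec_sum_hom_parts[of v r n s] NM by auto
    have "\<forall>t. \<exists>h. (\<forall>b<p. h b \<in> coord_ring r) \<and> vec_hom_part n s t v = (\<lambda>a. \<Sum>b<p. h b * w b a)"
    proof
      fix t
      have "vec_hom_part n s t v \<in> N" using N v by (simp add: graded_submodule_def)
      from homogeneous_elements_generated[OF N wp dom this vec_homog_hom_part]
      show "\<exists>h. (\<forall>b<p. h b \<in> coord_ring r) \<and> vec_hom_part n s t v = (\<lambda>a. \<Sum>b<p. h b * w b a)" by auto
    qed
    from choice[OF this] obtain h where h: "\<And>t b. b < p \<Longrightarrow> h t b \<in> coord_ring r" 
      "\<And>t. vec_hom_part n s t v = (\<lambda>a. \<Sum>b<p. h t b * w b a)" by auto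
    have "v = (\<lambda>a. \<Sum>b<p. (\<Sum>t\<le>D. h t b) * w b a)"
      by (subst D, unfold h(2), subst sum.swap) (simp add: sum_distrib_right)
    then show "v \<in> G" unfolding G_def using h(1) by (auto intro!: exI[of _ "\<lambda>b. \<Sum>t\<le>D. h t b"] coord_ring_sum)
  qed
  moreover have "G \<subseteq> N"
  proof
    fix v assume "v \<in> G"
    then obtain h where h: "v = (\<lambda>a. \<Sum>b<p. h b * w b a)" "\<And>b. b < p \<Longrightarrow> h b \<in> coord_ring r"
      by (auto simp: G_def)
    have "(\<lambda>a. \<Sum>b<q. h b * w b a) \<in> N" if "q \<le> p" for q
      using that
    proof (induction q)
      case 0
      then show ?case using N by (simp add: graded_submodule_def)
    next
      case (Suc q)
      then have "(\<lambda>a. h q * w q a) \<in> N" using N h(2)[of q] wp[of q] by (simp add: graded_submodule_def)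
      then show ?case using N Suc by (simp add: graded_submodule_def)
    qed
    then show "v \<in> N" unfolding h(1) by simp
  qed
  moreover have "mat_apply n p (\<lambda>a b. w b a) ` free_mod r p = G"
  proof -
    have ma: "mat_apply n p (\<lambda>a b. w b a) h = (\<lambda>a. \<Sum>b<p. h b * w b a)" for h
    proof
      fix a
      have "w b a = 0" if "b < p" "n \<le> a" for b
        using free_modD(2)[of "w b" r n a] wp[OF that(1)] NM that(2) by auto
      then show "mat_apply n p (\<lambda>a b. w b a) h a = (\<Sum>b<p. h b * w b a)"
        by (auto simp: mat_apply_def mult.commute)
    qed
    show ?thesis
    proof (intro equalityI subsetI)
      fix v assume "v \<in> G"
      then obtain h where h: "v = (\<lambda>a. \<Sum>b<p. h b * w b a)" "\<And>b. b < p \<Longrightarrow> h b \<in> coord_ring r"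
        by (auto simp: G_def)
      define h' where "h' = (\<lambda>b. if b < p then h b else 0)"
      have "h' \<in> free_mod r p" using h(2) by (simp add: h'_def free_mod_def)
      moreover have "v = mat_apply n p (\<lambda>a b. w b a) h'" by (simp add: ma h(1) h'_def)
      ultimately show "v \<in> mat_apply n p (\<lambda>a b. w b a) ` free_mod r p" by simp
    next
      fix v assume "v \<in> mat_apply n p (\<lambda>a b. w b a) ` free_mod r p"
      then show "v \<in> G" using free_modD(1) by (fastforce simp: ma G_def)
    qed
  qed
  moreover have "w b a \<in> coord_ring r \<and> (\<forall>m\<in>Poly_Mapping.keys (w b a). mdeg m + s a = s' b)" if "a < n" "b < p" for a b
  proof -
    have "if s a \<le> s' b then homog (s' b - s a) (w b a) else w b a = 0"
      using s'[OF that(2)] that(1) by (simp add: vec_homog_def)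
    then have "\<forall>m\<in>Poly_Mapping.keys (w b a). mdeg m + s a = s' b" by (auto simp: homog_def split: if_splits)
    moreover have "w b \<in> free_mod r n" using wp[OF that(2)] NM by auto
    ultimately show ?thesis using free_modD(1) by blast
  qed
  ultimately show ?thesis by (intro exI[of _ p] exI[of _ s'] exI[of _ "\<lambda>a b. w b a"]) auto
qed

section \<open>The resolution by iterated syzygies\<close>

lemma graded_kernel:
  assumes "\<And>a l. a < p \<Longrightarrow> l < n \<Longrightarrow> D a l \<in> coord_ring r \<and> (\<forall>m\<in>Poly_Mapping.keys (D a l). mdeg m + s a = s' l)"
  shows "graded_submodule r n s' {v \<in> free_mod r n. mat_apply p n D v = (\<lambda>a. 0)}"
proof -
  have part: "mat_apply p n D (vec_hom_part n s' t v) = (\<lambda>a. 0)" if "mat_apply p n D v = (\<lambda>a. 0)" for t v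
  proof -
    have "mat_apply p n D (vec_hom_part n s' t v) = vec_hom_part p s t (mat_apply p n D v)"
      by (rule mat_apply_vec_hom_part) (use assms in blast)
    then show ?thesis by (simp add: that vec_hom_part_def fun_eq_iff)
  qed
  have add: "mat_apply p n D (\<lambda>a. u a + v a) = (\<lambda>a. mat_apply p n D u a + mat_apply p n D v a)" for u v
    by (simp add: mat_apply_def fun_eq_iff algebra_simps sum.distrib)
  have mult: "mat_apply p n D (\<lambda>a. f * v a) = (\<lambda>a. f * mat_apply p n D v a)" for f v
    by (simp add: mat_apply_def fun_eq_iff sum_distrib_left mult.left_commute)
  have zero: "mat_apply p n D (\<lambda>a. 0) = (\<lambda>a. 0)" by (simp add: mat_apply_def fun_eq_iff)
  show ?thesis
    unfolding graded_submodule_def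
    by (auto simp: part add mult zero vec_hom_part_free_mod) (auto simp: free_mod_def coord_ring_add coord_ring_mult)
qed

text \<open>Dependent choice of states, each consisting of a rank, shifts and a graded submodule
  still to be covered: homogeneous generators are chosen, and their relations form the next
  submodule.\<close>

theorem graded_free_resolution_exists:
  fixes I :: "(nat, 'k::field) mpoly set"
  assumes I: "I \<subseteq> coord_ring r" "0 \<in> I" "\<And>f g. f \<in> I \<Longrightarrow> g \<in> I \<Longrightarrow> f + g \<in> I"
    "\<And>f g. f \<in> coord_ring r \<Longrightarrow> g \<in> I \<Longrightarrow> f * g \<in> I" "\<And>t f. f \<in> I \<Longrightarrow> hom_part t f \<in> I"
  shows "\<exists>F. graded_free_resolution r I F"
proof -
  \<comment> \<open>\<open>I\<close> inside the free module of rank 1, so that the first step has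
    the same shape as the later ones.\<close>
  define N0 where "N0 = {v \<in> free_mod r 1. v 0 \<in> I}"
  define hommat where "hommat = (\<lambda>n s p s' (D :: nat \<Rightarrow> nat \<Rightarrow> (nat, 'k) mpoly). \<forall>a<n. \<forall>b<p. D a b \<in> coord_ring r \<and> 
    (\<forall>m\<in>Poly_Mapping.keys (D a b). mdeg m + s a = (s' b :: nat)))"
  define P where "P = (\<lambda>i (n, s, N). graded_submodule r n s N \<and> (i = (0::nat) \<longrightarrow> n = 1 \<and> s = (\<lambda>l. 0) \<and> N = N0))"
  define Q where "Q = (\<lambda>(i::nat) (n, s, N) (p, s', N'). \<exists>D. hommat n s p s' D \<and> mat_apply n p D ` free_mod r p = N \<and>
    N' = {v \<in> free_mod r p. mat_apply n p D v = (\<lambda>a. 0)})"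
  have "graded_submodule r 1 (\<lambda>l. 0) N0"
    unfolding graded_submodule_def N0_def using I
    by (auto simp: free_mod_def vec_hom_part_def coord_ring_add coord_ring_mult coord_ring_hom_part)
  then have P0: "\<exists>x. P 0 x" by (intro exI[of _ "(1, \<lambda>l. 0, N0)"]) (simp add: P_def)
  have step: "\<exists>y. P (Suc i) y \<and> Q i x y" if "P i x" for i x
  proof -
    obtain n s N where x: "x = (n, s, N)" by (cases x) auto
    with that have "graded_submodule r n s N" by (simp add: P_def)
    from graded_submodule_finitely_generated[OF this] obtain p s' D where D: "hommat n s p s' D" 
      "mat_apply n p D ` free_mod r p = N" unfolding hommat_def by blast
    let ?N = "{v \<in> free_mod r p. mat_apply n p D v = (\<lambda>a. 0)}"
    have "graded_submodule r p s' ?N"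
      by (rule graded_kernel[where s = s]) (use D(1) in \<open>simp add: hommat_def\<close>)
    then have "P (Suc i) (p, s', ?N)" by (simp add: P_def)
    moreover have "Q i x (p, s', ?N)" using D by (auto simp: Q_def x)
    ultimately show ?thesis by blast
  qed
  obtain st where st: "\<And>i. P i (st i)" "\<And>i. Q i (st i) (st (Suc i))"
    using dependent_nat_choice[of P Q, OF P0 step] by auto
  define n where "n = (\<lambda>i. fst (st i))"
  define s where "s = (\<lambda>i. fst (snd (st i)))"
  define N where "N = (\<lambda>i. snd (snd (st i)))"
  have st_eq: "st i = (n i, s i, N i)" for i by (simp add: n_def s_def N_def)
  have "\<forall>i. \<exists>D. hommat (n i) (s i) (n (Suc i)) (s (Suc i)) D \<and> mat_apply (n i) (n (Suc i)) D ` free_mod r (n (Suc i)) = N i \<and>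
    N (Suc i) = {v \<in> free_mod r (n (Suc i)). mat_apply (n i) (n (Suc i)) D v = (\<lambda>a. 0)}"
    using st(2) unfolding st_eq Q_def by simp
  from choice[OF this] obtain D where D0: "\<forall>i. hommat (n i) (s i) (n (Suc i)) (s (Suc i)) (D i) \<and> 
    mat_apply (n i) (n (Suc i)) (D i) ` free_mod r (n (Suc i)) = N i \<and>
    N (Suc i) = {v \<in> free_mod r (n (Suc i)). mat_apply (n i) (n (Suc i)) (D i) v = (\<lambda>a. 0)}" ..
  have D: "hommat (n i) (s i) (n (Suc i)) (s (Suc i)) (D i)"
    "mat_apply (n i) (n (Suc i)) (D i) ` free_mod r (n (Suc i)) = N i"
    "N (Suc i) = {v \<in> free_mod r (n (Suc i)). mat_apply (n i) (n (Suc i)) (D i) v = (\<lambda>a. 0)}" for i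
    using D0[rule_format, of i] by blast+
  have zero: "n 0 = 1" "s 0 = (\<lambda>l. 0)" "N 0 = N0" using st(1)[of 0] unfolding st_eq P_def by auto
  define F where "F = \<lparr>fr_rank = n, fr_shift = s, fr_diff = (\<lambda>i. D (i - 1))\<rparr>"
  have mod: "fr_module r F i = free_mod r (n i)" for i
    by (simp add: fr_module_def free_mod_def F_def)
  have map: "fr_map F (Suc i) = mat_apply (n i) (n (Suc i)) (D i)" for i
    by (simp add: fr_map_def F_def)
  have "graded_free_resolution r I F"
    unfolding graded_free_resolution_def
  proof (intro conjI allI impI ballI)
    show "fr_rank F 0 = 1" "fr_shift F 0 0 = 0" using zero by (simp_all add: F_def)
  next
    fix i a l :: nat assume il: "1 \<le> i" "a < fr_rank F (i - 1)" "l < fr_rank F i"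
    then obtain i' where i': "i = Suc i'" by (cases i) auto
    have "a < n i'" "l < n (Suc i')" using il i' by (simp_all add: F_def)
    then have *: "D i' a l \<in> coord_ring r \<and> (\<forall>m\<in>Poly_Mapping.keys (D i' a l). mdeg m + s i' a = s (Suc i') l)"
      using D(1)[of i'] by (simp add: hommat_def)
    then show "fr_diff F i a l \<in> coord_ring r" using i' by (simp add: F_def)
    fix m assume "m \<in> Poly_Mapping.keys (fr_diff F i a l)"
    then show "mdeg m + fr_shift F (i - 1) a = fr_shift F i l" using * i' by (simp add: F_def)
  next
    have "(\<lambda>v. fr_map F 1 v 0) ` fr_module r F 1 = (\<lambda>v. v 0) ` N0"
      using D(2)[of 0] map[of 0] mod[of 1] by (simp add: zero image_image[symmetric, of "\<lambda>v. v 0"])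
    also have "\<dots> = I"
    proof (intro equalityI subsetI)
      fix f assume f: "f \<in> I"
      then have "(\<lambda>a. if a = 0 then f else 0) \<in> N0" using I(1) by (auto simp: N0_def free_mod_def)
      from imageI[OF this, of "\<lambda>v. v 0"] show "f \<in> (\<lambda>v. v 0) ` N0" by simp
    qed (auto simp: N0_def)
    finally show "(\<lambda>v. fr_map F 1 v 0) ` fr_module r F 1 = I" .
  next
    fix i :: nat assume "1 \<le> i"
    then obtain i' where i': "i = Suc i'" by (cases i) auto
    show "fr_map F (i + 1) ` fr_module r F (i + 1) = {v \<in> fr_module r F i. fr_map F i v = 0}"
      using D(2)[of "Suc i'"] D(3)[of i'] by (simp add: i' map mod zero_fun_def)
  qed
  then show ?thesis by blast
qed

section \<open>Koszul cycles and graded betti numbers\<close>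

text \<open>Bidegree (q, c) of the double complex of Koszul chains with values in the
  resolution.\<close>

definition res_chain :: "nat \<Rightarrow> 'k::field free_complex \<Rightarrow> nat \<Rightarrow> nat
    \<Rightarrow> (nat set \<Rightarrow> nat \<Rightarrow> (nat, 'k) mpoly) \<Rightarrow> bool" where
  "res_chain r F q c Z \<longleftrightarrow>
     (\<forall>T\<subseteq>{..<Suc r}. Z T \<in> fr_module r F q \<and> (card T \<noteq> c \<longrightarrow> Z T = (\<lambda>a. 0)))"

definition res_ctr :: "nat \<Rightarrow> (nat set \<Rightarrow> nat \<Rightarrow> (nat, 'k::field) mpoly) \<Rightarrow> nat set \<Rightarrow> nat \<Rightarrow> (nat, 'k) mpoly" where
  "res_ctr r Z T = (\<lambda>a. ctr {..<Suc r} xv (\<lambda>T. Z T a) T)"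

abbreviation res_homog :: "'k::field free_complex \<Rightarrow> nat \<Rightarrow> nat \<Rightarrow> (nat \<Rightarrow> (nat, 'k) mpoly) \<Rightarrow> bool" where
  "res_homog F q \<equiv> vec_homog (fr_rank F q) (fr_shift F q)"

lemma coef_xv_0: "coef (xv l) 0 = 0"
proof -
  have "Poly_Mapping.single l (Suc 0) \<noteq> 0" by (metis keys_single keys_zero insert_not_empty nat.distinct(1))
  then show ?thesis by (simp add: lookup_single when_def)
qed

lemma homog_minus_one_power: "homog 0 ((-1) ^ n :: ('v, 'k::field) mpoly)"
proof (induction n)
  case 0
  then show ?case using homog_const[of 1] by simp
qed (simp add: homog_uminus)

lemma res_chainD:
  assumes "res_chain r F q c Z" "T \<subseteq> {..<Suc r}"
  shows "Z T \<in> fr_module r F q" "card T \<noteq> c \<Longrightarrow> Z T = (\<lambda>a. 0)"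
  using assms by (auto simp: res_chain_def)

lemma fr_moduleD:
  assumes "v \<in> fr_module r F q"
  shows "v a \<in> coord_ring r" "fr_rank F q \<le> a \<Longrightarrow> v a = 0"
  using assms by (cases "a < fr_rank F q"; simp add: fr_module_def)+

lemma fr_module_0 [simp]: "(\<lambda>a. 0) \<in> fr_module r F q"
  by (simp add: fr_module_def)

lemma fr_module_diff: "u \<in> fr_module r F q \<Longrightarrow> v \<in> fr_module r F q \<Longrightarrow> (\<lambda>a. u a - v a) \<in> fr_module r F q"
  by (simp add: fr_module_def coord_ring_diff)

lemma fr_map_diff: "fr_map F q (\<lambda>a. u a - v a) = (\<lambda>a. fr_map F q u a - fr_map F q v a)"
  by (simp add: fr_map_def mat_apply_def fun_eq_iff algebra_simps sum_subtractf)

lemma fr_map_0 [simp]: "fr_map F q (\<lambda>a. 0) = (\<lambda>a. 0)"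
  by (simp add: fr_map_def mat_apply_def fun_eq_iff)

lemma sum_scaled_swap:
  fixes d :: "'i \<Rightarrow> 'a::comm_semiring_0"
  shows "(\<Sum>k\<in>K. d k * (\<Sum>l\<in>L. s l * z l k)) = (\<Sum>l\<in>L. s l * (\<Sum>k\<in>K. d k * z l k))"
  unfolding sum_distrib_left by (subst sum.swap) (simp only: mult.left_commute)

lemma fr_map_combination:
  "fr_map F q (\<lambda>a. \<Sum>b<N. k b * v b a) = (\<lambda>a. \<Sum>b<N. k b * fr_map F q (v b) a)"
proof
  fix a
  show "fr_map F q (\<lambda>a. \<Sum>b<N. k b * v b a) a = (\<Sum>b<N. k b * fr_map F q (v b) a)"
    unfolding fr_map_def mat_apply_def
    by (cases "a < fr_rank F (q - 1)") (simp_all only: if_True if_False mult_zero_right sum.neutral_const, rule sum_scaled_swap)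
qed

lemma fr_map_res_ctr: 
  assumes "\<And>l. l \<in> {..<Suc r} - T \<Longrightarrow> Y (insert l T) = fr_map F q (Z (insert l T))"
  shows "fr_map F q (res_ctr r Z T) = res_ctr r Y T"
proof
  fix a
  have "res_ctr r Y T a = (\<Sum>l\<in>{..<Suc r} - T. sg l T * xv l * fr_map F q (Z (insert l T)) a)"
    unfolding res_ctr_def ctr_def by (rule sum.cong) (use assms in auto)
  also have "\<dots> = fr_map F q (res_ctr r Z T) a"
    unfolding fr_map_def mat_apply_def res_ctr_def ctr_def
    by (cases "a < fr_rank F (q - 1)") 
      (simp_all only: if_True if_False mult_zero_right sum.neutral_const, rule sum_scaled_swap[symmetric])
  finally show "fr_map F q (res_ctr r Z T) a = res_ctr r Y T a" by (rule sym)
qed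

lemma res_ctr_diff: "res_ctr r (\<lambda>T a. Y T a - Z T a) T = (\<lambda>a. res_ctr r Y T a - res_ctr r Z T a)"
  by (simp add: res_ctr_def ctr_diff)

lemma res_ctr_combination:
  "res_ctr r (\<lambda>T a. \<Sum>b<N. k b * Z b T a) T = (\<lambda>a. \<Sum>b<N. k b * res_ctr r (Z b) T a)"
  by (simp add: res_ctr_def ctr_sum ctr_scale)

lemma res_chain_component: 
  assumes "res_chain r F q c Z" 
  shows "koszul_chain r (Suc r) c (\<lambda>T. Z T a)"
  unfolding koszul_chain_def
proof (intro allI impI conjI)
  fix T :: "nat set" assume T: "T \<subseteq> {..<Suc r}"
  show "Z T a \<in> coord_ring r" by (rule fr_moduleD(1)[OF res_chainD(1)[OF assms T]])
  show "card T \<noteq> c \<Longrightarrow> Z T a = 0" using res_chainD(2)[OF assms T] by simp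
qed

text \<open>The modules of the resolution are free, so Koszul chains with values in them can be
  filled componentwise; the components beyond the rank are reset to 0.\<close>

lemma res_exact:
  assumes "res_chain r F q c Z" "\<And>T. T \<subseteq> {..<Suc r} \<Longrightarrow> res_ctr r Z T = (\<lambda>a. 0)"
    and "\<And>a. coef (Z {} a) 0 = 0"
  shows "\<exists>Y. res_chain r F q (Suc c) Y \<and> (\<forall>T\<subseteq>{..<Suc r}. res_ctr r Y T = Z T)"
proof -
  have "\<exists>\<phi>. koszul_chain r (Suc r) (Suc c) \<phi> \<and> (\<forall>T\<subseteq>{..<Suc r}. ctr {..<Suc r} xv \<phi> T = Z T a)" for a
    using koszul_augmented_exact[OF res_chain_component[OF assms(1), of a]] assms(2,3)
    by (simp add: res_ctr_def fun_eq_iff)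
  then obtain \<phi> where \<phi>: "\<And>a. koszul_chain r (Suc r) (Suc c) (\<phi> a)"
    "\<And>a T. T \<subseteq> {..<Suc r} \<Longrightarrow> ctr {..<Suc r} xv (\<phi> a) T = Z T a" by metis
  define Y where "Y = (\<lambda>T a. if a < fr_rank F q then \<phi> a T else 0)"
  have "res_chain r F q (Suc c) Y"
    using koszul_chainD[OF \<phi>(1)] by (auto simp: res_chain_def Y_def fr_module_def)
  moreover have "res_ctr r Y T = Z T" if "T \<subseteq> {..<Suc r}" for T
  proof
    fix a
    show "res_ctr r Y T a = Z T a"
    proof (cases "a < fr_rank F q")
      case True
      then show ?thesis using \<phi>(2)[OF that, of a] by (simp add: res_ctr_def Y_def)
    next
      case False
      then have "Z T a = 0" using fr_moduleD(2)[OF res_chainD(1)[OF assms(1) that]] by simp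
      then show ?thesis using False by (simp add: res_ctr_def Y_def)
    qed
  qed
  ultimately show ?thesis by blast
qed

lemma fr_module_res_ctr:
  assumes "\<And>l. l \<in> {..<Suc r} - T \<Longrightarrow> Z (insert l T) \<in> fr_module r F q"
  shows "res_ctr r Z T \<in> fr_module r F q"
  unfolding fr_module_def res_ctr_def ctr_def
  using fr_moduleD[OF assms]
  by (auto intro!: coord_ring_sum coord_ring_mult coord_ring_sg coord_ring_xv sum.neutral)

lemma res_homog_res_ctr:
  assumes "\<And>l. l \<in> {..<Suc r} - T \<Longrightarrow> res_homog F q t (Z (insert l T))"
  shows "res_homog F q (Suc t) (res_ctr r Z T)"
  unfolding vec_homog_def
proof (intro allI impI)
  fix a assume a: "a < fr_rank F q"
  have *: "if fr_shift F q a \<le> t then homog (t - fr_shift F q a) (Z (insert l T) a) else Z (insert l T) a = 0"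
    if "l \<in> {..<Suc r} - T" for l
    using assms[OF that] a by (simp add: vec_homog_def)
  have sg: "homog 0 (sg l T :: (nat, 'a) mpoly)" for l
    unfolding sg_def by (rule homog_minus_one_power)
  show "if fr_shift F q a \<le> Suc t then homog (Suc t - fr_shift F q a) (res_ctr r Z T a) else res_ctr r Z T a = 0"
  proof (cases "fr_shift F q a \<le> t")
    case True
    have "homog (0 + Suc 0 + (t - fr_shift F q a)) (sg l T * xv l * Z (insert l T) a)" if "l \<in> {..<Suc r} - T" for l
      by (intro homog_mult sg homog_xv) (use *[OF that] True in auto)
    then have "homog (Suc t - fr_shift F q a) (res_ctr r Z T a)"
      unfolding res_ctr_def ctr_def using True by (intro homog_sum) (auto simp: Suc_diff_le)
    then show ?thesis using True by simp
  next
    case False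
    then have "res_ctr r Z T a = 0"
      unfolding res_ctr_def ctr_def using * by (intro sum.neutral) auto
    then show ?thesis by auto
  qed
qed

lemma fr_module_eq: "fr_module r F q = free_mod r (fr_rank F q)"
  by (simp add: fr_module_def free_mod_def)

context
  fixes r :: nat and I :: "(nat, 'k::field) mpoly set" and F :: "'k free_complex"
  assumes res: "graded_free_resolution r I F"
begin

lemma res_rank_0: "fr_rank F 0 = 1" "fr_shift F 0 0 = 0"
  using res by (simp_all add: graded_free_resolution_def)

lemma res_diff:
  assumes "a < fr_rank F q" "l < fr_rank F (Suc q)"
  shows "fr_diff F (Suc q) a l \<in> coord_ring r"
    and "m \<in> Poly_Mapping.keys (fr_diff F (Suc q) a l) \<Longrightarrow> mdeg m + fr_shift F q a = fr_shift F (Suc q) l"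
proof -
  have "\<forall>i\<ge>1. \<forall>a < fr_rank F (i - 1). \<forall>l < fr_rank F i. fr_diff F i a l \<in> coord_ring r \<and>
        (\<forall>m\<in>Poly_Mapping.keys (fr_diff F i a l). mdeg m + fr_shift F (i - 1) a = fr_shift F i l)"
    using res by (simp add: graded_free_resolution_def)
  from this[rule_format, of "Suc q" a l] assms
  show "fr_diff F (Suc q) a l \<in> coord_ring r"
    "m \<in> Poly_Mapping.keys (fr_diff F (Suc q) a l) \<Longrightarrow> mdeg m + fr_shift F q a = fr_shift F (Suc q) l" by auto
qed

lemma res_image_0: "(\<lambda>v. fr_map F (Suc 0) v 0) ` fr_module r F (Suc 0) = I"
  using res by (simp add: graded_free_resolution_def)

lemma res_image_Suc: "fr_map F (Suc (Suc q)) ` fr_module r F (Suc (Suc q)) 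
    = {v \<in> fr_module r F (Suc q). fr_map F (Suc q) v = (\<lambda>a. 0)}"
proof -
  have "\<forall>i\<ge>1. fr_map F (i + 1) ` fr_module r F (i + 1) = {v \<in> fr_module r F i. fr_map F i v = 0}"
    using res unfolding graded_free_resolution_def by blast
  from this[rule_format, of "Suc q"] show ?thesis by (simp add: zero_fun_def)
qed

lemma fr_map_fr_module: "v \<in> fr_module r F (Suc q) \<Longrightarrow> fr_map F (Suc q) v \<in> fr_module r F q"
  by (auto simp: fr_module_def fr_map_def mat_apply_def intro!: coord_ring_sum coord_ring_mult res_diff(1))

text \<open>Exactness in a single degree: a lift may be replaced by its component of degree t
  because the differential preserves degrees. For q = 0 the condition is membership in
  \<open>I\<close>, the kernel of the augmentation.\<close>

lemma graded_lift:
  assumes "v \<in> fr_module r F q" "res_homog F q t v"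
    and "if q = 0 then v 0 \<in> I else fr_map F q v = (\<lambda>a. 0)"
  shows "\<exists>u\<in>fr_module r F (Suc q). res_homog F (Suc q) t u \<and> fr_map F (Suc q) u = v"
proof -
  have "\<exists>u\<in>fr_module r F (Suc q). fr_map F (Suc q) u = v"
  proof (cases q)
    case 0
    then have "v 0 \<in> (\<lambda>v. fr_map F (Suc 0) v 0) ` fr_module r F (Suc 0)"
      using assms(3) res_image_0 by simp
    then obtain u where u: "u \<in> fr_module r F (Suc 0)" "fr_map F (Suc 0) u 0 = v 0" by auto
    have "fr_map F (Suc 0) u a = v a" for a
      using u(2) fr_moduleD(2)[OF assms(1), of a] fr_moduleD(2)[OF fr_map_fr_module[OF u(1)], of a] res_rank_0 0
      by (cases a) auto
    then show ?thesis using u(1) 0 by blast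
  next
    case (Suc q')
    then have "v \<in> fr_map F (Suc (Suc q')) ` fr_module r F (Suc (Suc q'))"
      using assms(1,3) unfolding res_image_Suc by simp
    then show ?thesis using Suc by auto
  qed
  then obtain u where u: "u \<in> fr_module r F (Suc q)" "fr_map F (Suc q) u = v" by blast
  have "fr_map F (Suc q) (vec_hom_part (fr_rank F (Suc q)) (fr_shift F (Suc q)) t u)
      = vec_hom_part (fr_rank F q) (fr_shift F q) t (fr_map F (Suc q) u)"
    unfolding fr_map_def diff_Suc_1 by (rule mat_apply_vec_hom_part) (rule res_diff(2))
  also have "\<dots> = v"
    using u(2) vec_hom_part_homog[OF assms(2)] assms(1) by (simp add: fr_module_eq)
  finally show ?thesis using vec_hom_part_free_mod u(1) vec_homog_hom_part unfolding fr_module_eq by blast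
qed

lemma fr_map_fr_map: "v \<in> fr_module r F (Suc (Suc q)) \<Longrightarrow> fr_map F (Suc q) (fr_map F (Suc (Suc q)) v) = (\<lambda>a. 0)"
  using res_image_Suc[of q] by auto

lemma res_ctr_res_ctr: "T \<subseteq> {..<Suc r} \<Longrightarrow> res_ctr r (res_ctr r Z) T = (\<lambda>a. 0)"
  unfolding res_ctr_def by (rule HOL.ext) (rule ctr_ctr, auto)

text \<open>The staircases go through the double complex of Koszul chains with values in the resolution,
  which computes Tor in two ways: a Koszul cycle modulo \<open>I\<close> is lifted to an element of \<open>F\<^sub>i\<close>, and a Koszul
  cycle whose lift is a boundary modulo the variables is a Koszul boundary.\<close>

lemma staircase_up:
  assumes z: "koszul_chain r (Suc r) i z" "\<And>T. T \<subseteq> {..<Suc r} \<Longrightarrow> homog e (z T)"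
    and cyc: "\<And>T. T \<subseteq> {..<Suc r} \<Longrightarrow> ctr {..<Suc r} xv z T \<in> I"
  shows "\<exists>Z. Z 0 = (\<lambda>T a. if a = 0 then z T else 0) \<and> 
    (\<forall>q\<le>i. res_chain r F q (i - q) (Z q) \<and> (\<forall>T\<subseteq>{..<Suc r}. res_homog F q (e + q) (Z q T))) \<and>
    (\<forall>q<i. \<forall>T\<subseteq>{..<Suc r}. fr_map F (Suc q) (Z (Suc q) T) = res_ctr r (Z q) T)"
proof -
  define P where "P = (\<lambda>q Z. (q = 0 \<longrightarrow> Z = (\<lambda>T a. if a = 0 then z T else 0)) \<and>
    (q \<le> i \<longrightarrow> res_chain r F q (i - q) Z \<and> (\<forall>T\<subseteq>{..<Suc r}. res_homog F q (e + q) (Z T)) \<and> 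
      (\<forall>T\<subseteq>{..<Suc r}. if q = 0 then res_ctr r Z T 0 \<in> I else fr_map F q (res_ctr r Z T) = (\<lambda>a. 0))))"
  define Q where "Q = (\<lambda>q Z Z'. q < i \<longrightarrow> (\<forall>T\<subseteq>{..<Suc r}. fr_map F (Suc q) (Z' T) = res_ctr r Z T))"
  have P0: "P 0 (\<lambda>T a. if a = 0 then z T else 0)"
    unfolding P_def
    using z cyc koszul_chainD[OF z(1)] res_rank_0 
    by (auto simp: res_chain_def fr_module_def vec_homog_def res_ctr_def fun_eq_iff)
  have step: "\<exists>Z'. P (Suc q) Z' \<and> Q q Z Z'" if PZ: "P q Z" for q Z
  proof (cases "q < i")
    case False
    then show ?thesis by (auto simp: P_def Q_def)
  next
    case True
    have "(res_chain r F q (i - q) Z \<and> (\<forall>T\<subseteq>{..<Suc r}. res_homog F q (e + q) (Z T)) \<and> 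
      (\<forall>T\<subseteq>{..<Suc r}. if q = 0 then res_ctr r Z T 0 \<in> I else fr_map F q (res_ctr r Z T) = (\<lambda>a. 0)))"
      using PZ less_imp_le[OF True] unfolding P_def by blast
    then have Z: "res_chain r F q (i - q) Z" "\<And>T. T \<subseteq> {..<Suc r} \<Longrightarrow> res_homog F q (e + q) (Z T)"
      "\<And>T. T \<subseteq> {..<Suc r} \<Longrightarrow> if q = 0 then res_ctr r Z T 0 \<in> I else fr_map F q (res_ctr r Z T) = (\<lambda>a. 0)"
      by blast+
    have "\<exists>u\<in>fr_module r F (Suc q). res_homog F (Suc q) (Suc (e + q)) u \<and> fr_map F (Suc q) u = res_ctr r Z T"
      if T: "T \<subseteq> {..<Suc r}" for T
    proof (rule graded_lift)
      show "res_ctr r Z T \<in> fr_module r F q"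
        by (rule fr_module_res_ctr) (use T res_chainD(1)[OF Z(1)] in auto)
      show "res_homog F q (Suc (e + q)) (res_ctr r Z T)"
        by (rule res_homog_res_ctr) (use T Z(2) in auto)
    qed (rule Z(3)[OF T])
    then obtain u where u: "\<And>T. T \<subseteq> {..<Suc r} \<Longrightarrow> u T \<in> fr_module r F (Suc q)"
      "\<And>T. T \<subseteq> {..<Suc r} \<Longrightarrow> res_homog F (Suc q) (Suc (e + q)) (u T)"
      "\<And>T. T \<subseteq> {..<Suc r} \<Longrightarrow> fr_map F (Suc q) (u T) = res_ctr r Z T" by metis
    \<comment> \<open>The lifts are kept in the expected Koszul degree; at other sets the element to
      be lifted is zero, so 0 is a lift.\<close>
    define Z' where "Z' = (\<lambda>T. if card T = i - Suc q then u T else (\<lambda>a. 0))"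
    have map: "fr_map F (Suc q) (Z' T) = res_ctr r Z T" if T: "T \<subseteq> {..<Suc r}" for T
    proof (cases "card T = i - Suc q")
      case False
      have "finite T" using T finite_subset by blast
      then have "Z (insert l T) = (\<lambda>a. 0)" if "l \<in> {..<Suc r} - T" for l
        using that T False True by (intro res_chainD(2)[OF Z(1)]) auto
      then have "res_ctr r Z T = (\<lambda>a. 0)" by (auto simp: res_ctr_def ctr_def)
      then show ?thesis using False by (simp add: Z'_def)
    qed (simp add: Z'_def u(3)[OF T])
    \<comment> \<open>Liftability for the next step: the differential of the resolution turns this
      into a double Koszul boundary.\<close>
    have "fr_map F (Suc q) (res_ctr r Z' T) = (\<lambda>a. 0)" if T: "T \<subseteq> {..<Suc r}" for T
    proof -
      have "fr_map F (Suc q) (res_ctr r Z' T) = res_ctr r (res_ctr r Z) T"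
        by (rule fr_map_res_ctr) (use T map in auto)
      then show ?thesis using res_ctr_res_ctr[OF T] by simp
    qed
    then have "P (Suc q) Z'"
      unfolding P_def using u(1,2) by (auto simp: res_chain_def Z'_def vec_homog_def)
    then show ?thesis using map by (auto simp: Q_def)
  qed
  from dependent_nat_choice[of P Q] P0 step obtain Z where Z: "\<And>q. P q (Z q)" "\<And>q. Q q (Z q) (Z (Suc q))"
    by metis
  show ?thesis
    using Z by (intro exI[of _ Z]) (auto simp: P_def Q_def)
qed

lemma staircase_down:
  assumes chain: "\<And>q. q \<le> i \<Longrightarrow> res_chain r F q (i - q) (Z q)"
    and link: "\<And>q T. q < i \<Longrightarrow> T \<subseteq> {..<Suc r} \<Longrightarrow> fr_map F (Suc q) (Z (Suc q) T) = res_ctr r (Z q) T"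
    and u: "u \<in> fr_module r F (Suc i)" "\<And>a. coef (Z i {} a) 0 = coef (fr_map F (Suc i) u a) 0"
  shows "\<exists>Y Y'. res_chain r F 0 (Suc i) Y \<and> res_chain r F (Suc 0) i Y' \<and>
    (\<forall>T\<subseteq>{..<Suc r}. Z 0 T = (\<lambda>a. res_ctr r Y T a + fr_map F (Suc 0) (Y' T) a))"
proof -
  \<comment> \<open>If the image of \<open>Y'\<close> has the same Koszul boundary as
    \<open>Z q\<close>, the difference is a Koszul cycle with values in a free module and can be
    filled; in Koszul degree 0 the constant terms are the obstruction.\<close>
  have main: "\<exists>Y Y'. res_chain r F q (Suc (i - q)) Y \<and> res_chain r F (Suc q) (i - q) Y' \<and>
      (\<forall>T\<subseteq>{..<Suc r}. Z q T = (\<lambda>a. res_ctr r Y T a + fr_map F (Suc q) (Y' T) a))"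
    if q: "q \<le> i" and Y': "res_chain r F (Suc q) (i - q) Y'" 
      and closed: "\<And>T. T \<subseteq> {..<Suc r} \<Longrightarrow> res_ctr r (Z q) T = res_ctr r (\<lambda>T. fr_map F (Suc q) (Y' T)) T"
      and const: "\<And>a. coef (Z q {} a) 0 = coef (fr_map F (Suc q) (Y' {}) a) 0" for q Y'
  proof -
    define \<psi> where "\<psi> = (\<lambda>T a. Z q T a - fr_map F (Suc q) (Y' T) a)"
    have c1: "res_chain r F q (i - q) \<psi>"
      unfolding res_chain_def
    proof (intro allI impI conjI)
      fix T :: "nat set" assume T: "T \<subseteq> {..<Suc r}"
      show "\<psi> T \<in> fr_module r F q"
        unfolding \<psi>_def by (intro fr_module_diff fr_map_fr_module res_chainD(1)[OF chain[OF q] T] res_chainD(1)[OF Y' T])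
      show "card T \<noteq> i - q \<Longrightarrow> \<psi> T = (\<lambda>a. 0)"
        using res_chainD(2)[OF chain[OF q] T] res_chainD(2)[OF Y' T] by (simp add: \<psi>_def)
    qed
    have c2: "res_ctr r \<psi> T = (\<lambda>a. 0)" if "T \<subseteq> {..<Suc r}" for T
      unfolding \<psi>_def res_ctr_diff using closed[OF that] by simp
    have c3: "coef (\<psi> {} a) 0 = 0" for a
      using const by (simp add: \<psi>_def lookup_minus)
    obtain Y where Y: "res_chain r F q (Suc (i - q)) Y" "\<And>T. T \<subseteq> {..<Suc r} \<Longrightarrow> res_ctr r Y T = \<psi> T"
      using res_exact[OF c1 c2 c3] by auto
    then show ?thesis using Y' by (intro exI[of _ Y] exI[of _ Y']) (simp add: \<psi>_def)
  qed
  have "\<exists>Y Y'. res_chain r F q (Suc (i - q)) Y \<and> res_chain r F (Suc q) (i - q) Y' \<and>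
      (\<forall>T\<subseteq>{..<Suc r}. Z q T = (\<lambda>a. res_ctr r Y T a + fr_map F (Suc q) (Y' T) a))" if "q \<le> i" for q
    using that
  proof (induction q rule: inc_induct)
    case base
    \<comment> \<open>At q = i the Koszul degree is 0, so both Koszul boundaries are zero, and
      \<open>u\<close> has the right constant terms by assumption.\<close>
    define Y' where "Y' = (\<lambda>T::nat set. if T = {} then u else (\<lambda>a. 0))"
    have Y': "res_chain r F (Suc i) (i - i) Y'"
      using u(1) by (auto simp: res_chain_def Y'_def)
    have "res_ctr r (Z i) T = res_ctr r (\<lambda>T. fr_map F (Suc i) (Y' T)) T" if T: "T \<subseteq> {..<Suc r}" for T
    proof -
      have "Z i (insert l T) = (\<lambda>a. 0)" if l: "l \<in> {..<Suc r} - T" for l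
      proof (rule res_chainD(2)[OF chain[OF order_refl]])
        have "finite T" using T finite_subset by blast
        then show "card (insert l T) \<noteq> i - i" by simp
      qed (use l T in auto)
      then show ?thesis by (auto simp: res_ctr_def ctr_def Y'_def fun_eq_iff intro!: sum.cong)
    qed
    then show ?case using main[OF order_refl Y'] u(2) by (simp add: Y'_def)
  next
    case (step q)
    \<comment> \<open>The Koszul filling \<open>Y\<close> found at \<open>Suc q\<close> becomes the
      \<open>Y'\<close> of level q; \<open>Y''\<close> disappears because the resolution is a
      complex.\<close>
    then obtain Y Y'' where Y: "res_chain r F (Suc q) (Suc (i - Suc q)) Y" "res_chain r F (Suc (Suc q)) (i - Suc q) Y''"
      "\<And>T. T \<subseteq> {..<Suc r} \<Longrightarrow> Z (Suc q) T = (\<lambda>a. res_ctr r Y T a + fr_map F (Suc (Suc q)) (Y'' T) a)" by blast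
    have Y': "res_chain r F (Suc q) (i - q) Y" using Y(1) step(2) by (simp add: Suc_diff_Suc)
    have "res_ctr r (Z q) T = res_ctr r (\<lambda>T. fr_map F (Suc q) (Y T)) T" if T: "T \<subseteq> {..<Suc r}" for T
    proof -
      have "res_ctr r Y T = (\<lambda>a. Z (Suc q) T a - fr_map F (Suc (Suc q)) (Y'' T) a)"
        using Y(3)[OF T] by simp
      then have "fr_map F (Suc q) (res_ctr r Y T) = fr_map F (Suc q) (Z (Suc q) T)"
        using fr_map_fr_map[OF res_chainD(1)[OF Y(2) T]] by (simp add: fr_map_diff)
      moreover have "fr_map F (Suc q) (res_ctr r Y T) = res_ctr r (\<lambda>T. fr_map F (Suc q) (Y T)) T"
        by (rule fr_map_res_ctr) simp
      ultimately show ?thesis using link[OF step(2) T] by simp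
    qed
    moreover have "Z q {} = (\<lambda>a. 0)" "Y {} = (\<lambda>a. 0)"
      using res_chainD(2)[OF chain, of q "{}"] res_chainD(2)[OF Y', of "{}"] step(2) by auto
    ultimately show ?case using main[OF _ Y'] step(2) by simp
  qed
  from this[of 0] show ?thesis by simp
qed

text \<open>One inequality of the balancing of Tor. The constant terms of the last lifts are cycles
  of the resolution tensored with k, because Koszul boundaries have no constant terms. As e is the
  polynomial degree of the cycles, the internal degree is i + e. The premise \<open>indep\<close> is
  independence of the Koszul classes modulo I.\<close>

theorem tor_dimension_ge:
  assumes i: "0 < i"
    and z: "\<And>b. b < N \<Longrightarrow> koszul_chain r (Suc r) i (z b)" 
      "\<And>b T. b < N \<Longrightarrow> T \<subseteq> {..<Suc r} \<Longrightarrow> homog e (z b T)"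
      "\<And>b T. b < N \<Longrightarrow> T \<subseteq> {..<Suc r} \<Longrightarrow> ctr {..<Suc r} xv (z b) T \<in> I"
    and indep: "\<And>c \<phi>. koszul_chain r (Suc r) (Suc i) \<phi> \<Longrightarrow>
      (\<And>T. T \<subseteq> {..<Suc r} \<Longrightarrow> (\<Sum>b<N. Poly_Mapping.single 0 (c b) * z b T) - ctr {..<Suc r} xv \<phi> T \<in> I) 
      \<Longrightarrow> \<forall>b<N. c b = 0"
  shows "N \<le> quot_dim fun_scale (tensor_cycles F i (i + e)) (tensor_boundaries F i (i + e))"
proof -
  define j where "j = i + e"
  obtain Z where Z0: "\<And>b. b < N \<Longrightarrow> Z b 0 = (\<lambda>T a. if a = 0 then z b T else 0)" 
    and Z: "\<And>b q. b < N \<Longrightarrow> q \<le> i \<Longrightarrow> res_chain r F q (i - q) (Z b q)"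
    and Zh: "\<And>b q T. b < N \<Longrightarrow> q \<le> i \<Longrightarrow> T \<subseteq> {..<Suc r} \<Longrightarrow> res_homog F q (e + q) (Z b q T)"
    and Zl: "\<And>b q T. b < N \<Longrightarrow> q < i \<Longrightarrow> T \<subseteq> {..<Suc r} \<Longrightarrow> fr_map F (Suc q) (Z b (Suc q) T) = res_ctr r (Z b q) T"
  proof -
    have "\<forall>b. \<exists>Z. b < N \<longrightarrow> Z 0 = (\<lambda>T a. if a = 0 then z b T else 0) \<and> 
      (\<forall>q\<le>i. res_chain r F q (i - q) (Z q) \<and> (\<forall>T\<subseteq>{..<Suc r}. res_homog F q (e + q) (Z q T))) \<and>
      (\<forall>q<i. \<forall>T\<subseteq>{..<Suc r}. fr_map F (Suc q) (Z (Suc q) T) = res_ctr r (Z q) T)"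
    proof
      fix b
      show "\<exists>Z. b < N \<longrightarrow> Z 0 = (\<lambda>T a. if a = 0 then z b T else 0) \<and> 
      (\<forall>q\<le>i. res_chain r F q (i - q) (Z q) \<and> (\<forall>T\<subseteq>{..<Suc r}. res_homog F q (e + q) (Z q T))) \<and>
      (\<forall>q<i. \<forall>T\<subseteq>{..<Suc r}. fr_map F (Suc q) (Z (Suc q) T) = res_ctr r (Z q) T)"
      proof (cases "b < N")
        case True
        from staircase_up[OF z(1)[OF True] z(2)[OF True] z(3)[OF True]] show ?thesis
          by (simp only: True simp_thms)
      qed simp
    qed
    from choice[OF this] obtain Z where "\<forall>b<N. Z b 0 = (\<lambda>T a. if a = 0 then z b T else 0) \<and> 
      (\<forall>q\<le>i. res_chain r F q (i - q) (Z b q) \<and> (\<forall>T\<subseteq>{..<Suc r}. res_homog F q (e + q) (Z b q T))) \<and>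
      (\<forall>q<i. \<forall>T\<subseteq>{..<Suc r}. fr_map F (Suc q) (Z b (Suc q) T) = res_ctr r (Z b q) T)"
      by blast
    then show thesis by (intro that[of Z]) blast+
  qed
  \<comment> \<open>At the end of the staircase the Koszul degree is 0, so the empty set carries the
    only value.\<close>
  define v where "v = (\<lambda>b a. coef (Z b i {} a) 0)"
  have coef_map: "coef (fr_map F q u a) 0 = mat_apply (fr_rank F (q - 1)) (fr_rank F q)
     (\<lambda>a l. coef (fr_diff F q a l) 0) (\<lambda>a. coef (u a) 0) a" for q u a
    by (simp add: fr_map_def mat_apply_def lookup_sum coef_mult_0)
  have v_cycle: "v b \<in> tensor_cycles F i j" if b: "b < N" for b
  proof -
    have "v b a = 0" if "\<not> (a < fr_rank F i \<and> fr_shift F i a = j)" for a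
    proof (cases "a < fr_rank F i")
      case True
      then have "if fr_shift F i a \<le> j then homog (j - fr_shift F i a) (Z b i {} a) else Z b i {} a = 0"
        using Zh[OF b order_refl, of "{}"] by (simp add: vec_homog_def j_def add.commute)
      moreover have "fr_shift F i a \<noteq> j" using that True by simp
      ultimately have "0 \<notin> Poly_Mapping.keys (Z b i {} a)"
        by (cases "fr_shift F i a \<le> j") (auto simp: homog_def)
      then show ?thesis by (simp add: v_def in_keys_iff)
    next
      case False
      have "Z b i {} a = 0" by (rule fr_moduleD(2)[OF res_chainD(1)[OF Z[OF b order_refl]]]) (use False in auto)
      then show ?thesis by (simp add: v_def)
    qed
    moreover have "tensor_map F i (v b) = 0"
    proof
      fix a
      obtain i' where i': "i = Suc i'" using i by (cases i) auto
      have "tensor_map F i (v b) a = coef (fr_map F i (Z b i {}) a) 0"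
        by (simp add: tensor_map_def v_def coef_map)
      also have "fr_map F i (Z b i {}) = res_ctr r (Z b i') {}"
        using Zl[OF b, of i' "{}"] i' by simp
      also have "coef (res_ctr r (Z b i') {} a) 0 = 0"
        unfolding res_ctr_def ctr_def lookup_sum by (intro sum.neutral ballI) (simp only: coef_mult_0 coef_xv_0 mult_zero_right mult_zero_left)
      finally show "tensor_map F i (v b) a = 0 a" by simp
    qed
    ultimately show ?thesis by (auto simp: tensor_cycles_def tensor_module_def)
  qed
  interpret vector_space fun_scale by (rule vector_space_fun_scale)
  have tm_add: "tensor_map F q (x + y) = tensor_map F q x + tensor_map F q y" for q x y
    by (simp add: tensor_map_def mat_apply_def fun_eq_iff algebra_simps sum.distrib)
  have tm_scale: "tensor_map F q (fun_scale c x) = fun_scale c (tensor_map F q x)" for q c x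
    by (simp add: tensor_map_def mat_apply_def fun_scale_def fun_eq_iff sum_distrib_left mult.left_commute)
  have tm_0: "tensor_map F q 0 = 0" for q
    by (simp add: tensor_map_def mat_apply_def fun_eq_iff)
  have mod: "subspace (tensor_module F q j)" for q
    by (rule subspaceI) (auto simp: tensor_module_def fun_scale_def)
  have sub_cycles: "subspace (tensor_cycles F i j)"
    using mod[of i] tm_add tm_scale tm_0 i unfolding tensor_cycles_def subspace_def
    by (auto simp: fun_scale_def)
  have sub_boundaries: "subspace (tensor_boundaries F i j)"
    unfolding tensor_boundaries_def
  proof (rule subspaceI)
    show "0 \<in> tensor_map F (i + 1) ` tensor_module F (i + 1) j"
      using imageI[OF subspace_0[OF mod], of "tensor_map F (i + 1)"] tm_0 by simp
  next
    fix x y assume "x \<in> tensor_map F (i + 1) ` tensor_module F (i + 1) j" "y \<in> tensor_map F (i + 1) ` tensor_module F (i + 1) j"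
    then obtain u w where "x = tensor_map F (i + 1) u" "u \<in> tensor_module F (i + 1) j" 
      "y = tensor_map F (i + 1) w" "w \<in> tensor_module F (i + 1) j" by auto
    then show "x + y \<in> tensor_map F (i + 1) ` tensor_module F (i + 1) j"
      using subspace_add[OF mod] by (simp flip: tm_add)
  next
    fix c x assume "x \<in> tensor_map F (i + 1) ` tensor_module F (i + 1) j"
    then obtain u where "x = tensor_map F (i + 1) u" "u \<in> tensor_module F (i + 1) j" by auto
    then show "fun_scale c x \<in> tensor_map F (i + 1) ` tensor_module F (i + 1) j"
      using subspace_scale[OF mod] by (simp flip: tm_scale)
  qed
  define const where "const = (\<lambda>w (a :: nat). Poly_Mapping.single (0 :: nat \<Rightarrow>\<^sub>0 nat) (w a :: 'k))"
  have const_module: "const w \<in> fr_module r F q" if "w \<in> tensor_module F q j" for w q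
    using that by (auto simp: const_def fr_module_def tensor_module_def)
  have tensor_map_const: "tensor_map F q w a = coef (fr_map F q (const w) a) 0" for q w a
    by (simp add: tensor_map_def coef_map const_def)
  have boundaries_cycles: "tensor_boundaries F i j \<subseteq> tensor_cycles F i j"
  proof
    fix x assume "x \<in> tensor_boundaries F i j"
    then obtain w where w: "w \<in> tensor_module F (Suc i) j" "x = tensor_map F (Suc i) w"
      by (auto simp: tensor_boundaries_def)
    obtain i' where i': "i = Suc i'" using i by (cases i) auto
    have "x a = 0" if "\<not> (a < fr_rank F i \<and> fr_shift F i a = j)" for a
    proof (cases "a < fr_rank F i")
      case True
      \<comment> \<open>A nonzero constant term would force equal shifts of row and column, so the
        tensored differential preserves degrees.\<close>
      have "coef (fr_diff F (Suc i) a l) 0 * w l = 0" if l: "l < fr_rank F (Suc i)" for l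
      proof (cases "fr_shift F (Suc i) l = j")
        case True
        then have "0 \<notin> Poly_Mapping.keys (fr_diff F (Suc i) a l)"
          using res_diff(2)[of a i l 0] l \<open>a < fr_rank F i\<close> \<open>\<not> (a < fr_rank F i \<and> fr_shift F i a = j)\<close> by auto
        then show ?thesis by (simp add: in_keys_iff)
      next
        case False
        then show ?thesis using w(1) by (simp add: tensor_module_def)
      qed
      then have "(\<Sum>l<fr_rank F (Suc i). coef (fr_diff F (Suc i) a l) 0 * w l) = 0"
        by (intro sum.neutral) auto
      then show ?thesis using w(2) by (simp add: tensor_map_def mat_apply_def)
    next
      case False
      then show ?thesis using w(2) by (simp add: tensor_map_def mat_apply_def)
    qed
    moreover have "tensor_map F i x = 0"
    proof
      fix a
      have "x = (\<lambda>a. coef (fr_map F (Suc i) (const w) a) 0)"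
        unfolding w(2) by (rule HOL.ext) (rule tensor_map_const)
      then have "tensor_map F i x a = coef (fr_map F i (fr_map F (Suc i) (const w)) a) 0"
        by (simp add: coef_map[of i] tensor_map_def)
      then show "tensor_map F i x a = 0 a" 
        using fr_map_fr_map[of "const w" i'] const_module[OF w(1)] i' by simp
    qed
    ultimately show "x \<in> tensor_cycles F i j" by (auto simp: tensor_cycles_def tensor_module_def)
  qed
  define S where "S = (\<lambda>l a. if a = l then 1 else 0 :: 'k) ` {..<fr_rank F i}"
  have span: "tensor_cycles F i j \<subseteq> span S"
  proof
    fix x assume "x \<in> tensor_cycles F i j"
    then have x: "x a = 0" if "fr_rank F i \<le> a" for a
      using that by (auto simp: tensor_cycles_def tensor_module_def)
    have "x = (\<Sum>l<fr_rank F i. fun_scale (x l) (\<lambda>a. if a = l then 1 else 0))"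
    proof
      fix a
      show "x a = (\<Sum>l<fr_rank F i. fun_scale (x l) (\<lambda>a. if a = l then 1 else 0)) a"
        using x[of a] by (auto simp: sum_fun_apply fun_scale_def if_distrib[of "(*) _"] sum.delta cong: if_cong)
    qed
    also have "\<dots> \<in> span S"
      by (intro span_sum span_scale span_base) (auto simp: S_def)
    finally show "x \<in> span S" .
  qed
  have v_indep: "\<forall>b<N. c b = 0" if c: "(\<Sum>b<N. fun_scale (c b) (v b)) \<in> tensor_boundaries F i j" for c
  proof -
    obtain w where w: "w \<in> tensor_module F (Suc i) j" "(\<Sum>b<N. fun_scale (c b) (v b)) = tensor_map F (Suc i) w"
      using c by (auto simp: tensor_boundaries_def)
    define k where "k = (\<lambda>b. Poly_Mapping.single (0 :: nat \<Rightarrow>\<^sub>0 nat) (c b))"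
    define Zs where "Zs = (\<lambda>q T a. \<Sum>b<N. k b * Z b q T a)"
    have chain: "res_chain r F q (i - q) (Zs q)" if q: "q \<le> i" for q
      unfolding res_chain_def
    proof (intro allI impI conjI)
      fix T :: "nat set" assume T: "T \<subseteq> {..<Suc r}"
      have "Zs q T a \<in> coord_ring r" for a
        unfolding Zs_def k_def using fr_moduleD(1)[OF res_chainD(1)[OF Z[OF _ q] T]]
        by (intro coord_ring_sum coord_ring_mult coord_ring_const) auto
      moreover have "Zs q T a = 0" if "fr_rank F q \<le> a" for a
        unfolding Zs_def using fr_moduleD(2)[OF res_chainD(1)[OF Z[OF _ q] T] that] by (intro sum.neutral) auto
      ultimately show "Zs q T \<in> fr_module r F q" by (simp add: fr_module_def)
      show "card T \<noteq> i - q \<Longrightarrow> Zs q T = (\<lambda>a. 0)"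
        unfolding Zs_def using res_chainD(2)[OF Z[OF _ q] T] by (intro HOL.ext sum.neutral) auto
    qed
    have link: "fr_map F (Suc q) (Zs (Suc q) T) = res_ctr r (Zs q) T" if "q < i" "T \<subseteq> {..<Suc r}" for q T
      unfolding Zs_def fr_map_combination res_ctr_combination using Zl that by (intro HOL.ext sum.cong) auto
    have const: "coef (Zs i {} a) 0 = coef (fr_map F (Suc i) (const w) a) 0" for a
    proof -
      have "coef (Zs i {} a) 0 = (\<Sum>b<N. fun_scale (c b) (v b)) a"
        by (simp add: Zs_def k_def lookup_sum coef_mult_0 sum_fun_apply fun_scale_def v_def)
      then show ?thesis using w(2) tensor_map_const by simp
    qed
    obtain Y Y' where Y: "res_chain r F 0 (Suc i) Y" "res_chain r F (Suc 0) i Y'"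
      "\<And>T. T \<subseteq> {..<Suc r} \<Longrightarrow> Zs 0 T = (\<lambda>a. res_ctr r Y T a + fr_map F (Suc 0) (Y' T) a)"
      using staircase_down[OF chain link const_module[OF w(1)] const] by blast
    show ?thesis
    proof (rule indep[OF res_chain_component[OF Y(1), of 0]])
      fix T :: "nat set" assume T: "T \<subseteq> {..<Suc r}"
      have "(\<Sum>b<N. Poly_Mapping.single 0 (c b) * z b T) = Zs 0 T 0"
        by (auto simp: Zs_def k_def Z0 intro!: sum.cong)
      then have "(\<Sum>b<N. Poly_Mapping.single 0 (c b) * z b T) - ctr {..<Suc r} xv (\<lambda>T. Y T 0) T = fr_map F (Suc 0) (Y' T) 0"
        using Y(3)[OF T] by (simp add: res_ctr_def)
      then show "(\<Sum>b<N. Poly_Mapping.single 0 (c b) * z b T) - ctr {..<Suc r} xv (\<lambda>T. Y T 0) T \<in> I"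
        using res_image_0 res_chainD(1)[OF Y(2) T] by auto
    qed
  qed
  show ?thesis
    unfolding j_def[symmetric]
    by (rule quot_dim_ge[OF vector_space_fun_scale sub_boundaries sub_cycles boundaries_cycles _ span v_cycle v_indep])
      (auto simp: S_def)
qed

end

section \<open>Ideals of points in linearly general position\<close>

definition points_ideal :: "nat \<Rightarrow> nat \<Rightarrow> (nat \<Rightarrow> nat \<Rightarrow> 'l::field) \<Rightarrow> (nat, 'l) mpoly set" where
  "points_ideal r \<gamma> x = {f \<in> coord_ring r. \<forall>t. \<forall>s<\<gamma>. mpoly_eval id (x s) (hom_part t f) = 0}"

text \<open>Independence of any r + 1 points, phrased through linear forms because interpolation
  uses it this way; \<open>relation_unique\<close> is the transposed version.\<close>

definition lin_general :: "nat \<Rightarrow> nat \<Rightarrow> (nat \<Rightarrow> nat \<Rightarrow> 'l::field) \<Rightarrow> bool" where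
  "lin_general r \<gamma> x \<longleftrightarrow> (\<forall>J\<subseteq>{..<\<gamma>}. card J = Suc r \<longrightarrow>
     (\<forall>g. (\<forall>s\<in>J. (\<Sum>l<Suc r. x s l * g l) = 0) \<longrightarrow> (\<forall>l<Suc r. g l = 0)))"

lemmas eval_id = eval_add[OF field_embedding_id] eval_diff[OF field_embedding_id] eval_sum[OF field_embedding_id]
  eval_mult[OF field_embedding_id] eval_0[OF field_embedding_id] eval_xv[OF field_embedding_id]
  eval_const[OF field_embedding_id] eval_power[OF field_embedding_id] eval_uminus[OF field_embedding_id]
  eval_1[OF field_embedding_id] 

lemma eval_id_sg: "mpoly_eval id v (sg l T) = sg l T"
  by (simp add: sg_def eval_id)

text \<open>A homogeneous component of degree t scales by the t-th power of the factor between two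
  coordinate vectors, so one representative of each point suffices.\<close>

lemma vanishing_ideal_eq_points_ideal:
  fixes x :: "nat \<Rightarrow> nat \<Rightarrow> 'l::field"
  assumes "\<And>s. s < \<gamma> \<Longrightarrow> p s \<in> proj_space r" "\<And>s. s < \<gamma> \<Longrightarrow> x s \<in> p s"
  shows "vanishing_ideal r (p ` {..<\<gamma>}) = points_ideal r \<gamma> x"
proof -
  have "(\<forall>y\<in>p s. mpoly_eval id y (hom_part t f) = 0) \<longleftrightarrow> mpoly_eval id (x s) (hom_part t f) = 0"
    if s: "s < \<gamma>" for s t and f :: "(nat, 'l) mpoly"
  proof
    assume 0: "mpoly_eval id (x s) (hom_part t f) = 0"
    obtain y where y: "p s = {fun_scale c y | c. c \<noteq> 0}"
      using assms(1)[OF s] unfolding proj_space_def by blast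
    obtain c where c: "x s = fun_scale c y" "c \<noteq> 0" using assms(2)[OF s] unfolding y by blast
    have "mpoly_eval id (fun_scale c' y) (hom_part t f) = c' ^ t * mpoly_eval id y (hom_part t f)" for c'
      unfolding fun_scale_def by (rule eval_homog_scale[OF homog_hom_part field_embedding_id])
    then show "\<forall>y\<in>p s. mpoly_eval id y (hom_part t f) = 0" using 0 c unfolding y by auto
  qed (use assms(2)[OF s] in blast)
  then show ?thesis unfolding vanishing_ideal_def points_ideal_def by auto
qed

lemma points_ideal_homog:
  assumes "homog t f"
  shows "f \<in> points_ideal r \<gamma> x \<longleftrightarrow> f \<in> coord_ring r \<and> (\<forall>s<\<gamma>. mpoly_eval id (x s) f = 0)"
  by (auto simp: points_ideal_def hom_part_homog[OF assms] eval_id)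

lemma points_ideal_0: "0 \<in> points_ideal r \<gamma> x"
  by (simp add: points_ideal_def eval_id)

lemma points_ideal_add: "f \<in> points_ideal r \<gamma> x \<Longrightarrow> g \<in> points_ideal r \<gamma> x \<Longrightarrow> f + g \<in> points_ideal r \<gamma> x"
  by (simp add: points_ideal_def eval_id hom_part_add coord_ring_add)

lemma points_ideal_mult:
  assumes "f \<in> coord_ring r" "g \<in> points_ideal r \<gamma> x"
  shows "f * g \<in> points_ideal r \<gamma> x"
proof -
  have "mpoly_eval id (x s) (hom_part t (f * g)) = 0" if s: "s < \<gamma>" for s t
  proof -
    define D where "D = Max (mdeg ` Poly_Mapping.keys f)"
    have D: "mdeg m \<le> D" if "m \<in> Poly_Mapping.keys f" for m
      unfolding D_def using that by (intro Max_ge) auto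
    have "hom_part t (f * g) = hom_part t ((\<Sum>u\<le>D. hom_part u f) * g)"
      by (subst sum_hom_parts) (use D in auto)
    also have "\<dots> = (\<Sum>u\<le>D. if u \<le> t then hom_part u f * hom_part (t - u) g else 0)"
      by (simp add: sum_distrib_right hom_part_sum hom_part_mult_homog[OF homog_hom_part])
    finally have *: "hom_part t (f * g) = (\<Sum>u\<le>D. if u \<le> t then hom_part u f * hom_part (t - u) g else 0)" .
    show ?thesis
      unfolding * eval_id using s assms(2) by (intro sum.neutral) (auto simp: eval_id points_ideal_def)
  qed
  then show ?thesis using assms by (simp add: points_ideal_def coord_ring_mult)
qed

lemma points_ideal_hom_part: "f \<in> points_ideal r \<gamma> x \<Longrightarrow> hom_part t f \<in> points_ideal r \<gamma> x"
  by (simp add: points_ideal_homog[OF homog_hom_part]) (simp add: points_ideal_def coord_ring_hom_part)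

lemma points_ideal_coord_ring: "points_ideal r \<gamma> x \<subseteq> coord_ring r"
  by (auto simp: points_ideal_def)

lemma hom_part_0_eq: "hom_part 0 f = Poly_Mapping.single 0 (coef f 0)"
  by (rule poly_mapping_eqI) (auto simp: coef_hom_part mdeg_eq_0_iff lookup_single when_def)

lemma linear_form_expansion:
  assumes "f \<in> coord_ring r" "homog (Suc 0) f"
  shows "\<exists>c. f = (\<Sum>l<Suc r. xv l * Poly_Mapping.single 0 (c l))"
proof -
  have "\<exists>l<Suc r. l \<in> Poly_Mapping.keys m" if m: "m \<in> Poly_Mapping.keys f" for m
  proof -
    have "mdeg m = 1" using assms(2) m by (simp add: homog_def)
    then have "m \<noteq> 0" by auto
    then obtain l where "l \<in> Poly_Mapping.keys m" by (metis keys_eq_empty all_not_in_conv)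
    moreover have "Poly_Mapping.keys m \<subseteq> {..r}" using assms(1) m by (simp add: coord_ring_def)
    ultimately show ?thesis by (intro exI[of _ l]) auto
  qed
  from variables_decomposition[OF assms(1) this] obtain h where h: "f = (\<Sum>l<Suc r. xv l * h l)" by blast
  have "f = hom_part (Suc 0) f" using hom_part_homog[OF assms(2)] by simp
  also have "\<dots> = (\<Sum>l<Suc r. xv l * Poly_Mapping.single 0 (coef (h l) 0))"
    by (subst h, unfold hom_part_sum hom_part_mult_homog[OF homog_xv]) (simp add: hom_part_0_eq)
  finally show ?thesis by (intro exI[of _ "\<lambda>l. coef (h l) 0"])
qed

definition lin_form :: "nat \<Rightarrow> (nat \<Rightarrow> 'l::field) \<Rightarrow> (nat, 'l) mpoly" where
  "lin_form r g = (\<Sum>l<Suc r. xv l * Poly_Mapping.single 0 (g l))"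

lemma lin_form:
  "lin_form r g \<in> coord_ring r" "homog (Suc 0) (lin_form r g)" "mpoly_eval id v (lin_form r g) = (\<Sum>l<Suc r. v l * g l)"
proof -
  have "homog (Suc 0 + 0) (xv l * Poly_Mapping.single 0 (g l))" for l
    by (intro homog_mult homog_xv homog_const)
  then show "homog (Suc 0) (lin_form r g)" unfolding lin_form_def by (intro homog_sum) simp
qed (auto simp: lin_form_def eval_id simp del: sum.lessThan_Suc intro!: coord_ring_sum coord_ring_mult coord_ring_xv)

context
  fixes r \<gamma> :: nat and x :: "nat \<Rightarrow> nat \<Rightarrow> 'l::field"
  assumes gen: "lin_general r \<gamma> x"
begin

lemma lin_generalD:
  assumes "J \<subseteq> {..<\<gamma>}" "card J = Suc r" "\<And>s. s \<in> J \<Longrightarrow> (\<Sum>l<Suc r. x s l * g l) = 0"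
  shows "\<forall>l\<in>{..<Suc r}. g l = 0"
  using gen assms unfolding lin_general_def by blast

text \<open>K and s are completed to r + 1 points, on which a linear form can take any prescribed
  values.\<close>

lemma separating_linear_form:
  assumes "K \<subseteq> {..<\<gamma>}" "s < \<gamma>" "s \<notin> K" "card K \<le> r" "Suc r \<le> \<gamma>"
  shows "\<exists>g. (\<Sum>l<Suc r. x s l * g l) = 1 \<and> (\<forall>q\<in>K. (\<Sum>l<Suc r. x q l * g l) = 0)"
proof -
  have "finite K" using assms(1) finite_subset by blast
  then obtain J where J: "insert s K \<subseteq> J" "J \<subseteq> {..<\<gamma>}" "card J = Suc r"
    using exists_subset_between[of "insert s K" "Suc r" "{..<\<gamma>}"] assms by auto
  have "finite J" using J(2) finite_subset by blast
  have "\<exists>g. \<forall>q\<in>J. (\<Sum>l<Suc r. x q l * g l) = (if q = s then 1 else 0)"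
    by (rule square_system_solvable[OF \<open>finite J\<close>]) (use J lin_generalD[OF J(2,3)] in auto)
  then obtain g where g: "\<And>q. q \<in> J \<Longrightarrow> (\<Sum>l<Suc r. x q l * g l) = (if q = s then 1 else 0)" by blast
  have "(\<Sum>l<Suc r. x q l * g l) = 0" if "q \<in> K" for q
    using g[of q] J(1) that assms(3) by (auto simp del: sum.lessThan_Suc)
  then show ?thesis using g[of s] J(1) by (intro exI[of _ g]) (auto simp del: sum.lessThan_Suc)
qed

text \<open>Castelnuovo's argument: the other points, at most 2 r of them, are distributed over two
  sets of at most r points, each contained in a hyperplane that misses the point s. The product of
  the two forms is brought to degree t by repeating one of them.\<close>

lemma separating_form:
  assumes "s < \<gamma>" "Suc r \<le> \<gamma>" "\<gamma> \<le> 2 * r + 1" "2 \<le> t"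
  shows "\<exists>h. h \<in> coord_ring r \<and> homog t h \<and> (\<forall>q<\<gamma>. mpoly_eval id (x q) h = (if q = s then 1 else 0))"
proof -
  obtain K where K: "K \<subseteq> {..<\<gamma>} - {s}" "card K = min r (\<gamma> - 1)"
    using obtain_subset_with_card_n[of "min r (\<gamma> - 1)" "{..<\<gamma>} - {s}"] assms(1) by auto
  define K' where "K' = {..<\<gamma>} - {s} - K"
  have "finite K" using K(1) finite_subset by blast
  then have "card K' = \<gamma> - 1 - card K" unfolding K'_def using K(1) assms(1) by (simp add: card_Diff_subset)
  then have "card K' \<le> r" using K(2) assms by auto
  then obtain g' where g': "(\<Sum>l<Suc r. x s l * g' l) = 1" "\<And>q. q \<in> K' \<Longrightarrow> (\<Sum>l<Suc r. x q l * g' l) = 0"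
    using separating_linear_form[of K' s] assms K'_def by auto
  obtain g where g: "(\<Sum>l<Suc r. x s l * g l) = 1" "\<And>q. q \<in> K \<Longrightarrow> (\<Sum>l<Suc r. x q l * g l) = 0"
    using separating_linear_form[of K s] assms K by auto
  define h where "h = lin_form r g' * lin_form r g ^ (t - 1)"
  have pow: "lin_form r g ^ n \<in> coord_ring r \<and> homog n (lin_form r g ^ n)" for n
  proof (induction n)
    case 0
    then show ?case using homog_const[of 1] by simp
  next
    case (Suc n)
    then show ?case using homog_mult[OF lin_form(2)[of r g], of n "lin_form r g ^ n"] lin_form(1)[of r g]
      by (simp add: coord_ring_mult)
  qed
  have "h \<in> coord_ring r" unfolding h_def using pow lin_form(1) by (intro coord_ring_mult) auto
  moreover have "homog t h"
    using homog_mult[OF lin_form(2)[of r g'] conjunct2[OF pow[of "t - 1"]]] assms(4) by (simp add: h_def)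
  moreover have "mpoly_eval id (x q) h = (if q = s then 1 else 0)" if q: "q < \<gamma>" for q
  proof -
    have e: "mpoly_eval id (x q) h = (\<Sum>l<Suc r. x q l * g' l) * (\<Sum>l<Suc r. x q l * g l) ^ (t - 1)"
      by (simp add: h_def eval_id lin_form(3) del: sum.lessThan_Suc)
    consider "q = s" | "q \<in> K'" "q \<noteq> s" | "q \<in> K" "q \<noteq> s" using q unfolding K'_def by auto
    then show ?thesis
    proof cases
      case 1
      then show ?thesis unfolding e using g g' by simp
    next
      case 2
      then show ?thesis unfolding e using g'(2) by simp
    next
      case 3
      then show ?thesis unfolding e using g(2) assms(4) by simp
    qed
  qed
  ultimately show ?thesis by blast
qed

lemma subspace_coord_ring_deg: "module.subspace poly_scale (coord_ring_deg r t)"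
proof -
  interpret vector_space poly_scale by (rule vector_space_poly_scale)
  show ?thesis by (rule subspaceI) (auto simp: coord_ring_deg_iff coord_ring_add homog_add poly_scale_def homog_scale coord_ring_mult)
qed

lemma subspace_points_ideal: "module.subspace poly_scale (points_ideal r \<gamma> x \<inter> coord_ring_deg r t)"
proof -
  interpret vector_space poly_scale by (rule vector_space_poly_scale)
  show ?thesis using subspace_coord_ring_deg[of t]
    by (auto simp: subspace_def points_ideal_0 points_ideal_add) (auto simp: poly_scale_def points_ideal_mult)
qed

lemma coord_ring_deg_span:
  "coord_ring_deg r t \<subseteq> module.span poly_scale 
    ((\<lambda>m. Poly_Mapping.single m 1) ` {m. Poly_Mapping.keys m \<subseteq> {..r} \<and> mdeg m = t} :: (nat, 'l) mpoly set)"
proof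
  interpret vector_space poly_scale by (rule vector_space_poly_scale)
  fix f :: "(nat, 'l) mpoly" assume f: "f \<in> coord_ring_deg r t"
  have "f = (\<Sum>m\<in>Poly_Mapping.keys f. poly_scale (coef f m) (Poly_Mapping.single m 1))"
    by (simp add: poly_scale_def mult_single mpoly_sum_monomials)
  also have "\<dots> \<in> span ((\<lambda>m. Poly_Mapping.single m 1) ` {m. Poly_Mapping.keys m \<subseteq> {..r} \<and> mdeg m = t})"
    using f by (intro span_sum span_scale span_base) (auto simp: coord_ring_deg_def coord_ring_def)
  finally show "f \<in> span ((\<lambda>m. Poly_Mapping.single m 1) ` {m. Poly_Mapping.keys m \<subseteq> {..r} \<and> mdeg m = t})" .
qed

lemma hilbert_fun_eqI:
  fixes v :: "nat \<Rightarrow> (nat, 'l) mpoly"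
  assumes "\<And>k. k < n \<Longrightarrow> v k \<in> coord_ring_deg r t"
    and "\<And>c. (\<Sum>k<n. Poly_Mapping.single 0 (c k) * v k) \<in> points_ideal r \<gamma> x \<Longrightarrow> \<forall>k<n. c k = 0"
    and "\<And>z. z \<in> coord_ring_deg r t \<Longrightarrow> \<exists>c. z - (\<Sum>k<n. Poly_Mapping.single 0 (c k) * v k) \<in> points_ideal r \<gamma> x"
  shows "hilbert_fun r (points_ideal r \<gamma> x) t = n"
  unfolding hilbert_fun_def
proof (rule quot_dim_eq[OF vector_space_poly_scale subspace_points_ideal subspace_coord_ring_deg _ _ coord_ring_deg_span assms(1)])
  interpret vector_space poly_scale by (rule vector_space_poly_scale)
  show "finite ((\<lambda>m. Poly_Mapping.single m (1::'l)) ` {m. Poly_Mapping.keys m \<subseteq> {..r} \<and> mdeg m = t})"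
    by (intro finite_imageI finite_monomials)
  show "\<forall>k<n. c k = 0" if "(\<Sum>k<n. poly_scale (c k) (v k)) \<in> points_ideal r \<gamma> x \<inter> coord_ring_deg r t" for c
    using assms(2)[of c] that by (simp add: poly_scale_def)
  fix z :: "(nat, 'l) mpoly" assume z: "z \<in> coord_ring_deg r t"
  obtain c where c: "z - (\<Sum>k<n. Poly_Mapping.single 0 (c k) * v k) \<in> points_ideal r \<gamma> x" using assms(3)[OF z] by blast
  have "(\<Sum>k<n. poly_scale (c k) (v k)) \<in> coord_ring_deg r t"
    by (rule subspace_sum[OF subspace_coord_ring_deg]) (rule subspace_scale[OF subspace_coord_ring_deg], use assms(1) in auto)
  then have "z - (\<Sum>k<n. poly_scale (c k) (v k)) \<in> coord_ring_deg r t"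
    by (rule subspace_diff[OF subspace_coord_ring_deg z])
  then show "\<exists>c. z - (\<Sum>k<n. poly_scale (c k) (v k)) \<in> points_ideal r \<gamma> x \<inter> coord_ring_deg r t"
    using c by (intro exI[of _ c]) (simp add: poly_scale_def)
qed auto

text \<open>From degree 2 on, the separating forms are dual to the evaluations at the points; in
  degree 1, no nonzero linear form vanishes at r + 1 of the points.\<close>

lemma hilbert_fun_points:
  assumes "Suc r \<le> \<gamma>" "\<gamma> \<le> 2 * r + 1"
  shows "hilbert_fun r (points_ideal r \<gamma> x) t = (if t = 0 then 1 else if t = 1 then Suc r else \<gamma>)"
proof -
  consider "t = 0" | "t = 1" | "2 \<le> t" by linarith
  then show ?thesis
  proof cases
    case 1
    have "hilbert_fun r (points_ideal r \<gamma> x) 0 = Suc 0"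
    proof (rule hilbert_fun_eqI[of "Suc 0" "\<lambda>k. 1"])
      show "1 \<in> coord_ring_deg r 0" using homog_const[of 1] by (simp add: coord_ring_deg_iff)
    next
      fix c :: "nat \<Rightarrow> 'l" assume "(\<Sum>k<Suc 0. Poly_Mapping.single 0 (c k) * 1) \<in> points_ideal r \<gamma> x"
      then have "Poly_Mapping.single 0 (c 0) \<in> points_ideal r \<gamma> x" by simp
      moreover have "0 < \<gamma>" using assms(1) by simp
      ultimately have "c 0 = 0" unfolding points_ideal_homog[OF homog_const] by (auto simp: eval_id)
      then show "\<forall>k<Suc 0. c k = 0" by simp
    next
      fix z :: "(nat, 'l) mpoly" assume "z \<in> coord_ring_deg r 0"
      then have "hom_part 0 z = z" using hom_part_homog[of 0 z 0] by (simp add: coord_ring_deg_iff)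
      then have "z = Poly_Mapping.single 0 (coef z 0)" by (simp add: hom_part_0_eq)
      then have "z - (\<Sum>k<Suc 0. Poly_Mapping.single 0 (coef z 0) * 1) \<in> points_ideal r \<gamma> x"
        using points_ideal_0[of r \<gamma> x] by simp
      then show "\<exists>c. z - (\<Sum>k<Suc 0. Poly_Mapping.single 0 (c k) * 1) \<in> points_ideal r \<gamma> x" 
        by (intro exI[of _ "\<lambda>k. coef z 0"])
    qed
    then show ?thesis using 1 by simp
  next
    case 2
    have "hilbert_fun r (points_ideal r \<gamma> x) 1 = Suc r"
    proof (rule hilbert_fun_eqI[of "Suc r" xv])
      show "xv k \<in> coord_ring_deg r 1" if "k < Suc r" for k
        using that by (simp add: coord_ring_deg_iff coord_ring_xv)
    next
      fix c :: "nat \<Rightarrow> 'l" assume "(\<Sum>k<Suc r. Poly_Mapping.single 0 (c k) * xv k) \<in> points_ideal r \<gamma> x"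
      then have "lin_form r c \<in> points_ideal r \<gamma> x" by (simp add: lin_form_def mult.commute)
      then have "(\<Sum>l<Suc r. x s l * c l) = 0" if "s < \<gamma>" for s
        using that unfolding points_ideal_homog[OF lin_form(2)] lin_form(3) by blast
      then have "\<forall>k\<in>{..<Suc r}. c k = 0" using assms(1) by (intro lin_generalD[of "{..<Suc r}"]) auto
      then show "\<forall>k<Suc r. c k = 0" by simp
    next
      fix z :: "(nat, 'l) mpoly" assume "z \<in> coord_ring_deg r 1"
      then obtain c where c: "z = (\<Sum>l<Suc r. xv l * Poly_Mapping.single 0 (c l))"
        using linear_form_expansion[of z r] by (auto simp: coord_ring_deg_iff)
      have "z - (\<Sum>k<Suc r. Poly_Mapping.single 0 (c k) * xv k) \<in> points_ideal r \<gamma> x" 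
        using points_ideal_0[of r \<gamma> x] unfolding c by (simp add: mult.commute)
      then show "\<exists>c. z - (\<Sum>k<Suc r. Poly_Mapping.single 0 (c k) * xv k) \<in> points_ideal r \<gamma> x" 
        by (intro exI[of _ c])
    qed
    then show ?thesis using 2 by simp
  next
    case 3
    have "\<forall>s. \<exists>h. s < \<gamma> \<longrightarrow> h \<in> coord_ring r \<and> homog t h \<and> (\<forall>q<\<gamma>. mpoly_eval id (x q) h = (if q = s then 1 else 0))"
      using separating_form assms 3 by blast
    from choice[OF this] obtain h where h0: "\<forall>s<\<gamma>. h s \<in> coord_ring r \<and> homog t (h s) \<and> 
      (\<forall>q<\<gamma>. mpoly_eval id (x q) (h s) = (if q = s then 1 else 0))" by blast
    have h: "h s \<in> coord_ring r" "homog t (h s)" "q < \<gamma> \<Longrightarrow> mpoly_eval id (x q) (h s) = (if q = s then 1 else 0)" 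
      if "s < \<gamma>" for s q using h0 that by blast+
    have hom: "homog t (\<Sum>k<\<gamma>. Poly_Mapping.single 0 (c k) * h k)" for c
      by (intro homog_sum homog_scale h) auto
    have ev: "mpoly_eval id (x q) (\<Sum>k<\<gamma>. Poly_Mapping.single 0 (c k) * h k) = c q" if q: "q < \<gamma>" for c q
    proof -
      have "mpoly_eval id (x q) (\<Sum>k<\<gamma>. Poly_Mapping.single 0 (c k) * h k) = (\<Sum>k<\<gamma>. if k = q then c q else 0)"
        unfolding eval_id by (rule sum.cong) (use q h(3) in auto)
      then show ?thesis using q by simp
    qed
    have "hilbert_fun r (points_ideal r \<gamma> x) t = \<gamma>"
    proof (rule hilbert_fun_eqI[of \<gamma> h])
      show "h k \<in> coord_ring_deg r t" if "k < \<gamma>" for k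
        using h[OF that] by (simp add: coord_ring_deg_iff)
    next
      fix c assume "(\<Sum>k<\<gamma>. Poly_Mapping.single 0 (c k) * h k) \<in> points_ideal r \<gamma> x"
      then show "\<forall>k<\<gamma>. c k = 0" unfolding points_ideal_homog[OF hom] using ev by auto
    next
      fix z :: "(nat, 'l) mpoly" assume z: "z \<in> coord_ring_deg r t"
      let ?c = "\<lambda>k. mpoly_eval id (x k) z"
      have "z - (\<Sum>k<\<gamma>. Poly_Mapping.single 0 (?c k) * h k) \<in> coord_ring r"
        using z h(1) by (intro coord_ring_diff coord_ring_sum coord_ring_mult) (auto simp: coord_ring_deg_iff)
      moreover have hz: "homog t (z - (\<Sum>k<\<gamma>. Poly_Mapping.single 0 (?c k) * h k))"
        using z hom by (intro homog_diff) (auto simp: coord_ring_deg_iff)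
      ultimately have "z - (\<Sum>k<\<gamma>. Poly_Mapping.single 0 (?c k) * h k) \<in> points_ideal r \<gamma> x"
        unfolding points_ideal_homog[OF hz] using ev by (simp add: eval_diff[OF field_embedding_id])
      then show "\<exists>c. z - (\<Sum>k<\<gamma>. Poly_Mapping.single 0 (c k) * h k) \<in> points_ideal r \<gamma> x" 
        by (intro exI[of _ ?c])
    qed
    then show ?thesis using 3 by simp
  qed
qed

end

section \<open>Koszul cycles from the Gale transform\<close>

lemma ext_ext: 
  assumes "finite T"
  shows "ext p (ext q \<phi>) T = - ext q (ext p \<phi>) T"
proof -
  define f where "f = (\<lambda>l m. sg l T * sg m (T - {l}) * (p l * q m) * \<phi> (T - {l} - {m}))"
  have 1: "ext p (ext q \<phi>) T = (\<Sum>l\<in>T. \<Sum>m\<in>T - {l}. f l m)"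
    unfolding ext_def f_def sum_distrib_left by (simp add: algebra_simps)
  have "ext q (ext p \<phi>) T = (\<Sum>m\<in>T. \<Sum>l\<in>T - {m}. - f l m)"
    unfolding ext_def f_def sum_distrib_left
  proof (intro sum.cong refl)
    fix m l assume ml: "m \<in> T" "l \<in> T - {m}"
    then have "T - {m} - {l} = T - {l} - {m}" by auto
    then show "sg m T * q m * (sg l (T - {m}) * p l * \<phi> (T - {m} - {l})) 
      = - (sg l T * sg m (T - {l}) * (p l * q m) * \<phi> (T - {l} - {m}))"
      using ml assms by (auto simp: sg_remove algebra_simps)
  qed
  also have "\<dots> = - (\<Sum>l\<in>T. \<Sum>m\<in>T - {l}. f l m)"
  proof -
    have "(\<Sum>m\<in>T. \<Sum>l\<in>T - {m}. f l m) = (\<Sum>m\<in>T. \<Sum>l\<in>T. if l \<noteq> m then f l m else 0)"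
      using assms by (intro sum.cong refl sum.mono_neutral_cong_left) auto
    also have "\<dots> = (\<Sum>l\<in>T. \<Sum>m\<in>T. if l \<noteq> m then f l m else 0)" by (rule sum.swap)
    also have "\<dots> = (\<Sum>l\<in>T. \<Sum>m\<in>T - {l}. f l m)"
      using assms by (intro sum.cong refl sum.mono_neutral_cong_right) auto
    finally show ?thesis by (simp add: sum_negf)
  qed
  finally show ?thesis using 1 by simp
qed

lemma fold_ext_adjoint:
  assumes "finite A"
  shows "(\<Sum>T\<in>Pow A. fold (\<lambda>m. ext (x m)) ms \<phi> T * \<psi> T) = (\<Sum>T\<in>Pow A. \<phi> T * foldr (\<lambda>m. ctr A (x m)) ms \<psi> T)"
proof (induction ms arbitrary: \<phi>)
  case (Cons m ms)
  show ?case unfolding fold_Cons foldr_Cons comp_apply Cons.IH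
    by (rule ctr_ext_adjoint[OF assms, symmetric])
qed simp

lemma foldr_ctr: "foldr (\<lambda>m. ctr A (x m)) ms (\<lambda>T. if T = A then 1 else 0) = full_ctr A (map (\<lambda>m. (x m, 0)) ms)"
  by (induction ms) auto

text \<open>By \<open>ext_ext\<close> the wedge with \<open>x m\<close> can be moved next to the
  form at the cost of a sign.\<close>

lemma fold_ext_eq_0:
  assumes "finite A" "m \<in> set ms" "\<And>T. T \<subseteq> A \<Longrightarrow> ext (x m) \<phi> T = 0" "T \<subseteq> A"
  shows "fold (\<lambda>m. ext (x m)) ms \<phi> T = 0"
  using assms(2-)
proof (induction ms arbitrary: \<phi> T)
  case (Cons m' ms)
  have zero: "fold (\<lambda>m. ext (x m)) ms \<psi> T = 0" if "\<And>T. T \<subseteq> A \<Longrightarrow> \<psi> T = 0" "T \<subseteq> A" for ms \<psi> T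
    using that
  proof (induction ms arbitrary: \<psi> T)
    case (Cons n ns)
    have "ext (x n) \<psi> S = 0" if "S \<subseteq> A" for S
      unfolding ext_def using that Cons.prems(1) by (intro sum.neutral ballI) (metis Diff_subset mult_zero_right order_trans)
    then show ?case using Cons by simp
  qed simp
  show ?case
  proof (cases "m = m'")
    case True
    then show ?thesis using zero[of "ext (x m) \<phi>" T ms] Cons.prems by simp
  next
    case False
    have "ext (x m) (ext (x m') \<phi>) S = 0" if S: "S \<subseteq> A" for S
    proof -
      have "ext (x m') (ext (x m) \<phi>) S = 0"
        unfolding ext_def[of "x m'"] using S Cons.prems(2) by (intro sum.neutral ballI) (metis Diff_subset mult_zero_right order_trans)
      moreover have "finite S" using S assms(1) finite_subset by blast
      ultimately show ?thesis using ext_ext[of S "x m" "x m'" \<phi>] by simp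
    qed
    then show ?thesis using Cons False by simp
  qed
qed simp

lemma omit_ctr_zero_scalars: "omit_ctr A (map (\<lambda>k. (g k, 0)) ks) T = 0"
  by (induction ks arbitrary: T) (simp_all add: ctr_def)

text \<open>The Gale transform of the points, as the space of linear relations between them.\<close>

definition gale :: "nat \<Rightarrow> nat \<Rightarrow> (nat \<Rightarrow> nat \<Rightarrow> 'l::field) \<Rightarrow> (nat \<Rightarrow> 'l) set" where
  "gale r \<gamma> x = {w. \<forall>l<Suc r. (\<Sum>s<\<gamma>. x s l * w s) = 0}"

text \<open>The linear forms on the quadrics of the dual projective space that are combinations of the
  evaluations at the Gale dual points and vanish identically.\<close>

definition quadric_relations :: "nat \<Rightarrow> nat \<Rightarrow> (nat \<Rightarrow> nat \<Rightarrow> 'l::field) \<Rightarrow> (nat \<Rightarrow> 'l) set" where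
  "quadric_relations r \<gamma> x = {c. \<forall>w\<in>gale r \<gamma> x. \<forall>w'\<in>gale r \<gamma> x. (\<Sum>s<\<gamma>. c s * w s * w' s) = 0}"

context
  fixes r \<gamma> :: nat and x :: "nat \<Rightarrow> nat \<Rightarrow> 'l::field"
  assumes gen: "lin_general r \<gamma> x"
begin

lemma relation_unique:
  assumes "J \<subseteq> {..<\<gamma>}" "card J = Suc r" "\<And>l. l < Suc r \<Longrightarrow> (\<Sum>s\<in>J. x s l * w s) = 0"
  shows "\<forall>s\<in>J. w s = 0"
proof -
  have "finite J" using assms(1) finite_subset by blast
  then show ?thesis
    by (rule transposed_injective[of J "{..<Suc r}" x]) (use assms lin_generalD[OF gen assms(1,2)] in auto)
qed

lemma relation_exists:
  assumes "J \<subseteq> {..<\<gamma>}" "card J = Suc r"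
  shows "\<exists>w. \<forall>l<Suc r. (\<Sum>s\<in>J. x s l * w s) = b l"
proof -
  have "finite J" using assms(1) finite_subset by blast
  have "\<exists>w. \<forall>l\<in>{..<Suc r}. (\<Sum>s\<in>J. x s l * w s) = b l"
    by (rule square_system_solvable[of "{..<Suc r}" J]) (use \<open>finite J\<close> assms relation_unique[OF assms] in auto)
  then show ?thesis by auto
qed

text \<open>The Gale dual points are in general position too: the r + 1 points outside K form a
  basis, so the values of a relation on K can be prescribed and determine the others.\<close>

lemma gale_dual_basis:
  assumes "K \<subseteq> {..<\<gamma>}" "card K + Suc r = \<gamma>" "k \<in> K"
  shows "\<exists>w\<in>gale r \<gamma> x. \<forall>j\<in>K. w j = (if j = k then 1 else 0)"
proof -
  have fK: "finite K" using assms(1) finite_subset by blast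
  define J where "J = {..<\<gamma>} - K"
  have J: "J \<subseteq> {..<\<gamma>}" "card J = Suc r" "finite J" "J \<inter> K = {}" "{..<\<gamma>} = J \<union> K"
    using assms fK by (auto simp: J_def card_Diff_subset)
  obtain u where u: "\<And>l. l < Suc r \<Longrightarrow> (\<Sum>s\<in>J. x s l * u s) = - x k l"
    using relation_exists[OF J(1,2), of "\<lambda>l. - x k l"] by auto
  define w where "w = (\<lambda>s. if s \<in> K then (if s = k then 1 else 0) else u s)"
  have "(\<Sum>s<\<gamma>. x s l * w s) = 0" if l: "l < Suc r" for l
  proof -
    have "(\<Sum>s\<in>J. x s l * w s) = (\<Sum>s\<in>J. x s l * u s)"
      using J(4) by (intro sum.cong) (auto simp: w_def)
    moreover have "(\<Sum>s\<in>K. x s l * w s) = (\<Sum>s\<in>K. if s = k then x k l else 0)"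
      by (intro sum.cong) (auto simp: w_def)
    ultimately show ?thesis unfolding J(5) using J(3,4) fK assms(3) u[OF l] by (simp add: sum.union_disjoint)
  qed
  then show ?thesis by (intro bexI[of _ w]) (auto simp: gale_def w_def)
qed

text \<open>c w is orthogonal to the Gale transform, whose annihilator is the space of values of
  linear forms. Concretely, a form is interpolated on r + 1 points, and the error, supported on the
  other points, is tested against the dual basis there.\<close>

lemma quadric_relation_lift:
  assumes "Suc r \<le> \<gamma>" "c \<in> quadric_relations r \<gamma> x" "w \<in> gale r \<gamma> x"
  shows "\<exists>g. \<forall>s<\<gamma>. (\<Sum>l<Suc r. x s l * g l) = c s * w s"
proof -
  define J where "J = {..<Suc r}"
  define K where "K = {..<\<gamma>} - J"
  have J: "J \<subseteq> {..<\<gamma>}" "card J = Suc r" "finite J" using assms(1) by (auto simp: J_def)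
  have K: "K \<subseteq> {..<\<gamma>}" "card K + Suc r = \<gamma>" "finite K" using J assms(1) by (auto simp: K_def card_Diff_subset)
  have "\<exists>g. \<forall>s\<in>J. (\<Sum>l\<in>{..<Suc r}. x s l * g l) = c s * w s"
    by (rule square_system_solvable[of J "{..<Suc r}"]) (use J lin_generalD[OF gen J(1,2)] in auto)
  then obtain g where g: "\<And>s. s \<in> J \<Longrightarrow> (\<Sum>l<Suc r. x s l * g l) = c s * w s" by blast
  define v where "v = (\<lambda>s. c s * w s - (\<Sum>l<Suc r. x s l * g l))"
  have "v k = 0" if k: "k < \<gamma>" for k
  proof (cases "k \<in> K")
    case True
    obtain w' where w': "w' \<in> gale r \<gamma> x" "\<And>j. j \<in> K \<Longrightarrow> w' j = (if j = k then 1 else 0)"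
      using gale_dual_basis[OF K(1,2) True] by blast
    have "(\<Sum>s<\<gamma>. v s * w' s) = (\<Sum>s<\<gamma>. c s * w s * w' s) - (\<Sum>s<\<gamma>. \<Sum>l<Suc r. g l * (x s l * w' s))"
      by (simp add: v_def algebra_simps sum_subtractf sum_distrib_left del: sum.lessThan_Suc)
    also have "(\<Sum>s<\<gamma>. \<Sum>l<Suc r. g l * (x s l * w' s)) = (\<Sum>l<Suc r. g l * (\<Sum>s<\<gamma>. x s l * w' s))"
      by (subst sum.swap) (simp add: sum_distrib_left del: sum.lessThan_Suc)
    also have "\<dots> = 0" using w'(1) by (intro sum.neutral) (auto simp: gale_def)
    also have "(\<Sum>s<\<gamma>. c s * w s * w' s) = 0" using assms(2,3) w'(1) by (simp add: quadric_relations_def)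
    finally have "(\<Sum>s<\<gamma>. v s * w' s) = 0" by simp
    moreover have "(\<Sum>s<\<gamma>. v s * w' s) = (\<Sum>s<\<gamma>. if s = k then v k else 0)"
    proof (rule sum.cong)
      fix s assume "s \<in> {..<\<gamma>}"
      then consider "s \<in> J" "s \<noteq> k" | "s \<in> K" using True K_def by blast
      then show "v s * w' s = (if s = k then v k else 0)"
      proof cases
        case 1
        then show ?thesis using g by (simp add: v_def)
      next
        case 2
        then show ?thesis using w'(2) by simp
      qed
    qed simp
    ultimately show ?thesis using k by simp
  next
    case False
    then show ?thesis using g k by (simp add: v_def K_def)
  qed
  then show ?thesis by (intro exI[of _ g]) (simp add: v_def)
qed

text \<open>A quadric relation \<open>c\<close> multiplies the Gale transform into the linear forms on the points. The
  Koszul relations between the products \<open>c w\<close> and the \<open>w\<close> therefore give, with a basis \<open>w\<close> of the Gale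
  transform, the functional \<open>\<xi>\<close> on the Koszul homology of the ideal. Its coefficient at \<open>p0, ms\<close> is
  the product of the values of \<open>c\<close> at \<open>ms\<close> times a determinant of Gale coordinates, which is \<open>1\<close> if
  the basis is dual to \<open>p0, ms\<close>.\<close>

theorem betti_lower_bound:
  assumes num: "Suc r \<le> \<gamma>" "\<gamma> \<le> 2 * r + 1" "\<gamma> = r + s + 2" "s < r"
    and nz: "\<And>q. q < \<gamma> \<Longrightarrow> \<exists>l<Suc r. x q l \<noteq> 0"
    and c: "\<And>b. b < N \<Longrightarrow> c b \<in> quadric_relations r \<gamma> x"
    and S: "\<And>b. b < N \<Longrightarrow> S b \<subseteq> {..<\<gamma>} \<and> card (S b) = s"
    and diag: "\<And>b q. b < N \<Longrightarrow> q \<in> S b \<Longrightarrow> c b q \<noteq> 0"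
    and off: "\<And>a b. a < N \<Longrightarrow> b < N \<Longrightarrow> a \<noteq> b \<Longrightarrow> \<exists>q\<in>S b. c a q = 0"
  shows "N \<le> betti r (points_ideal r \<gamma> x) (r - s) (r - s + 2)"
proof -
  define I where "I = points_ideal r \<gamma> x"
  define A where "A = {..<Suc r}"
  have fA: "finite A" "card A = Suc r" by (simp_all add: A_def)
  define i where "i = r - s"
  define F where "F = (SOME F. graded_free_resolution r I F)"
  have F: "graded_free_resolution r I F"
    unfolding F_def I_def
    by (rule someI_ex, rule graded_free_resolution_exists)
      (auto intro: points_ideal_0 points_ideal_add points_ideal_mult points_ideal_hom_part subsetD[OF points_ideal_coord_ring])

  \<comment> \<open>Together \<open>p0 b\<close> and \<open>ms b\<close> are s + 1 points, as many
    as the dimension of the Gale transform, so it has a basis dual to them.\<close>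
  define ms where "ms = (\<lambda>b. SOME ms. set ms = S b \<and> distinct ms)"
  define p0 where "p0 = (\<lambda>b. SOME p. p < \<gamma> \<and> p \<notin> S b)"
  have ms: "set (ms b) = S b" "distinct (ms b)" and p0: "p0 b < \<gamma>" "p0 b \<notin> S b" if b: "b < N" for b
  proof -
    have fS: "finite (S b)" using S[OF b] finite_subset by blast
    from someI_ex[OF finite_distinct_list[OF fS]] show "set (ms b) = S b" "distinct (ms b)" by (simp_all add: ms_def)
    have "\<not> {..<\<gamma>} \<subseteq> S b" using card_mono[OF fS, of "{..<\<gamma>}"] S[OF b] num by auto
    then have "\<exists>p. p < \<gamma> \<and> p \<notin> S b" by blast
    from someI_ex[OF this] show "p0 b < \<gamma>" "p0 b \<notin> S b" by (simp_all add: p0_def)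
  qed
  have len: "length (ms b) = s" if b: "b < N" for b
    using ms[OF b] S[OF b] distinct_card[of "ms b"] by simp

  define dual where "dual = (\<lambda>b k w g. w \<in> gale r \<gamma> x \<and> (\<forall>j\<in>set (p0 b # ms b). w j = (if j = k then 1 else 0)) \<and>
      (\<forall>q<\<gamma>. (\<Sum>l\<in>A. x q l * g l) = c b q * w q))"
  define y where "y = (\<lambda>b k. SOME y. dual b k (fst y) (snd y))"
  define w where "w = (\<lambda>b k. fst (y b k))"
  define g where "g = (\<lambda>b k. snd (y b k))"
  have "dual b k (w b k) (g b k)" if b: "b < N" and k: "k \<in> set (p0 b # ms b)" for b k
  proof -
    define K where "K = set (p0 b # ms b)"
    have "finite (S b)" using S[OF b] finite_subset by blast
    then have K: "K \<subseteq> {..<\<gamma>}" "card K + Suc r = \<gamma>" using ms[OF b] p0[OF b] S[OF b] num by (auto simp: K_def)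
    obtain v where v: "v \<in> gale r \<gamma> x" "\<forall>j\<in>K. v j = (if j = k then 1 else 0)"
      using gale_dual_basis[OF K] k unfolding K_def by blast
    obtain h where h: "\<forall>q<\<gamma>. (\<Sum>l<Suc r. x q l * h l) = c b q * v q"
      using quadric_relation_lift[OF num(1) c[OF b] v(1)] by blast
    have "\<exists>y. dual b k (fst y) (snd y)"
      using v h by (intro exI[of _ "(v, h)"]) (simp add: dual_def A_def K_def del: sum.lessThan_Suc)
    from someI_ex[OF this] show ?thesis by (simp add: y_def w_def g_def)
  qed
  then have wg: "\<forall>k\<in>set (p0 b # ms b). w b k \<in> gale r \<gamma> x \<and> (\<forall>j\<in>set (p0 b # ms b). w b k j = (if j = k then 1 else 0)) \<and>
      (\<forall>q<\<gamma>. (\<Sum>l\<in>A. x q l * g b k l) = c b q * w b k q)" if "b < N" for b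
    using that unfolding dual_def by blast
  \<comment> \<open>Wherever c is nonzero at q this is x_q wedged with the contraction by all s + 1
    lifts, divided by that value of c, as \<open>ext_full_ctr\<close> shows.\<close>
  define \<xi> where "\<xi> = (\<lambda>b q. omit_ctr A (map (\<lambda>k. (g b k, w b k q)) (p0 b # ms b)))"
  have \<xi>_gale: "(\<Sum>q<\<gamma>. x q l * \<xi> b q T) = 0" if "b < N" "l < Suc r" for b l T
    unfolding \<xi>_def using wg[OF that(1)] that(2) by (intro sum_omit_ctr) (auto simp: gale_def)
  \<comment> \<open>The lift of c w pairs with \<open>x q\<close> to \<open>c b q\<close> times the
    value of w at q, whereas the scalars are values at \<open>q'\<close>. These fit together if q =
    q', and also if \<open>c b q = 0\<close>; the second case yields the zeros off the
    diagonal.\<close>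
  have \<xi>_ext': "ext (x q) (\<xi> b q') T = 0" if b: "b < N" and q: "q < \<gamma>" and T: "T \<subseteq> A" and qq: "q = q' \<or> c b q = 0" for b q q' T
    unfolding \<xi>_def
  proof (rule ext_omit_ctr[OF fA(1) _ T, where c = "c b q"])
    fix h a assume "(h, a) \<in> set (map (\<lambda>k. (g b k, w b k q')) (p0 b # ms b))"
    then obtain k where "k \<in> set (p0 b # ms b)" "h = g b k" "a = w b k q'" by auto
    then show "(\<Sum>l\<in>A. x q l * h l) = c b q * a" using wg[OF b] q qq by auto
  qed
  have \<xi>_ext: "ext (x q) (\<xi> b q) T = 0" if "b < N" "q < \<gamma>" "T \<subseteq> A" for b q T
    using \<xi>_ext'[OF that] by simp

  \<comment> \<open>The volume form contracted with s points, hence of degree r + 1 - s = i +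
    1.\<close>
  define \<eta> where "\<eta> = (\<lambda>b. full_ctr A (map (\<lambda>m. (x m, 0)) (ms b)))"
  have \<eta>_card: "\<eta> b T = 0" if "b < N" "T \<subseteq> A" "card T \<noteq> Suc i" for b T
    unfolding \<eta>_def using that num(4) len[OF that(1)] fA by (intro full_ctr_card) (auto simp: i_def)
  define pair where "pair = (\<lambda>a b. \<Sum>T\<in>Pow A. \<xi> a (p0 b) T * \<eta> b T)"
  \<comment> \<open>Moving the contractions over to the other factor leaves the top coefficient of
    \<open>\<xi>\<close> wedged with the points of \<open>ms b\<close>.\<close>
  have pair_fold: "pair a b = fold (\<lambda>m. ext (x m)) (ms b) (\<xi> a (p0 b)) A" for a b
  proof -
    have "pair a b = (\<Sum>T\<in>Pow A. fold (\<lambda>m. ext (x m)) (ms b) (\<xi> a (p0 b)) T * (if T = A then 1 else 0))"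
      unfolding pair_def \<eta>_def foldr_ctr[symmetric] by (rule fold_ext_adjoint[OF fA(1), symmetric])
    then show ?thesis using fA(1) by (simp add: if_distrib[of "(*) _"] cong: if_cong)
  qed
  have pair_off: "pair a b = 0" if ab: "a < N" "b < N" "a \<noteq> b" for a b
  proof -
    obtain q where q: "q \<in> S b" "c a q = 0" using off[OF ab] by blast
    then have "q < \<gamma>" using S[OF ab(2)] by auto
    show ?thesis unfolding pair_fold
    proof (rule fold_ext_eq_0[OF fA(1)])
      show "q \<in> set (ms b)" using ms(1)[OF ab(2)] q(1) by simp
      show "ext (x q) (\<xi> a (p0 b)) T = 0" if "T \<subseteq> A" for T
        by (rule \<xi>_ext'[OF ab(1) \<open>q < \<gamma>\<close> that]) (simp add: q(2))
    qed simp
  qed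
  have pair_diag: "pair b b \<noteq> 0" if b: "b < N" for b
  proof -
    \<comment> \<open>At \<open>p0 b\<close> the scalar of \<open>p0 b\<close> is 1 and the others
      are 0, so \<open>\<xi>\<close> there is the full contraction by the lifts belonging to
      \<open>ms b\<close>.\<close>
    have w0: "w b k (p0 b) = (if k = p0 b then 1 else 0)" if "k \<in> set (p0 b # ms b)" for k
      using wg[OF b] that by auto
    have eq: "map (\<lambda>k. (g b k, w b k (p0 b))) (ms b) = map (\<lambda>k. (g b k, 0)) (ms b)"
      using w0 p0(2)[OF b] ms(1)[OF b] by auto
    have "\<xi> b (p0 b) = full_ctr A (map (\<lambda>k. (g b k, 0)) (ms b))"
      unfolding \<xi>_def list.map omit_ctr.simps eq using w0[of "p0 b"] by (simp add: omit_ctr_zero_scalars[abs_def])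
    then have "pair b b = prod_list (map (c b) (ms b)) * (if A = A then 1 else 0)"
      unfolding pair_fold
    proof (simp only:, intro iterated_ext_full_ctr)
      fix k m assume km: "k \<in> set (ms b)" "m \<in> set (ms b)"
      then have "m < \<gamma>" using ms(1)[OF b] S[OF b] by auto
      then have "(\<Sum>l\<in>A. x m l * g b k l) = c b m * w b k m" using wg[OF b] km by auto
      then show "(\<Sum>l\<in>A. x m l * g b k l) = (if k = m then c b k else 0)" using wg[OF b] km by auto
    qed (use fA ms(2)[OF b] in auto)
    moreover have "prod_list (map (c b) (ms b)) \<noteq> 0"
      using diag[OF b] ms(1)[OF b] by (auto simp: prod_list_zero_iff)
    ultimately show ?thesis by simp
  qed

  define h where "h = (\<lambda>p. SOME h. h \<in> coord_ring r \<and> homog 2 h \<and> (\<forall>q<\<gamma>. mpoly_eval id (x q) h = (if q = p then 1 else 0)))"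
  have h: "h p \<in> coord_ring r" "homog 2 (h p)" "q < \<gamma> \<Longrightarrow> mpoly_eval id (x q) (h p) = (if q = p then 1 else 0)" if "p < \<gamma>" for p q
    using someI_ex[OF separating_form[OF gen that num(1,2) order_refl]] unfolding h_def by blast+
  \<comment> \<open>Formally the Koszul boundary of the chain with value \<open>\<eta> b\<close> at
    \<open>p0 b\<close> and 0 at the other points. Such values need not come from linear forms, so
    the class may be nonzero; but in degree 2 every function on the points is realised, by means of
    \<open>h\<close>.\<close>
  define z where "z = (\<lambda>b T. Poly_Mapping.single 0 (ctr A (x (p0 b)) (\<eta> b) T) * h (p0 b))"
  have z_eval: "mpoly_eval id (x q) (z b T) = (if q = p0 b then ctr A (x q) (\<eta> b) T else 0)" if "b < N" "q < \<gamma>" for b q T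
    using h(3)[OF p0(1)[OF that(1)] that(2)] by (simp add: z_def eval_id)
  have eval_ctr: "mpoly_eval id v (ctr A xv \<psi> T) = ctr A v (\<lambda>T. mpoly_eval id v (\<psi> T)) T" for v \<psi> T
    by (simp add: ctr_def eval_id eval_id_sg)
  have sg_xv: "homog (Suc 0) (sg l T * xv l :: (nat, 'l) mpoly)" for l T
    using homog_mult[OF homog_minus_one_power homog_xv, of "card {m \<in> T. m < l}" l] by (simp add: sg_def)

  have "N \<le> quot_dim fun_scale (tensor_cycles F i (i + 2)) (tensor_boundaries F i (i + 2))"
  proof (rule tor_dimension_ge[OF F, where z = z])
    show "0 < i" using num(4) by (simp add: i_def)
    show "koszul_chain r (Suc r) i (z b)" if b: "b < N" for b
      unfolding koszul_chain_def A_def[symmetric]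
    proof (intro allI impI conjI)
      fix T assume T: "T \<subseteq> A"
      show "z b T \<in> coord_ring r" unfolding z_def by (intro coord_ring_mult coord_ring_const h(1) p0(1)[OF b])
      assume "card T \<noteq> i"
      moreover have "finite T" using T fA(1) finite_subset by blast
      ultimately have "\<eta> b (insert l T) = 0" if "l \<in> A - T" for l
        using that T by (intro \<eta>_card[OF b]) auto
      then have "ctr A (x (p0 b)) (\<eta> b) T = 0" by (simp add: ctr_def)
      then show "z b T = 0" by (simp add: z_def)
    qed
    show hz: "homog 2 (z b T)" if "b < N" for b T
      unfolding z_def by (intro homog_scale h(2) p0(1)[OF that])
    show "ctr {..<Suc r} xv (z b) T \<in> I" if b: "b < N" and T: "T \<subseteq> {..<Suc r}" for b T
    proof -
      have "homog (Suc 0 + 2) (ctr A xv (z b) T)"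
        unfolding ctr_def by (intro homog_sum homog_mult sg_xv hz[OF b])
      moreover have "ctr A xv (z b) T \<in> coord_ring r"
        unfolding ctr_def by (intro coord_ring_sum coord_ring_mult coord_ring_sg coord_ring_xv)
          (auto simp: A_def z_def intro!: coord_ring_mult h(1) p0(1)[OF b])
      moreover have "mpoly_eval id (x q) (ctr A xv (z b) T) = 0" if q: "q < \<gamma>" for q
      proof (cases "q = p0 b")
        case True
        then have "mpoly_eval id (x q) (ctr A xv (z b) T) = ctr A (x q) (ctr A (x q) (\<eta> b)) T"
          unfolding eval_ctr using z_eval[OF b q] by simp
        then show ?thesis using ctr_ctr[OF fA(1)] T by (simp add: A_def)
      next
        case False
        then show ?thesis unfolding eval_ctr using z_eval[OF b q] by simp
      qed
      ultimately show ?thesis unfolding I_def A_def[symmetric] by (simp add: points_ideal_homog)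
    qed
  next
    fix k :: "nat \<Rightarrow> 'l" and \<phi> 
    assume \<phi>: "koszul_chain r (Suc r) (Suc i) \<phi>"
      and k: "\<And>T. T \<subseteq> {..<Suc r} \<Longrightarrow> (\<Sum>b<N. Poly_Mapping.single 0 (k b) * z b T) - ctr {..<Suc r} xv \<phi> T \<in> I"
    \<comment> \<open>Only the linear part of \<open>\<phi>\<close> enters, because the relation is
      compared in degree 2.\<close>
    define U where "U = (\<lambda>q T. mpoly_eval id (x q) (hom_part 1 (\<phi> T)))"
    have hom2: "homog 2 (\<Sum>b<N. Poly_Mapping.single 0 (k b) * z b T)" for T
      unfolding z_def by (intro homog_sum homog_scale h(2) p0(1)) auto
    \<comment> \<open>At each point, the formal primitive of the combination of cycles and the
      actual primitive \<open>\<phi>\<close> have the same contraction with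
      \<open>x q\<close>.\<close>
    have closed: "ctr A (x q) (\<lambda>T. (\<Sum>b<N. k b * (if q = p0 b then \<eta> b T else 0)) - U q T) T = 0" 
      if q: "q < \<gamma>" and T: "T \<subseteq> A" for q T
    proof -
      have "hom_part 2 (ctr A xv \<phi> T) = ctr A xv (\<lambda>T. hom_part 1 (\<phi> T)) T"
        unfolding ctr_def hom_part_sum hom_part_mult_homog[OF sg_xv] by (simp add: numeral_2_eq_2)
      then have "mpoly_eval id (x q) (hom_part 2 (ctr A xv \<phi> T)) = ctr A (x q) (U q) T"
        by (simp add: eval_ctr U_def)
      moreover have "mpoly_eval id (x q) (hom_part 2 ((\<Sum>b<N. Poly_Mapping.single 0 (k b) * z b T) - ctr A xv \<phi> T)) = 0"
        using k[of T] T q by (simp add: I_def points_ideal_def A_def)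
      ultimately have "(\<Sum>b<N. k b * mpoly_eval id (x q) (z b T)) = ctr A (x q) (U q) T"
        by (simp add: hom_part_diff eval_id hom_part_homog[OF hom2])
      moreover have "(\<Sum>b<N. k b * mpoly_eval id (x q) (z b T)) = ctr A (x q) (\<lambda>T. \<Sum>b<N. k b * (if q = p0 b then \<eta> b T else 0)) T"
        unfolding ctr_sum ctr_scale by (intro sum.cong) (auto simp: z_eval q ctr_def)
      ultimately show ?thesis by (simp add: ctr_diff)
    qed
    have zero: "(\<Sum>T\<in>Pow A. \<xi> a q T * ((\<Sum>b<N. k b * (if q = p0 b then \<eta> b T else 0)) - U q T)) = 0" 
      if a: "a < N" and q: "q < \<gamma>" for a q
    proof -
      obtain l where l: "l \<in> A" "x q l \<noteq> 0" using nz[OF q] by (auto simp: A_def)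
      show ?thesis by (rule pairing_vanishes[OF fA(1) l \<xi>_ext[OF a q] closed[OF q]])
    qed
    \<comment> \<open>As a function of q, \<open>\<xi> a\<close> lies in the Gale transform, so it
      is orthogonal to the values of a linear form.\<close>
    have U0: "(\<Sum>q<\<gamma>. \<xi> a q T * U q T) = 0" if a: "a < N" and T: "T \<subseteq> A" for a T
    proof -
      have "hom_part 1 (\<phi> T) \<in> coord_ring r" "homog (Suc 0) (hom_part 1 (\<phi> T))"
        using koszul_chainD(1)[OF \<phi>, of T] T by (auto simp: A_def coord_ring_hom_part)
      from linear_form_expansion[OF this] obtain u where u: "hom_part 1 (\<phi> T) = (\<Sum>l<Suc r. xv l * Poly_Mapping.single 0 (u l))"
        by blast
      have "(\<Sum>q<\<gamma>. \<xi> a q T * U q T) = (\<Sum>q<\<gamma>. \<Sum>l<Suc r. u l * (x q l * \<xi> a q T))"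
        unfolding U_def u eval_id sum_distrib_left by (simp add: mult_ac del: sum.lessThan_Suc)
      also have "\<dots> = (\<Sum>l<Suc r. u l * (\<Sum>q<\<gamma>. x q l * \<xi> a q T))"
        by (subst sum.swap) (simp add: sum_distrib_left del: sum.lessThan_Suc)
      also have "\<dots> = 0" using \<xi>_gale[OF a] by (intro sum.neutral) auto
      finally show ?thesis .
    qed
    show "\<forall>b<N. k b = 0"
    proof (intro allI impI)
      fix a assume a: "a < N"
      \<comment> \<open>Summed over all points the contribution of \<open>U\<close> disappears, and
        the diagonal pairing isolates \<open>k a\<close>.\<close>
      have "0 = (\<Sum>q<\<gamma>. \<Sum>T\<in>Pow A. \<xi> a q T * ((\<Sum>b<N. k b * (if q = p0 b then \<eta> b T else 0)) - U q T))"
        using zero[OF a] by (intro sum.neutral[symmetric]) auto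
      also have "\<dots> = (\<Sum>q<\<gamma>. \<Sum>T\<in>Pow A. \<Sum>b<N. k b * (if q = p0 b then \<xi> a q T * \<eta> b T else 0)) - (\<Sum>q<\<gamma>. \<Sum>T\<in>Pow A. \<xi> a q T * U q T)"
        unfolding right_diff_distrib sum_subtractf sum_distrib_left
        by (intro arg_cong2[where f = "(-)"] sum.cong refl) auto
      also have "(\<Sum>q<\<gamma>. \<Sum>T\<in>Pow A. \<xi> a q T * U q T) = (\<Sum>T\<in>Pow A. \<Sum>q<\<gamma>. \<xi> a q T * U q T)"
        by (rule sum.swap)
      also have "\<dots> = 0" using U0[OF a] by (intro sum.neutral) auto
      also have "(\<Sum>q<\<gamma>. \<Sum>T\<in>Pow A. \<Sum>b<N. k b * (if q = p0 b then \<xi> a q T * \<eta> b T else 0))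
        = (\<Sum>q<\<gamma>. \<Sum>b<N. k b * (if q = p0 b then pair a b else 0))"
        by (intro sum.cong refl, subst sum.swap) (auto simp: pair_def sum_distrib_left intro!: sum.cong)
      also have "\<dots> = (\<Sum>b<N. \<Sum>q<\<gamma>. if q = p0 b then k b * pair a b else 0)"
        by (subst sum.swap) (auto intro!: sum.cong)
      also have "\<dots> = (\<Sum>b<N. k b * pair a b)"
        using p0(1) by (intro sum.cong) auto
      also have "\<dots> = (\<Sum>b<N. if b = a then k a * pair a a else 0)"
        using pair_off[OF a] by (intro sum.cong) auto
      also have "\<dots> = k a * pair a a" using a by simp
      finally show "k a = 0" using pair_diag[OF a] by simp
    qed
  qed
  then show ?thesis by (simp add: betti_def F_def I_def i_def Let_def)
qed

end

section \<open>Existence, supports and general position of quadric relations\<close>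

definition sym_pairs :: "nat set \<Rightarrow> (nat \<times> nat) set" where
  "sym_pairs K = {(j, k). j \<in> K \<and> k \<in> K \<and> j \<le> k}"

lemma finite_sym_pairs [simp]: "finite K \<Longrightarrow> finite (sym_pairs K)"
  by (rule finite_subset[of _ "K \<times> K"]) (auto simp: sym_pairs_def)

lemma card_sym_pairs: "finite K \<Longrightarrow> 2 * card (sym_pairs K) = card K * Suc (card K)"
proof -
  assume K: "finite K"
  let ?S = "{(j, k). j \<in> K \<and> k \<in> K \<and> k \<le> j}"
  have fS: "finite ?S" by (rule finite_subset[of _ "K \<times> K"]) (use K in auto)
  have "sym_pairs K \<union> ?S = K \<times> K" "sym_pairs K \<inter> ?S = (\<lambda>j. (j, j)) ` K"
    by (auto simp: sym_pairs_def)
  moreover have "card ((\<lambda>j. (j, j)) ` K) = card K" by (rule card_image) (auto simp: inj_on_def)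
  moreover have "card ?S = card (sym_pairs K)"
    by (rule bij_betw_same_card[of "\<lambda>(j, k). (k, j)"], rule bij_betwI[where g = "\<lambda>(j, k). (k, j)"])
      (auto simp: sym_pairs_def)
  ultimately show ?thesis using card_Un_Int[OF finite_sym_pairs[OF K] fS] K by simp
qed

text \<open>Used with n the dimension of the space of quadrics in s + 1 variables: any n Gale dual
  points then impose independent conditions on quadrics.\<close>

definition quadric_general :: "nat \<Rightarrow> nat \<Rightarrow> nat \<Rightarrow> (nat \<Rightarrow> nat \<Rightarrow> 'l::field) \<Rightarrow> bool" where
  "quadric_general n r \<gamma> x \<longleftrightarrow> (\<forall>J\<subseteq>{..<\<gamma>}. card J = n \<longrightarrow> 
     (\<forall>c\<in>quadric_relations r \<gamma> x. (\<forall>q<\<gamma>. q \<notin> J \<longrightarrow> c q = 0) \<longrightarrow> (\<forall>q<\<gamma>. c q = 0)))"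

context
  fixes r \<gamma> :: nat and x :: "nat \<Rightarrow> nat \<Rightarrow> 'l::field"
  assumes gen: "lin_general r \<gamma> x"
begin

text \<open>The conditions on c are linear equations, one for each unordered pair of basis vectors
  of the Gale transform; the unknowns are the values of c outside \<open>B\<close>.\<close>

lemma quadric_relation_vanishing:
  assumes "\<gamma> = r + s + 2" "B \<subseteq> {..<\<gamma>}" "(s + 1) * (s + 2) div 2 + card B < \<gamma>"
  shows "\<exists>c\<in>quadric_relations r \<gamma> x. (\<forall>q\<in>B. c q = 0) \<and> (\<exists>q<\<gamma>. c q \<noteq> 0)"
proof -
  define K where "K = {Suc r..<\<gamma>}"
  have K: "K \<subseteq> {..<\<gamma>}" "card K + Suc r = \<gamma>" "finite K" "card K = s + 1" using assms(1) by (auto simp: K_def)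
  define w where "w = (\<lambda>k. SOME w. w \<in> gale r \<gamma> x \<and> (\<forall>j\<in>K. w j = (if j = k then 1 else 0)))"
  have w: "w k \<in> gale r \<gamma> x" "j \<in> K \<Longrightarrow> w k j = (if j = k then 1 else 0)" if "k \<in> K" for k j
    using someI_ex[OF gale_dual_basis[OF gen K(1,2) that, unfolded Bex_def]] unfolding w_def by blast+
  \<comment> \<open>The difference of the two sides vanishes on \<open>K\<close>, so it is a
    relation between the first r + 1 points and therefore zero.\<close>
  have expand: "v q = (\<Sum>k\<in>K. v k * w k q)" if v: "v \<in> gale r \<gamma> x" and q: "q < \<gamma>" for v q
  proof -
    define u where "u = (\<lambda>q. v q - (\<Sum>k\<in>K. v k * w k q))"
    have uK: "u j = 0" if "j \<in> K" for j
    proof -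
      have "(\<Sum>k\<in>K. v k * w k j) = (\<Sum>k\<in>K. if k = j then v j else 0)"
        using w(2) that by (intro sum.cong) auto
      then show ?thesis using K(3) that by (simp add: u_def)
    qed
    have "(\<Sum>q\<in>{..<Suc r}. x q l * u q) = 0" if l: "l < Suc r" for l
    proof -
      have "(\<Sum>q<\<gamma>. x q l * u q) = (\<Sum>q<\<gamma>. x q l * v q) - (\<Sum>q<\<gamma>. \<Sum>k\<in>K. v k * (x q l * w k q))"
        by (simp add: u_def right_diff_distrib sum_subtractf sum_distrib_left mult_ac)
      also have "(\<Sum>q<\<gamma>. \<Sum>k\<in>K. v k * (x q l * w k q)) = (\<Sum>k\<in>K. v k * (\<Sum>q<\<gamma>. x q l * w k q))"
        by (subst sum.swap) (simp add: sum_distrib_left)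
      also have "\<dots> = 0" using w(1) l by (intro sum.neutral) (auto simp: gale_def)
      also have "(\<Sum>q<\<gamma>. x q l * v q) = 0" using v l by (simp add: gale_def)
      finally have "(\<Sum>q<\<gamma>. x q l * u q) = 0" by simp
      moreover have "(\<Sum>q<\<gamma>. x q l * u q) = (\<Sum>q<Suc r. x q l * u q)"
        using uK assms(1) by (intro sum.mono_neutral_right) (auto simp: K_def)
      ultimately show ?thesis by simp
    qed
    then have u0: "\<forall>q\<in>{..<Suc r}. u q = 0"
      using assms(1) by (intro relation_unique[OF gen]) auto
    have "u q = 0"
    proof (cases "q < Suc r")
      case True
      then show ?thesis using u0 by simp
    next
      case False
      then show ?thesis using uK[of q] q by (simp add: K_def)
    qed
    then show ?thesis by (simp add: u_def)
  qed
  have "card (sym_pairs K) = (s + 1) * (s + 2) div 2"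
    using card_sym_pairs[OF K(3)] unfolding K(4) by simp
  moreover have "card ({..<\<gamma>} - B) = \<gamma> - card B"
    using assms(2) by (simp add: card_Diff_subset finite_subset)
  ultimately have "card (sym_pairs K) < card ({..<\<gamma>} - B)" using assms(3) by simp
  then obtain c where c: "\<exists>q\<in>{..<\<gamma>} - B. c q \<noteq> 0"
    "\<forall>e\<in>sym_pairs K. (\<Sum>q\<in>{..<\<gamma>} - B. w (fst e) q * w (snd e) q * c q) = 0"
    using nonzero_solution[of "sym_pairs K" "{..<\<gamma>} - B" "\<lambda>e q. w (fst e) q * w (snd e) q"] K(3) by auto
  define c' where "c' = (\<lambda>q. if q \<in> B then 0 else c q)"
  have sym: "(\<Sum>q<\<gamma>. c' q * w j q * w k q) = 0" if "j \<in> K" "k \<in> K" for j k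
  proof -
    have le: "(\<Sum>q<\<gamma>. c' q * w j q * w k q) = 0" if "(j, k) \<in> sym_pairs K" for j k
    proof -
      have "(\<Sum>q<\<gamma>. c' q * w j q * w k q) = (\<Sum>q\<in>{..<\<gamma>} - B. w j q * w k q * c q)"
        by (intro sum.mono_neutral_cong_right) (auto simp: c'_def)
      then show ?thesis using bspec[OF c(2) that] by simp
    qed
    show ?thesis
    proof (cases "j \<le> k")
      case True
      then show ?thesis using that by (intro le) (simp add: sym_pairs_def)
    next
      case False
      then have "(\<Sum>q<\<gamma>. c' q * w k q * w j q) = 0" using that by (intro le) (simp add: sym_pairs_def)
      then show ?thesis by (simp add: mult_ac)
    qed
  qed
  have "c' \<in> quadric_relations r \<gamma> x"
    unfolding quadric_relations_def
  proof (intro CollectI ballI)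
    fix v v' assume v: "v \<in> gale r \<gamma> x" "v' \<in> gale r \<gamma> x"
    have "(\<Sum>q<\<gamma>. c' q * v q * v' q) = (\<Sum>q<\<gamma>. c' q * (\<Sum>j\<in>K. v j * w j q) * (\<Sum>k\<in>K. v' k * w k q))"
      using expand[OF v(1)] expand[OF v(2)] by (intro sum.cong) auto
    also have "\<dots> = (\<Sum>q<\<gamma>. \<Sum>j\<in>K. \<Sum>k\<in>K. (v j * v' k) * (c' q * w j q * w k q))"
      by (simp add: sum_distrib_left sum_distrib_right mult_ac)
    also have "\<dots> = (\<Sum>j\<in>K. \<Sum>k\<in>K. (v j * v' k) * (\<Sum>q<\<gamma>. c' q * w j q * w k q))"
      unfolding sum_distrib_left by (subst sum.swap, rule sum.cong[OF refl], subst sum.swap) (rule refl)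
    also have "\<dots> = 0" using sym by (intro sum.neutral ballI) simp
    finally show "(\<Sum>q<\<gamma>. c' q * v q * v' q) = 0" .
  qed
  then show ?thesis using c(1) by (intro bexI[of _ c']) (auto simp: c'_def)
qed

text \<open>On a support of at most s + 1 points a Gale vector w could be chosen with value 1 at q
  and 0 at the rest, and the relation for w, w would read \<open>c q = 0\<close>. The bound s is
  what \<open>betti_lower_bound\<close> asks for.\<close>

lemma quadric_relation_support:
  assumes "\<gamma> = r + s + 2" "c \<in> quadric_relations r \<gamma> x" "q < \<gamma>" "c q \<noteq> 0"
  shows "s \<le> card {q \<in> {..<\<gamma>}. c q \<noteq> 0}"
proof (rule ccontr)
  let ?S = "{q \<in> {..<\<gamma>}. c q \<noteq> 0}"
  assume "\<not> s \<le> card ?S"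
  then have "card ?S \<le> s + 1" by simp
  then obtain K where K: "?S \<subseteq> K" "K \<subseteq> {..<\<gamma>}" "card K = s + 1"
    using exists_subset_between[of ?S "s + 1" "{..<\<gamma>}"] assms(1) by auto
  have "q \<in> K" using K(1) assms(3,4) by auto
  then obtain w where w: "w \<in> gale r \<gamma> x" "\<forall>j\<in>K. w j = (if j = q then 1 else 0)"
    using gale_dual_basis[OF gen K(2)] K(3) assms(1) by auto
  have "(\<Sum>j<\<gamma>. c j * w j * w j) = (\<Sum>j<\<gamma>. if j = q then c q else 0)"
  proof (rule sum.cong)
    fix j assume "j \<in> {..<\<gamma>}"
    then show "c j * w j * w j = (if j = q then c q else 0)" 
      using w(2) K(1) \<open>q \<in> K\<close> by (cases "j \<in> K") auto
  qed simp
  then show False using assms(2-4) w(1) by (simp add: quadric_relations_def)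
qed

text \<open>The case N = 1 of \<open>betti_lower_bound\<close>: with a single relation, it remains
  to find s points at which it is nonzero.\<close>

lemma betti_positive:
  assumes "\<gamma> = r + s + 2" "s < r" "\<gamma> \<le> 2 * r + 1" "\<And>q. q < \<gamma> \<Longrightarrow> \<exists>l<Suc r. x q l \<noteq> 0"
    and "(s + 1) * (s + 2) div 2 < \<gamma>"
  shows "1 \<le> betti r (points_ideal r \<gamma> x) (r - s) (r - s + 2)"
proof -
  obtain c q where c: "c \<in> quadric_relations r \<gamma> x" "q < \<gamma>" "c q \<noteq> 0"
    using quadric_relation_vanishing[OF assms(1), of "{}"] assms(5) by auto
  obtain S where S: "S \<subseteq> {q \<in> {..<\<gamma>}. c q \<noteq> 0}" "card S = s"
    by (rule obtain_subset_with_card_n[OF quadric_relation_support[OF assms(1) c]])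
  show ?thesis
    by (rule betti_lower_bound[OF gen _ assms(3,1,2,4), where c = "\<lambda>b. c" and S = "\<lambda>b. S"])
      (use assms(1) c(1) S in auto)
qed

text \<open>The relations \<open>c\<close> form a space of dimension \<open>k + 1\<close> on which the points are \<open>k + s\<close> linear forms in
  general position; the products of \<open>s\<close> of these forms have the dual basis formed by the points at
  which the other \<open>k\<close> forms vanish.\<close>

lemma betti_binomial:
  assumes "\<gamma> = r + s + 2" "s < r" "\<gamma> \<le> 2 * r + 1" "\<And>q. q < \<gamma> \<Longrightarrow> \<exists>l<Suc r. x q l \<noteq> 0"
    and qg: "quadric_general ((s + 1) * (s + 2) div 2) r \<gamma> x"
    and k: "\<gamma> = (s + 1) * (s + 2) div 2 + k + 1" "k + s \<le> \<gamma>"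
  shows "(k + s) choose k \<le> betti r (points_ideal r \<gamma> x) (r - s) (r - s + 2)"
proof -
  define P where "P = {B. B \<subseteq> {..<k + s} \<and> card B = k}"
  have fP: "finite P" unfolding P_def by (rule finite_subset[of _ "Pow {..<k + s}"]) auto
  have cardP: "card P = (k + s) choose k" unfolding P_def using n_subsets[of "{..<k + s}" k] by simp
  obtain B where B: "bij_betw B {0..<(k + s) choose k} P"
    using ex_bij_betw_nat_finite[OF fP] cardP by auto
  let ?N = "(k + s) choose k"
  have BP: "B b \<subseteq> {..<k + s}" "card (B b) = k" "finite (B b)" if "b < ?N" for b
    using bij_betw_apply[OF B, of b] that by (auto simp: P_def intro: finite_subset)
  define c where "c = (\<lambda>b. SOME c. c \<in> quadric_relations r \<gamma> x \<and> (\<forall>q\<in>B b. c q = 0) \<and> (\<exists>q<\<gamma>. c q \<noteq> 0))"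
  have c: "c b \<in> quadric_relations r \<gamma> x" "\<forall>q\<in>B b. c b q = 0" "\<exists>q<\<gamma>. c b q \<noteq> 0" if b: "b < ?N" for b
  proof -
    have "\<exists>c. c \<in> quadric_relations r \<gamma> x \<and> (\<forall>q\<in>B b. c q = 0) \<and> (\<exists>q<\<gamma>. c q \<noteq> 0)"
      unfolding Bex_def[symmetric] using BP[OF b] k by (intro quadric_relation_vanishing[OF assms(1)]) auto
    from someI_ex[OF this] show "c b \<in> quadric_relations r \<gamma> x" "\<forall>q\<in>B b. c b q = 0" "\<exists>q<\<gamma>. c b q \<noteq> 0"
      unfolding c_def by blast+
  qed
  define S where "S = (\<lambda>b. {..<k + s} - B b)"
  show ?thesis
  proof (rule betti_lower_bound[OF gen _ assms(3,1,2,4), where c = c and S = S])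
    show "Suc r \<le> \<gamma>" using assms(1) by simp
    show "c b \<in> quadric_relations r \<gamma> x" if "b < ?N" for b by (rule c(1)[OF that])
    show "S b \<subseteq> {..<\<gamma>} \<and> card (S b) = s" if "b < ?N" for b
      using BP[OF that] k(2) by (auto simp: S_def card_Diff_subset)
    show "c b q \<noteq> 0" if b: "b < ?N" and q: "q \<in> S b" for b q
    proof
      assume 0: "c b q = 0"
      \<comment> \<open>One more zero would leave a relation supported on only as many points as
        there are quadrics, which \<open>quadric_general\<close> excludes.\<close>
      define J where "J = {..<\<gamma>} - insert q (B b)"
      have "q \<notin> B b" "q < \<gamma>" using q k(2) by (auto simp: S_def)
      moreover have "insert q (B b) \<subseteq> {..<\<gamma>}" using BP[OF b] k(2) \<open>q < \<gamma>\<close> by auto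
      ultimately have "card J = (s + 1) * (s + 2) div 2"
        unfolding J_def using BP[OF b] k(1) by (simp add: card_Diff_subset)
      moreover have "J \<subseteq> {..<\<gamma>}" by (auto simp: J_def)
      moreover have "\<forall>q'<\<gamma>. q' \<notin> J \<longrightarrow> c b q' = 0" using 0 c(2)[OF b] by (auto simp: J_def)
      ultimately have "\<forall>q<\<gamma>. c b q = 0" using qg c(1)[OF b] unfolding quadric_general_def by blast
      then show False using c(3)[OF b] by blast
    qed
    \<comment> \<open>Distinct k-subsets do not contain one another, so some prescribed zero of
      \<open>c a\<close> lies outside \<open>B b\<close>.\<close>
    show "\<exists>q\<in>S b. c a q = 0" if "a < ?N" "b < ?N" "a \<noteq> b" for a b
    proof -
      have "B a \<noteq> B b" using B that unfolding bij_betw_def inj_on_def by auto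
      then have "\<not> B a \<subseteq> B b" using BP[OF that(1)] BP[OF that(2)] card_subset_eq by metis
      then obtain q where "q \<in> B a" "q \<notin> B b" by blast
      then show ?thesis using BP(1)[OF that(1)] c(2)[OF that(1)] by (intro bexI[of _ q]) (auto simp: S_def)
    qed
  qed
qed

end

section \<open>Open conditions\<close>

text \<open>Integer degrees, because \<open>multi_homog_det\<close> splits the degrees into row and
  column parts and the column parts of \<open>quadric_matrix\<close> are negative. The zero
  polynomial has every degree.\<close>

definition multi_homog :: "nat \<Rightarrow> nat \<Rightarrow> (nat \<Rightarrow> int) \<Rightarrow> (nat \<times> nat, 'k::field) mpoly \<Rightarrow> bool" where
  "multi_homog r \<gamma> e f \<longleftrightarrow> (\<forall>m\<in>Poly_Mapping.keys f. Poly_Mapping.keys m \<subseteq> {..<\<gamma>} \<times> {..r} \<and>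
     (\<forall>s<\<gamma>. int (\<Sum>l\<le>r. Poly_Mapping.lookup m (s, l)) = e s))"

lemma multi_homog_multihomogeneous: "multi_homog r \<gamma> e f \<Longrightarrow> f \<in> multihomogeneous r \<gamma>"
  unfolding multi_homog_def multihomogeneous_def
proof (intro CollectI exI[of _ "\<lambda>s. nat (e s)"] ballI conjI allI impI)
  fix m s assume *: "\<forall>m\<in>Poly_Mapping.keys f. Poly_Mapping.keys m \<subseteq> {..<\<gamma>} \<times> {..r} \<and>
     (\<forall>s<\<gamma>. int (\<Sum>l\<le>r. Poly_Mapping.lookup m (s, l)) = e s)" "m \<in> Poly_Mapping.keys f"
  then show "Poly_Mapping.keys m \<subseteq> {..<\<gamma>} \<times> {..r}" by blast
  assume "s < \<gamma>"
  then have "e s = int (\<Sum>l\<le>r. Poly_Mapping.lookup m (s, l))" using * by simp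
  then show "(\<Sum>l\<le>r. Poly_Mapping.lookup m (s, l)) = nat (e s)" by (simp only: nat_int)
qed

lemma multi_homog_cong: "multi_homog r \<gamma> e f \<Longrightarrow> (\<And>s. e s = e' s) \<Longrightarrow> multi_homog r \<gamma> e' f"
  by (simp add: multi_homog_def)

lemma multi_homog_0 [simp]: "multi_homog r \<gamma> e 0"
  by (simp add: multi_homog_def)

lemma multi_homog_1: "multi_homog r \<gamma> (\<lambda>s. 0) 1"
  by (simp add: multi_homog_def)

lemma multi_homog_uminus: "multi_homog r \<gamma> e f \<Longrightarrow> multi_homog r \<gamma> e (- f)"
  by (simp add: multi_homog_def)

lemma multi_homog_add: "multi_homog r \<gamma> e f \<Longrightarrow> multi_homog r \<gamma> e g \<Longrightarrow> multi_homog r \<gamma> e (f + g)"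
  using keys_add[of f g] unfolding multi_homog_def by blast

lemma multi_homog_sum: "(\<And>i. i \<in> I \<Longrightarrow> multi_homog r \<gamma> e (f i)) \<Longrightarrow> multi_homog r \<gamma> e (\<Sum>i\<in>I. f i)"
  by (induction I rule: infinite_finite_induct) (auto intro: multi_homog_add)

lemma multi_homog_mult:
  assumes "multi_homog r \<gamma> e f" "multi_homog r \<gamma> e' g"
  shows "multi_homog r \<gamma> (\<lambda>s. e s + e' s) (f * g)"
  unfolding multi_homog_def
proof
  fix m assume "m \<in> Poly_Mapping.keys (f * g)"
  then obtain a b where ab: "m = a + b" "a \<in> Poly_Mapping.keys f" "b \<in> Poly_Mapping.keys g"
    using keys_mult[of f g] by blast
  have "Poly_Mapping.keys m \<subseteq> {..<\<gamma>} \<times> {..r}"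
    using keys_add[of a b] assms ab unfolding multi_homog_def by blast
  moreover have "int (\<Sum>l\<le>r. Poly_Mapping.lookup m (s, l)) = e s + e' s" if "s < \<gamma>" for s
    using assms ab that by (simp add: multi_homog_def lookup_add sum.distrib)
  ultimately show "Poly_Mapping.keys m \<subseteq> {..<\<gamma>} \<times> {..r} \<and> (\<forall>s<\<gamma>. int (\<Sum>l\<le>r. Poly_Mapping.lookup m (s, l)) = e s + e' s)"
    by blast
qed

lemma multi_homog_prod:
  assumes "\<And>i. i \<in> I \<Longrightarrow> multi_homog r \<gamma> (e i) (f i)"
  shows "multi_homog r \<gamma> (\<lambda>s. \<Sum>i\<in>I. e i s) (\<Prod>i\<in>I. f i)"
  using assms by (induction I rule: infinite_finite_induct) (auto intro: multi_homog_1 multi_homog_mult)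

lemma multi_homog_prod_ex:
  assumes "\<And>i. i \<in> I \<Longrightarrow> \<exists>e. multi_homog r \<gamma> e (f i)"
  shows "\<exists>e. multi_homog r \<gamma> e (\<Prod>i\<in>I. f i)"
  using assms
proof (induction I rule: infinite_finite_induct)
  case (insert i I)
  obtain e where "multi_homog r \<gamma> e (f i)" using insert.prems[of i] by auto
  moreover obtain e' where "multi_homog r \<gamma> e' (\<Prod>i\<in>I. f i)" using insert.IH insert.prems by auto
  ultimately have e: "multi_homog r \<gamma> e (f i)" "multi_homog r \<gamma> e' (\<Prod>i\<in>I. f i)" .
  show ?case unfolding prod.insert[OF insert.hyps] by (rule exI, rule multi_homog_mult[OF e])
qed (use multi_homog_1 in auto)

lemma ball_bij_betw: "bij_betw f A B \<Longrightarrow> (\<forall>a\<in>A. P (f a)) \<longleftrightarrow> (\<forall>b\<in>B. P b)"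
  by (auto simp: bij_betw_def)

lemma multi_homog_xv: 
  assumes "q < \<gamma>" "l \<le> r" 
  shows "multi_homog r \<gamma> (\<lambda>s. if s = q then 1 else 0) (xv (q, l))"
proof -
  have "(\<Sum>l'\<le>r. Poly_Mapping.lookup (Poly_Mapping.single (q, l) (Suc 0)) (s, l')) = (if s = q then 1 else 0)" for s
  proof -
    have "(\<Sum>l'\<le>r. Poly_Mapping.lookup (Poly_Mapping.single (q, l) (Suc 0)) (s, l')) = (\<Sum>l'\<le>r. if l' = l then (if s = q then 1 else 0) else 0)"
      by (intro sum.cong) (auto simp: lookup_single when_def)
    then show ?thesis using assms(2) by simp
  qed
  then show ?thesis using assms by (simp add: multi_homog_def)
qed

text \<open>A permutation uses every row and every column once, so all products in the Leibniz
  formula have the same degree.\<close>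

lemma multi_homog_det:
  assumes "\<And>i j. i < n \<Longrightarrow> j < n \<Longrightarrow> multi_homog r \<gamma> (\<lambda>s. a i s + b j s) (M i j)"
  shows "multi_homog r \<gamma> (\<lambda>s. (\<Sum>i<n. a i s) + (\<Sum>j<n. b j s)) (det (mat n n (\<lambda>(i, j). M i j)))"
proof -
  have "multi_homog r \<gamma> (\<lambda>s. (\<Sum>i<n. a i s) + (\<Sum>j<n. b j s)) (signof p * (\<Prod>i = 0..<n. M i (p i)))"
    if p: "p permutes {0..<n}" for p
  proof -
    have "multi_homog r \<gamma> (\<lambda>s. \<Sum>i=0..<n. a i s + b (p i) s) (\<Prod>i = 0..<n. M i (p i))"
      using permutes_in_image[OF p] by (intro multi_homog_prod assms) auto
    moreover have "(\<Sum>i=0..<n. a i s + b (p i) s) = (\<Sum>i<n. a i s) + (\<Sum>j<n. b j s)" for s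
      unfolding sum.distrib using sum.permute[OF p, of "\<lambda>j. b j s"] by (simp add: o_def atLeast0LessThan)
    ultimately have "multi_homog r \<gamma> (\<lambda>s. (\<Sum>i<n. a i s) + (\<Sum>j<n. b j s)) (\<Prod>i = 0..<n. M i (p i))" by simp
    then show ?thesis by (cases "signof p = (1 :: (nat \<times> nat, 'a) mpoly)") (auto simp: sign_def multi_homog_uminus)
  qed
  moreover have "det (mat n n (\<lambda>(i, j). M i j)) = (\<Sum>p\<in>{p. p permutes {0..<n}}. signof p * (\<Prod>i = 0..<n. M i (p i)))"
    unfolding det_def'[OF mat_carrier] 
  proof (intro sum.cong refl arg_cong2[where f = "(*)"] prod.cong)
    fix p i assume "p \<in> {p. p permutes {0..<n}}" "i \<in> {0..<n}"
    then have "p i < n" "i < n" using permutes_in_image[of p "{0..<n}" i] by auto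
    then show "mat n n (\<lambda>(i, j). M i j) $$ (i, p i) = M i (p i)" by simp
  qed
  ultimately show ?thesis by (simp only:) (rule multi_homog_sum, simp)
qed

lemma eval_det:
  assumes "field_embedding \<iota>"
  shows "mpoly_eval \<iota> y (det (mat n n (\<lambda>(i, j). M i j))) = det (mat n n (\<lambda>(i, j). mpoly_eval \<iota> y (M i j)))"
proof -
  interpret comm_ring_hom "mpoly_eval \<iota> y"
    by unfold_locales (simp_all add: eval_add[OF assms] eval_mult[OF assms] eval_1[OF assms] eval_0[OF assms])
  have "map_mat (mpoly_eval \<iota> y) (mat n n (\<lambda>(i, j). M i j)) = mat n n (\<lambda>(i, j). mpoly_eval \<iota> y (M i j))"
    by (rule eq_matI) auto
  then show ?thesis using hom_det[of "mat n n (\<lambda>(i, j). M i j)"] by simp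
qed

lemma det_nonzero_iff:
  fixes M :: "nat \<Rightarrow> nat \<Rightarrow> 'a::field"
  shows "det (mat n n (\<lambda>(i, j). M i j)) \<noteq> 0 \<longleftrightarrow> 
    (\<forall>v. (\<forall>i<n. (\<Sum>j<n. M i j * v j) = 0) \<longrightarrow> (\<forall>j<n. v j = 0))"
proof -
  let ?M = "mat n n (\<lambda>(i, j). M i j)"
  have mv: "?M *\<^sub>v vec n v = 0\<^sub>v n \<longleftrightarrow> (\<forall>i<n. (\<Sum>j<n. M i j * v j) = 0)" for v
    by (auto simp: vec_eq_iff scalar_prod_def atLeast0LessThan)
  have v0: "vec n v = 0\<^sub>v n \<longleftrightarrow> (\<forall>j<n. v j = 0)" for v :: "nat \<Rightarrow> 'a"
    by (auto simp: vec_eq_iff)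
  have "det ?M = 0 \<longleftrightarrow> (\<exists>u. u \<in> carrier_vec n \<and> u \<noteq> 0\<^sub>v n \<and> ?M *\<^sub>v u = 0\<^sub>v n)"
    by (rule det_0_iff_vec_prod_zero_field) simp
  also have "\<dots> \<longleftrightarrow> (\<exists>v. vec n v \<noteq> 0\<^sub>v n \<and> ?M *\<^sub>v vec n v = 0\<^sub>v n)"
  proof
    assume "\<exists>u. u \<in> carrier_vec n \<and> u \<noteq> 0\<^sub>v n \<and> ?M *\<^sub>v u = 0\<^sub>v n"
    then obtain u where u: "u \<in> carrier_vec n" "u \<noteq> 0\<^sub>v n" "?M *\<^sub>v u = 0\<^sub>v n" by blast
    have "u = vec n (\<lambda>i. u $ i)" using u(1) by (intro eq_vecI) auto
    then show "\<exists>v. vec n v \<noteq> 0\<^sub>v n \<and> ?M *\<^sub>v vec n v = 0\<^sub>v n" using u by metis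
  next
    assume "\<exists>v. vec n v \<noteq> 0\<^sub>v n \<and> ?M *\<^sub>v vec n v = 0\<^sub>v n"
    then obtain v where "vec n v \<noteq> 0\<^sub>v n \<and> ?M *\<^sub>v vec n v = 0\<^sub>v n" by blast
    then show "\<exists>u. u \<in> carrier_vec n \<and> u \<noteq> 0\<^sub>v n \<and> ?M *\<^sub>v u = 0\<^sub>v n"
      by (intro exI[of _ "vec n v"]) simp
  qed
  finally show ?thesis unfolding mv v0 by blast
qed

text \<open>The product of all maximal minors of the coordinate matrix: a single polynomial cuts out
  the open set.\<close>

definition lin_general_poly :: "nat \<Rightarrow> nat \<Rightarrow> (nat \<times> nat, 'k::field) mpoly" where
  "lin_general_poly r \<gamma> = (\<Prod>J\<in>{J. J \<subseteq> {..<\<gamma>} \<and> card J = Suc r}. 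
     det (mat (Suc r) (Suc r) (\<lambda>(a, l). xv (sorted_list_of_set J ! a, l))))"

lemma sorted_list_nth:
  fixes \<gamma> :: nat
  assumes "J \<subseteq> {..<\<gamma>}" "card J = n"
  shows "bij_betw ((!) (sorted_list_of_set J)) {..<n} J"
proof -
  have "finite J" by (rule finite_subset[OF assms(1)]) simp
  then show ?thesis using bij_betw_nth[of "sorted_list_of_set J" "{..<n}" J] assms(2) by (simp add: lessThan_atLeast0)
qed

lemma lin_general_poly_multi_homog: "\<exists>e. multi_homog r \<gamma> e (lin_general_poly r \<gamma>)"
proof -
  have "\<exists>e. multi_homog r \<gamma> e (det (mat (Suc r) (Suc r) (\<lambda>(a, l). xv (sorted_list_of_set J ! a, l))) :: (nat \<times> nat, 'a) mpoly)"
    if J: "J \<subseteq> {..<\<gamma>}" "card J = Suc r" for J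
  proof -
    have "multi_homog r \<gamma> (\<lambda>s. (if s = sorted_list_of_set J ! a then 1 else 0) + 0) (xv (sorted_list_of_set J ! a, l) :: (nat \<times> nat, 'a) mpoly)"
      if "a < Suc r" "l < Suc r" for a l
      using multi_homog_xv[of "sorted_list_of_set J ! a" \<gamma> l r] bij_betw_apply[OF sorted_list_nth[OF J], of a] J(1) that by auto
    note det = multi_homog_det[OF this]
    show ?thesis by (rule exI, rule det)
  qed
  then show ?thesis unfolding lin_general_poly_def by (intro multi_homog_prod_ex) simp
qed

lemma lin_general_poly_eval:
  fixes x :: "nat \<Rightarrow> nat \<Rightarrow> 'l::field"
  assumes "field_embedding \<iota>"
  shows "mpoly_eval \<iota> (\<lambda>(s, l). x s l) (lin_general_poly r \<gamma>) \<noteq> 0 \<longleftrightarrow> lin_general r \<gamma> x"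
proof -
  have fin: "finite {J. J \<subseteq> {..<\<gamma>} \<and> card J = Suc r}" by (rule finite_subset[of _ "Pow {..<\<gamma>}"]) auto
  have "det (mat (Suc r) (Suc r) (\<lambda>(a, l). x (sorted_list_of_set J ! a) l)) \<noteq> 0 \<longleftrightarrow> 
    (\<forall>g. (\<forall>s\<in>J. (\<Sum>l<Suc r. x s l * g l) = 0) \<longrightarrow> (\<forall>l<Suc r. g l = 0))" if J: "J \<subseteq> {..<\<gamma>}" "card J = Suc r" for J
  proof -
    have "(\<forall>i<Suc r. (\<Sum>l<Suc r. x (sorted_list_of_set J ! i) l * g l) = 0) \<longleftrightarrow> (\<forall>s\<in>J. (\<Sum>l<Suc r. x s l * g l) = 0)" for g
      using ball_bij_betw[OF sorted_list_nth[OF J], of "\<lambda>s. (\<Sum>l<Suc r. x s l * g l) = 0"] by (simp only: Ball_def lessThan_iff)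
    then show ?thesis unfolding det_nonzero_iff by simp
  qed
  then show ?thesis
    unfolding lin_general_poly_def eval_prod[OF assms] eval_det[OF assms] lin_general_def
    using fin by (auto simp: prod_zero_iff eval_xv[OF assms])
qed

text \<open>The linear relation between the points \<open>0, ..., r, j\<close> given by Cramer's rule.\<close>

definition cramer :: "nat \<Rightarrow> (nat \<Rightarrow> nat \<Rightarrow> 'a::comm_ring_1) \<Rightarrow> nat \<Rightarrow> nat \<Rightarrow> 'a" where
  "cramer r x j p = (if p \<le> r then - det (mat (Suc r) (Suc r) (\<lambda>(l, q). x (if q = p then j else q) l))
     else if p = j then det (mat (Suc r) (Suc r) (\<lambda>(l, q). x q l)) else 0)"

text \<open>If u expresses the point j in the basis of the first r + 1 points, Cramer's rule
  identifies the determinants in \<open>cramer\<close> as \<open>u p\<close> times a common nonzero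
  determinant.\<close>

lemma cramer_gale:
  fixes x :: "nat \<Rightarrow> nat \<Rightarrow> 'l::field"
  assumes "lin_general r \<gamma> x" "r < j" "j < \<gamma>"
  shows "cramer r x j \<in> gale r \<gamma> x" "cramer r x j j \<noteq> 0"
proof -
  define M where "M = mat (Suc r) (Suc r) (\<lambda>(l, q). x q l)"
  have J: "{..<Suc r} \<subseteq> {..<\<gamma>}" "card {..<Suc r} = Suc r" using assms by auto
  have "\<exists>u. \<forall>l<Suc r. (\<Sum>q\<in>{..<Suc r}. x q l * u q) = x j l"
    by (rule relation_exists[OF assms(1) J])
  then obtain u where u: "\<And>l. l < Suc r \<Longrightarrow> (\<Sum>q<Suc r. x q l * u q) = x j l" by blast
  have Mu: "M *\<^sub>v vec (Suc r) u = vec (Suc r) (x j)"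
    by (rule eq_vecI) (use u in \<open>auto simp: M_def scalar_prod_def atLeast0LessThan\<close>)
  have cr: "det (mat (Suc r) (Suc r) (\<lambda>(l, q). x (if q = p then j else q) l)) = u p * det M" if "p < Suc r" for p
  proof -
    have "replace_col M (M *\<^sub>v vec (Suc r) u) p = mat (Suc r) (Suc r) (\<lambda>(l, q). x (if q = p then j else q) l)"
      unfolding Mu by (rule eq_matI) (auto simp: replace_col_def M_def)
    moreover have "det (replace_col M (M *\<^sub>v vec (Suc r) u) p) = vec (Suc r) u $ p * det M"
      by (rule cramer_lemma_mat) (use that in \<open>auto simp: M_def\<close>)
    ultimately show ?thesis using that by simp
  qed
  have "det M \<noteq> 0"
    unfolding M_def det_nonzero_iff using relation_unique[OF assms(1) J] by (auto simp del: sum.lessThan_Suc)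
  then show "cramer r x j j \<noteq> 0" using assms by (simp add: cramer_def M_def)
  show "cramer r x j \<in> gale r \<gamma> x"
    unfolding gale_def
  proof (intro CollectI allI impI)
    fix l assume l: "l < Suc r"
    have "(\<Sum>q<\<gamma>. x q l * cramer r x j q) = (\<Sum>q\<in>insert j {..<Suc r}. x q l * cramer r x j q)"
      using assms by (intro sum.mono_neutral_right) (auto simp: cramer_def)
    also have "\<dots> = x j l * det M + (\<Sum>q<Suc r. x q l * cramer r x j q)"
      using assms by (subst sum.insert) (auto simp: cramer_def M_def)
    also have "(\<Sum>q<Suc r. x q l * cramer r x j q) = (\<Sum>q<Suc r. - (x q l * u q) * det M)"
      using cr by (intro sum.cong) (auto simp: cramer_def)
    also have "\<dots> = - x j l * det M"
      unfolding sum_distrib_right[symmetric] sum_negf using u[OF l] by simp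
    finally show "(\<Sum>q<\<gamma>. x q l * cramer r x j q) = 0" by simp
  qed
qed

abbreviation generic_points :: "nat \<Rightarrow> nat \<Rightarrow> (nat \<times> nat, 'k::field) mpoly" where
  "generic_points \<equiv> \<lambda>s l. xv (s, l)"

text \<open>Each of the points 0, ..., r, j has degree 1 in the coefficient, except the point p to
  which it belongs. If p is none of them the coefficient is 0, and the degree -1 is allowed.\<close>

lemma cramer_multi_homog:
  assumes "r < j" "j < \<gamma>"
  shows "multi_homog r \<gamma> (\<lambda>s. (if s \<le> r then 1 else 0) + (if s = j then 1 else 0) - (if s = p then 1 else 0)) (cramer r generic_points j p)"
proof -
  have *: "multi_homog r \<gamma> (\<lambda>s. (if s \<le> r then 1 else 0) + (if s = j then 1 else 0) - (if s = p then 1 else 0))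
    (det (mat (Suc r) (Suc r) (\<lambda>(l, q). generic_points (if q = p then j else q) l)) :: (nat \<times> nat, 'a) mpoly)"
    if "p \<le> r \<or> p = j"
  proof -
    have "multi_homog r \<gamma> (\<lambda>s. 0 + (if s = (if q = p then j else q) then 1 else 0)) (generic_points (if q = p then j else q) l :: (nat \<times> nat, 'a) mpoly)"
      if "l < Suc r" "q < Suc r" for l q
      using multi_homog_xv[of j \<gamma> l r] multi_homog_xv[of q \<gamma> l r] assms that by (cases "q = p") simp_all
    from multi_homog_det[of "Suc r" r \<gamma> "\<lambda>l s. 0" "\<lambda>q s. if s = (if q = p then j else q) then 1 else 0"
        "\<lambda>l q. generic_points (if q = p then j else q) l :: (nat \<times> nat, 'a) mpoly", OF this]
    have "multi_homog r \<gamma> (\<lambda>s. \<Sum>q<Suc r. if s = (if q = p then j else q) then 1 else 0)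
      (det (mat (Suc r) (Suc r) (\<lambda>(l, q). generic_points (if q = p then j else q) l)) :: (nat \<times> nat, 'a) mpoly)"
      by simp
    moreover have "(\<Sum>q<Suc r. if s = (if q = p then j else q) then 1 else 0) = 
      ((if s \<le> r then 1 else 0) + (if s = j then 1 else 0) - (if s = p then 1 else 0) :: int)" for s
    proof -
      have "(\<Sum>q<Suc r. if s = (if q = p then j else q) then 1 else (0::int)) = 
        (\<Sum>q<Suc r. (if q = s then 1 else 0) + (if q = p then (if s = j then 1 else 0) - (if s = p then 1 else 0) else 0))"
        by (intro sum.cong) auto
      also have "\<dots> = (if s < Suc r then 1 else 0) + (if p < Suc r then (if s = j then 1 else 0) - (if s = p then 1 else 0) else 0)"
        unfolding sum.distrib by simp
      finally show ?thesis using \<open>p \<le> r \<or> p = j\<close> assms by auto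
    qed
    ultimately show ?thesis by simp
  qed
  show ?thesis
  proof (cases "p \<le> r")
    case True
    then show ?thesis using * by (simp add: cramer_def multi_homog_uminus)
  next
    case False
    have "mat (Suc r) (Suc r) (\<lambda>(l, q). generic_points (if q = p then j else q) l :: (nat \<times> nat, 'a) mpoly) 
        = mat (Suc r) (Suc r) (\<lambda>(l, q). generic_points q l)"
      using False by (intro eq_matI) auto
    then show ?thesis using False * by (simp add: cramer_def)
  qed
qed

lemma cramer_eval:
  assumes "field_embedding \<iota>"
  shows "mpoly_eval \<iota> (\<lambda>(s, l). x s l) (cramer r generic_points j p) = cramer r x j p"
  by (simp add: cramer_def eval_uminus[OF assms] eval_det[OF assms] eval_xv[OF assms] eval_0[OF assms])

section \<open>The polynomial for independent conditions on quadrics\<close>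

definition pair_list :: "nat \<Rightarrow> nat \<Rightarrow> (nat \<times> nat) list" where
  "pair_list r s = (SOME L. distinct L \<and> set L = sym_pairs {Suc r..r + s + 1})"

lemma pair_list: "distinct (pair_list r s)" "set (pair_list r s) = sym_pairs {Suc r..r + s + 1}"
  "length (pair_list r s) = (s + 1) * (s + 2) div 2"
proof -
  have "\<exists>L. distinct L \<and> set L = sym_pairs {Suc r..r + s + 1}"
    using finite_distinct_list[OF finite_sym_pairs, of "{Suc r..r + s + 1}"] by auto
  from someI_ex[OF this] show *: "distinct (pair_list r s)" "set (pair_list r s) = sym_pairs {Suc r..r + s + 1}"
    by (auto simp: pair_list_def)
  have "2 * card (sym_pairs {Suc r..r + s + 1}) = (s + 1) * (s + 2)"
    by (subst card_sym_pairs) simp_all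
  then show "length (pair_list r s) = (s + 1) * (s + 2) div 2"
    using distinct_card[OF *(1)] *(2) by simp
qed

definition quadric_matrix :: "nat \<Rightarrow> nat \<Rightarrow> (nat \<Rightarrow> nat \<Rightarrow> 'a::comm_ring_1) \<Rightarrow> nat set \<Rightarrow> nat \<Rightarrow> nat \<Rightarrow> 'a" where
  "quadric_matrix r s x J a b = 
     cramer r x (fst (pair_list r s ! a)) (sorted_list_of_set J ! b) * cramer r x (snd (pair_list r s ! a)) (sorted_list_of_set J ! b)"

definition quadric_general_poly :: "nat \<Rightarrow> nat \<Rightarrow> (nat \<times> nat, 'k::field) mpoly" where
  "quadric_general_poly r s = (\<Prod>J\<in>{J. J \<subseteq> {..<r + s + 2} \<and> card J = (s + 1) * (s + 2) div 2}. 
     det (mat ((s + 1) * (s + 2) div 2) ((s + 1) * (s + 2) div 2) (\<lambda>(a, b). quadric_matrix r s generic_points J a b)))"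

lemma pair_list_nth:
  assumes "a < (s + 1) * (s + 2) div 2"
  shows "r < fst (pair_list r s ! a)" "fst (pair_list r s ! a) < r + s + 2" 
    "r < snd (pair_list r s ! a)" "snd (pair_list r s ! a) < r + s + 2"
proof -
  have "pair_list r s ! a \<in> sym_pairs {Suc r..r + s + 1}" using assms pair_list[of r s] nth_mem by metis
  then show "r < fst (pair_list r s ! a)" "fst (pair_list r s ! a) < r + s + 2" 
    "r < snd (pair_list r s ! a)" "snd (pair_list r s ! a) < r + s + 2" by (auto simp: sym_pairs_def)
qed

lemma quadric_general_poly_multi_homog: "\<exists>e. multi_homog r (r + s + 2) e (quadric_general_poly r s)"
proof -
  let ?n = "(s + 1) * (s + 2) div 2" and ?\<gamma> = "r + s + 2"
  have "\<exists>e. multi_homog r ?\<gamma> e (det (mat ?n ?n (\<lambda>(a, b). quadric_matrix r s generic_points J a b)) :: (nat \<times> nat, 'a) mpoly)"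
    if J: "J \<subseteq> {..<?\<gamma>}" "card J = ?n" for J
  proof -
    \<comment> \<open>A row contributes the points of its two Cramer relations; a column loses its
      own point once in each of the two factors.\<close>
    have "multi_homog r ?\<gamma> (\<lambda>t. (2 * (if t \<le> r then 1 else 0) + (if t = fst (pair_list r s ! a) then 1 else 0) + (if t = snd (pair_list r s ! a) then 1 else 0))
        + - 2 * (if t = sorted_list_of_set J ! b then 1 else 0)) (quadric_matrix r s generic_points J a b :: (nat \<times> nat, 'a) mpoly)"
      if "a < ?n" "b < ?n" for a b
    proof -
      define j k q where "j = fst (pair_list r s ! a)" and "k = snd (pair_list r s ! a)" and "q = sorted_list_of_set J ! b"
      have "r < j" "j < ?\<gamma>" "r < k" "k < ?\<gamma>" using pair_list_nth[OF that(1)] by (auto simp: j_def k_def)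
      then have "multi_homog r ?\<gamma> (\<lambda>t. ((if t \<le> r then 1 else 0) + (if t = j then 1 else 0) - (if t = q then 1 else 0))
          + ((if t \<le> r then 1 else 0) + (if t = k then 1 else 0) - (if t = q then 1 else 0)))
          (cramer r generic_points j q * cramer r generic_points k q :: (nat \<times> nat, 'a) mpoly)"
        by (intro multi_homog_mult cramer_multi_homog)
      then show ?thesis unfolding quadric_matrix_def j_def[symmetric] k_def[symmetric] q_def[symmetric]
        by (rule multi_homog_cong) simp
    qed
    note det = multi_homog_det[OF this]
    show ?thesis by (rule exI, rule det)
  qed
  then show ?thesis unfolding quadric_general_poly_def by (intro multi_homog_prod_ex) simp
qed

lemma quadric_general_poly_eval:
  fixes x :: "nat \<Rightarrow> nat \<Rightarrow> 'l::field"
  assumes "field_embedding \<iota>"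
  shows "mpoly_eval \<iota> (\<lambda>(q, l). x q l) (quadric_general_poly r s) \<noteq> 0 \<longleftrightarrow> 
    (\<forall>J\<subseteq>{..<r + s + 2}. card J = (s + 1) * (s + 2) div 2 \<longrightarrow> 
      (\<forall>c. (\<forall>(j, k)\<in>sym_pairs {Suc r..r + s + 1}. (\<Sum>q\<in>J. cramer r x j q * cramer r x k q * c q) = 0) \<longrightarrow> (\<forall>q\<in>J. c q = 0)))"
proof -
  let ?n = "(s + 1) * (s + 2) div 2" and ?\<gamma> = "r + s + 2"
  have fin: "finite {J. J \<subseteq> {..<?\<gamma>} \<and> card J = ?n}" by (rule finite_subset[of _ "Pow {..<?\<gamma>}"]) auto
  have "det (mat ?n ?n (\<lambda>(a, b). quadric_matrix r s x J a b)) \<noteq> 0 \<longleftrightarrow> 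
    (\<forall>c. (\<forall>(j, k)\<in>sym_pairs {Suc r..r + s + 1}. (\<Sum>q\<in>J. cramer r x j q * cramer r x k q * c q) = 0) \<longrightarrow> (\<forall>q\<in>J. c q = 0))"
    if J: "J \<subseteq> {..<?\<gamma>}" "card J = ?n" for J
  proof -
    let ?b = "(!) (sorted_list_of_set J)"
    note bij = sorted_list_nth[OF J]
    have pairs: "(\<forall>(j, k)\<in>sym_pairs {Suc r..r + s + 1}. P j k) \<longleftrightarrow> (\<forall>a<?n. P (fst (pair_list r s ! a)) (snd (pair_list r s ! a)))" for P
      unfolding pair_list(2)[symmetric] all_set_conv_all_nth pair_list(3) by (simp add: case_prod_beta)
    have sum: "(\<Sum>b<?n. quadric_matrix r s x J a b * c (?b b)) = 
      (\<Sum>q\<in>J. cramer r x (fst (pair_list r s ! a)) q * cramer r x (snd (pair_list r s ! a)) q * c q)" for a c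
      unfolding quadric_matrix_def by (rule sum.reindex_bij_betw[OF bij])
    have all: "(\<forall>b<?n. c (?b b) = 0) \<longleftrightarrow> (\<forall>q\<in>J. c q = 0)" for c :: "nat \<Rightarrow> 'l"
      using ball_bij_betw[OF bij, of "\<lambda>q. c q = 0"] by (simp only: Ball_def lessThan_iff)
    show ?thesis
      unfolding det_nonzero_iff pairs
    proof (intro iffI allI impI)
      fix c :: "nat \<Rightarrow> 'l"
      assume 1: "\<forall>v. (\<forall>i<?n. (\<Sum>b<?n. quadric_matrix r s x J i b * v b) = 0) \<longrightarrow> (\<forall>b<?n. v b = 0)"
        and 2: "\<forall>a<?n. (\<Sum>q\<in>J. cramer r x (fst (pair_list r s ! a)) q * cramer r x (snd (pair_list r s ! a)) q * c q) = 0"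
      show "\<forall>q\<in>J. c q = 0"
        using 1[rule_format, of "\<lambda>b. c (?b b)"] 2 unfolding sum all[symmetric] by blast
    next
      fix v :: "nat \<Rightarrow> 'l" and b
      assume 1: "\<forall>c. (\<forall>a<?n. (\<Sum>q\<in>J. cramer r x (fst (pair_list r s ! a)) q * cramer r x (snd (pair_list r s ! a)) q * c q) = 0) \<longrightarrow> (\<forall>q\<in>J. c q = 0)"
        and 2: "\<forall>i<?n. (\<Sum>b<?n. quadric_matrix r s x J i b * v b) = 0" and b: "b < ?n"
      define c where "c = (\<lambda>q. v (the_inv_into {..<?n} ?b q))"
      have cb: "c (?b b) = v b" if "b < ?n" for b
        using bij that unfolding c_def bij_betw_def by (simp add: the_inv_into_f_f)
      have "(\<Sum>b<?n. quadric_matrix r s x J a b * v b) = (\<Sum>b<?n. quadric_matrix r s x J a b * c (?b b))" for a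
        using cb by (intro sum.cong) auto
      then have "\<forall>q\<in>J. c q = 0" using 1 2 unfolding sum by simp
      then show "v b = 0" using cb[OF b] all[of c] b by metis
    qed
  qed
  then show ?thesis
    unfolding quadric_general_poly_def eval_prod[OF assms] eval_det[OF assms]
    using fin by (auto simp: prod_zero_iff quadric_matrix_def eval_mult[OF assms] cramer_eval[OF assms])
qed

text \<open>Cramer relations belong to the Gale transform, so a quadric relation supported on J
  solves the homogeneous system of J.\<close>

lemma quadric_generalI:
  fixes x :: "nat \<Rightarrow> nat \<Rightarrow> 'l::field"
  assumes "field_embedding \<iota>" "lin_general r (r + s + 2) x"
    "mpoly_eval \<iota> (\<lambda>(q, l). x q l) (quadric_general_poly r s) \<noteq> 0"
  shows "quadric_general ((s + 1) * (s + 2) div 2) r (r + s + 2) x"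
  unfolding quadric_general_def
proof (intro allI impI ballI)
  fix J c q assume J: "J \<subseteq> {..<r + s + 2}" "card J = (s + 1) * (s + 2) div 2"
    and c: "c \<in> quadric_relations r (r + s + 2) x" "\<forall>q<r + s + 2. q \<notin> J \<longrightarrow> c q = 0" and q: "q < r + s + 2"
  have "(\<Sum>q\<in>J. cramer r x j q * cramer r x k q * c q) = 0" if "(j, k) \<in> sym_pairs {Suc r..r + s + 1}" for j k
  proof -
    have "(\<Sum>q\<in>J. cramer r x j q * cramer r x k q * c q) = (\<Sum>q<r + s + 2. c q * cramer r x j q * cramer r x k q)"
      using J(1) c(2) by (intro sum.mono_neutral_cong_left) auto
    also have "\<dots> = 0"
      using c(1) cramer_gale(1)[OF assms(2), of j] cramer_gale(1)[OF assms(2), of k] that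
      unfolding quadric_relations_def sym_pairs_def by auto
    finally show ?thesis .
  qed
  then have "\<forall>q\<in>J. c q = 0"
    using assms(3)[unfolded quadric_general_poly_eval[OF assms(1)]] J by blast
  then show "c q = 0" using c(2) q by blast
qed

section \<open>Existence of general points\<close>

text \<open>Sets of at most n elements, not exactly n, so that the property has content for small I
  and vectors can be added one by one.\<close>

definition vec_general :: "nat \<Rightarrow> nat set \<Rightarrow> (nat \<Rightarrow> nat \<Rightarrow> 'a::field) \<Rightarrow> bool" where
  "vec_general n I v \<longleftrightarrow> (\<forall>J\<subseteq>I. card J \<le> n \<longrightarrow> 
     (\<forall>c. (\<forall>j<n. (\<Sum>p\<in>J. v p j * c p) = 0) \<longrightarrow> (\<forall>p\<in>J. c p = 0)))"

text \<open>Every set of fewer than n old vectors lies in a hyperplane; a new vector outside these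
  finitely many hyperplanes keeps the property.\<close>

lemma vec_general_extend:
  assumes "finite I" "vec_general n I v" "p \<notin> I"
  shows "\<exists>\<Phi>. finite \<Phi> \<and> (\<forall>\<phi>\<in>\<Phi>. \<exists>j<n. \<phi> j \<noteq> 0) \<and>
    (\<forall>u. (\<forall>\<phi>\<in>\<Phi>. (\<Sum>j<n. \<phi> j * u j) \<noteq> 0) \<longrightarrow> vec_general n (insert p I) (v(p := u)))"
proof -
  define Js where "Js = {J. J \<subseteq> I \<and> card J < n}"
  have finJs: "finite Js" unfolding Js_def by (rule finite_subset[of _ "Pow I"]) (use assms(1) in auto)
  have "\<exists>\<phi>. (\<exists>j\<in>{..<n}. \<phi> j \<noteq> 0) \<and> (\<forall>q\<in>J. (\<Sum>j\<in>{..<n}. v q j * \<phi> j) = 0)" if "J \<in> Js" for J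
    by (rule nonzero_solution) (use that assms(1) finite_subset in \<open>auto simp: Js_def\<close>)
  then have "\<forall>J\<in>Js. \<exists>\<phi>. (\<exists>j\<in>{..<n}. \<phi> j \<noteq> 0) \<and> (\<forall>q\<in>J. (\<Sum>j\<in>{..<n}. v q j * \<phi> j) = 0)" by blast
  from bchoice[OF this] obtain \<phi> where \<phi>: "\<forall>J\<in>Js. (\<exists>j\<in>{..<n}. \<phi> J j \<noteq> 0) \<and> (\<forall>q\<in>J. (\<Sum>j\<in>{..<n}. v q j * \<phi> J j) = 0)" ..
  have "vec_general n (insert p I) (v(p := u))" if u: "\<forall>\<psi>\<in>\<phi> ` Js. (\<Sum>j<n. \<psi> j * u j) \<noteq> 0" for u
    unfolding vec_general_def
  proof (intro allI impI)
    fix J c assume J: "J \<subseteq> insert p I" "card J \<le> n" and c: "\<forall>j<n. (\<Sum>q\<in>J. (v(p := u)) q j * c q) = 0"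
    have fJ: "finite J" using J(1) assms(1) finite_subset by blast
    define J' where "J' = J - {p}"
    have J': "J' \<subseteq> I" "finite J'" "p \<notin> J'" using J(1) fJ by (auto simp: J'_def)
    have sum': "(\<Sum>q\<in>J'. (v(p := u)) q j * c q) = (\<Sum>q\<in>J'. v q j * c q)" for j
      using J'(3) by (intro sum.cong) auto
    have cp: "c p = 0" if pJ: "p \<in> J"
    proof -
      have "card J' < n" using J(2) fJ pJ unfolding J'_def by (metis card_Diff1_less less_le_trans)
      then have J'J: "J' \<in> Js" using J'(1) by (simp add: Js_def)
      have "(\<Sum>q\<in>J'. v q j * c q) + u j * c p = 0" if "j < n" for j
        using c that sum.remove[OF fJ pJ, of "\<lambda>q. (v(p := u)) q j * c q"] sum'[of j] by (simp add: J'_def add.commute)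
      then have "0 = (\<Sum>j<n. \<phi> J' j * ((\<Sum>q\<in>J'. v q j * c q) + u j * c p))" by simp
      also have "\<dots> = (\<Sum>j<n. \<Sum>q\<in>J'. c q * (v q j * \<phi> J' j)) + (\<Sum>j<n. \<phi> J' j * u j) * c p"
        by (simp add: algebra_simps sum.distrib sum_distrib_left sum_distrib_right)
      also have "(\<Sum>j<n. \<Sum>q\<in>J'. c q * (v q j * \<phi> J' j)) = (\<Sum>q\<in>J'. c q * (\<Sum>j<n. v q j * \<phi> J' j))"
        unfolding sum_distrib_left by (rule sum.swap)
      also have "\<dots> = 0" using \<phi> J'J by (intro sum.neutral) auto
      finally show ?thesis using u J'J by simp
    qed
    have "(\<Sum>q\<in>J'. v q j * c q) = 0" if "j < n" for j
    proof (cases "p \<in> J")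
      case True
      then show ?thesis 
        using c that sum.remove[OF fJ True, of "\<lambda>q. (v(p := u)) q j * c q"] sum'[of j] cp by (simp add: J'_def)
    next
      case False
      then have "J' = J" by (simp add: J'_def)
      then show ?thesis using c that sum'[of j] by simp
    qed
    moreover have "card J' \<le> n" using J(2) fJ unfolding J'_def by (meson card_Diff1_le le_trans)
    ultimately have "\<forall>q\<in>J'. c q = 0" using assms(2) J'(1) unfolding vec_general_def by blast
    then show "\<forall>q\<in>J. c q = 0" using cp by (auto simp: J'_def)
  qed
  then show ?thesis using finJs \<phi> by (intro exI[of _ "\<phi> ` Js"]) auto
qed

lemma vec_general_mono: "vec_general n I v \<Longrightarrow> (\<And>p j. p \<in> I \<Longrightarrow> j < n \<Longrightarrow> v p j = v' p j) \<Longrightarrow> vec_general n I v'"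
  unfolding vec_general_def
proof (intro allI impI)
  fix J c
  assume *: "\<forall>J\<subseteq>I. card J \<le> n \<longrightarrow> (\<forall>c. (\<forall>j<n. (\<Sum>p\<in>J. v p j * c p) = 0) \<longrightarrow> (\<forall>p\<in>J. c p = 0))"
    "\<And>p j. p \<in> I \<Longrightarrow> j < n \<Longrightarrow> v p j = v' p j" "J \<subseteq> I" "card J \<le> n" "\<forall>j<n. (\<Sum>p\<in>J. v' p j * c p) = 0"
  have "(\<Sum>p\<in>J. v p j * c p) = 0" if "j < n" for j
  proof -
    have "(\<Sum>p\<in>J. v p j * c p) = (\<Sum>p\<in>J. v' p j * c p)" using *(2,3) that by (intro sum.cong) auto
    then show ?thesis using *(5) that by simp
  qed
  then show "\<forall>p\<in>J. c p = 0" using *(1,3,4) by blast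
qed

text \<open>Distinct exponents prevent cancellation, so a hyperplane meets the monomial curve in the
  roots of a nonzero polynomial.\<close>

lemma finite_curve_zeros:
  fixes \<Phi> :: "(nat \<Rightarrow> 'a::field) set"
  assumes "finite \<Phi>" "\<And>\<phi>. \<phi> \<in> \<Phi> \<Longrightarrow> \<exists>j<n. \<phi> j \<noteq> 0" "inj_on e {..<n}"
  shows "finite {t. \<exists>\<phi>\<in>\<Phi>. (\<Sum>j<n. \<phi> j * t ^ e j) = 0}"
proof -
  have "finite {t. (\<Sum>j<n. \<phi> j * t ^ e j) = 0}" if \<phi>: "\<phi> \<in> \<Phi>" for \<phi>
  proof -
    define p where "p = (\<Sum>j<n. monom (\<phi> j) (e j))"
    obtain j where j: "j < n" "\<phi> j \<noteq> 0" using assms(2)[OF \<phi>] by blast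
    have "poly.coeff p (e j) = (\<Sum>j'<n. if j' = j then \<phi> j else 0)"
      unfolding p_def coeff_sum by (intro sum.cong) (use assms(3) j in \<open>auto simp: inj_on_def\<close>)
    then have "p \<noteq> 0" using j by auto
    moreover have "poly p t = (\<Sum>j<n. \<phi> j * t ^ e j)" for t
      by (simp add: p_def poly_sum poly_monom)
    ultimately show ?thesis using poly_roots_finite[of p] by simp
  qed
  moreover have "{t. \<exists>\<phi>\<in>\<Phi>. (\<Sum>j<n. \<phi> j * t ^ e j) = 0} = (\<Union>\<phi>\<in>\<Phi>. {t. (\<Sum>j<n. \<phi> j * t ^ e j) = 0})" by auto
  ultimately show ?thesis using assms(1) by simp
qed

lemma lin_generalI:
  assumes "\<And>J w. J \<subseteq> {..<\<gamma>} \<Longrightarrow> card J = Suc r \<Longrightarrow> (\<And>l. l < Suc r \<Longrightarrow> (\<Sum>s\<in>J. x s l * w s) = 0) \<Longrightarrow> \<forall>s\<in>J. w s = 0"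
  shows "lin_general r \<gamma> x"
  unfolding lin_general_def
proof (intro allI impI)
  fix J g l assume J: "J \<subseteq> {..<\<gamma>}" "card J = Suc r" and g: "\<forall>s\<in>J. (\<Sum>l<Suc r. x s l * g l) = 0" and l: "l < Suc r"
  have "finite J" using J(1) finite_subset by blast
  have "\<forall>l\<in>{..<Suc r}. g l = 0"
  proof (rule transposed_injective[of "{..<Suc r}" J "\<lambda>l s. x s l"])
    show "\<forall>s\<in>J. w s = 0" if "\<And>l. l \<in> {..<Suc r} \<Longrightarrow> (\<Sum>s\<in>J. x s l * w s) = 0" for w
      using assms[OF J, of w] that by simp
  qed (use \<open>finite J\<close> J(2) g in auto)
  then show "g l = 0" using l by simp
qed

text \<open>Points of the moment curve are added one at a time, each outside finitely many
  hyperplanes through the earlier points.\<close>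

lemma lin_general_exists:
  assumes "infinite (UNIV :: 'a::field set)"
  shows "\<exists>y :: nat \<Rightarrow> nat \<Rightarrow> 'a. lin_general r \<gamma> y \<and> (\<forall>s. \<forall>l>r. y s l = 0)"
proof -
  have "\<exists>v :: nat \<Rightarrow> nat \<Rightarrow> 'a. vec_general (Suc r) {..<\<gamma>} v"
  proof (induction \<gamma>)
    case 0
    show ?case by (simp add: vec_general_def)
  next
    case (Suc \<gamma>)
    then obtain v :: "nat \<Rightarrow> nat \<Rightarrow> 'a" where v: "vec_general (Suc r) {..<\<gamma>} v" by blast
    obtain \<Phi> where \<Phi>: "finite \<Phi>" "\<And>\<phi>. \<phi> \<in> \<Phi> \<Longrightarrow> \<exists>j<Suc r. \<phi> j \<noteq> 0"
      "\<And>u. (\<forall>\<phi>\<in>\<Phi>. (\<Sum>j<Suc r. \<phi> j * u j) \<noteq> 0) \<Longrightarrow> vec_general (Suc r) (insert \<gamma> {..<\<gamma>}) (v(\<gamma> := u))"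
      using vec_general_extend[OF _ v, of \<gamma>] by auto
    have "finite {t. \<exists>\<phi>\<in>\<Phi>. (\<Sum>j<Suc r. \<phi> j * t ^ j) = 0}"
      by (rule finite_curve_zeros[OF \<Phi>(1,2), of "\<lambda>j. j"]) auto
    then obtain t where "t \<notin> {t. \<exists>\<phi>\<in>\<Phi>. (\<Sum>j<Suc r. \<phi> j * t ^ j) = 0}"
      using ex_new_if_finite[OF assms] by blast
    then have "vec_general (Suc r) (insert \<gamma> {..<\<gamma>}) (v(\<gamma> := (\<lambda>j. t ^ j)))" by (intro \<Phi>(3)) blast
    then show ?case unfolding lessThan_Suc by (intro exI[of _ "v(\<gamma> := (\<lambda>j. t ^ j))"])
  qed
  then obtain v :: "nat \<Rightarrow> nat \<Rightarrow> 'a" where v: "vec_general (Suc r) {..<\<gamma>} v" by blast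
  define y where "y = (\<lambda>s l. if l \<le> r then v s l else 0)"
  have "vec_general (Suc r) {..<\<gamma>} y" by (rule vec_general_mono[OF v]) (simp add: y_def)
  then have "lin_general r \<gamma> y"
    by (intro lin_generalI) (simp add: vec_general_def)
  then show ?thesis by (intro exI[of _ y]) (simp add: y_def)
qed

text \<open>The larger exponent is found first: a sum with larger exponent k is at most
  \<open>2 ^ Suc k\<close>, and any sum containing a bigger exponent exceeds this.\<close>

lemma power_two_sums_inj:
  assumes "(2::nat) ^ j + 2 ^ k = 2 ^ j' + 2 ^ k'" "j \<le> k" "j' \<le> k'"
  shows "j = j' \<and> k = k'"
proof -
  have less: "(2::nat) ^ a + 2 ^ b < 2 ^ a' + 2 ^ b'" if "a \<le> b" "b < b'" for a b a' b'
  proof -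
    have "(2::nat) ^ a + 2 ^ b \<le> 2 ^ b + 2 ^ b" using that(1) by simp
    also have "\<dots> = 2 ^ Suc b" by simp
    also have "\<dots> \<le> 2 ^ b'" using that(2) by (intro power_increasing) auto
    also have "\<dots> < 2 ^ a' + 2 ^ b'" by simp
    finally show ?thesis .
  qed
  have "k = k'" using less[of j k k' j'] less[of j' k' k j] assms by (metis less_irrefl linorder_neqE_nat)
  then show ?thesis using assms(1) by simp
qed

text \<open>Points with Gale transform in general position are obtained by adding to the coordinate points
  successive general points of the curve \<open>(t\<^sup>1, t\<^sup>2, t\<^sup>4, t\<^sup>8, ...)\<close>, which lies on no quadric because the
  sums of two powers of \<open>2\<close> are distinct.\<close>

lemma gale_points_exist:
  assumes "infinite (UNIV :: 'a::field set)" "set L = sym_pairs {..s}" "distinct L"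
  shows "\<exists>q :: nat \<Rightarrow> nat \<Rightarrow> 'a. (\<forall>j\<le>s. \<forall>k\<le>s. q (r + 1 + j) k = (if j = k then 1 else 0)) \<and>
    vec_general (Suc s) {..<r + s + 2} q \<and>
    vec_general (length L) {..<r + s + 2} (\<lambda>p i. q p (fst (L ! i)) * q p (snd (L ! i)))"
proof -
  let ?V = "\<lambda>q :: nat \<Rightarrow> nat \<Rightarrow> 'a. \<lambda>p i. q p (fst (L ! i)) * q p (snd (L ! i))"
  \<comment> \<open>The indices from r + 1 on are those of the coordinate points; the indices below
    m are those chosen so far.\<close>
  define I where "I = (\<lambda>m. {..<m} \<union> {Suc r..r + s + 1})"
  have "\<exists>q :: nat \<Rightarrow> nat \<Rightarrow> 'a. (\<forall>j\<le>s. \<forall>k\<le>s. q (r + 1 + j) k = (if j = k then 1 else 0)) \<and>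
    vec_general (Suc s) (I m) q \<and> vec_general (length L) (I m) (?V q)" if "m \<le> Suc r" for m
    using that
  proof (induction m)
    case 0
    define q where "q = (\<lambda>p k. if p = r + 1 + k then 1 else 0 :: 'a)"
    have "vec_general (Suc s) (I 0) q"
      unfolding vec_general_def
    proof (intro allI impI ballI)
      fix J c p assume J: "J \<subseteq> I 0" and c: "\<forall>j<Suc s. (\<Sum>p\<in>J. q p j * c p) = 0" and p: "p \<in> J"
      have "finite J" using J by (rule finite_subset) (simp add: I_def)
      have "p \<in> {Suc r..r + s + 1}" using J p by (auto simp: I_def)
      then obtain j where j: "j < Suc s" "p = r + 1 + j"
        by (intro that[of "p - r - 1"]) auto
      have "(\<Sum>p'\<in>J. q p' j * c p') = (\<Sum>p'\<in>J. if p' = p then c p else 0)"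
        by (intro sum.cong) (auto simp: q_def j(2))
      then show "c p = 0" using c j(1) p \<open>finite J\<close> by simp
    qed
    moreover have "vec_general (length L) (I 0) (?V q)"
      unfolding vec_general_def
    proof (intro allI impI ballI)
      fix J c p assume J: "J \<subseteq> I 0" and c: "\<forall>i<length L. (\<Sum>p\<in>J. ?V q p i * c p) = 0" and p: "p \<in> J"
      have "finite J" using J by (rule finite_subset) (simp add: I_def)
      have "p \<in> {Suc r..r + s + 1}" using J p by (auto simp: I_def)
      then obtain j where j: "j \<le> s" "p = r + 1 + j"
        by (intro that[of "p - r - 1"]) auto
      \<comment> \<open>The square of coordinate j is nonzero at only one of the coordinate
        points.\<close>
      then have "(j, j) \<in> set L" unfolding assms(2) by (simp add: sym_pairs_def)
      then obtain i where i: "i < length L" "L ! i = (j, j)" by (metis in_set_conv_nth)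
      have "(\<Sum>p'\<in>J. ?V q p' i * c p') = (\<Sum>p'\<in>J. if p' = p then c p else 0)"
        by (intro sum.cong) (auto simp: q_def j(2) i(2))
      then show "c p = 0" using c i(1) p \<open>finite J\<close> by simp
    qed
    ultimately show ?case by (intro exI[of _ q]) (simp add: q_def)
  next
    case (Suc m)
    then obtain q where q: "\<forall>j\<le>s. \<forall>k\<le>s. q (r + 1 + j) k = (if j = k then 1 else 0 :: 'a)"
      "vec_general (Suc s) (I m) q" "vec_general (length L) (I m) (?V q)" by auto
    have fI: "finite (I m)" "m \<notin> I m" "I (Suc m) = insert m (I m)" using Suc.prems by (auto simp: I_def)
    obtain \<Phi> where \<Phi>: "finite \<Phi>" "\<And>\<phi>. \<phi> \<in> \<Phi> \<Longrightarrow> \<exists>j<Suc s. \<phi> j \<noteq> 0"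
      "\<And>u. (\<forall>\<phi>\<in>\<Phi>. (\<Sum>j<Suc s. \<phi> j * u j) \<noteq> 0) \<Longrightarrow> vec_general (Suc s) (insert m (I m)) (q(m := u))"
      using vec_general_extend[OF fI(1) q(2) fI(2)] by auto
    obtain \<Psi> where \<Psi>: "finite \<Psi>" "\<And>\<phi>. \<phi> \<in> \<Psi> \<Longrightarrow> \<exists>j<length L. \<phi> j \<noteq> 0"
      "\<And>u. (\<forall>\<phi>\<in>\<Psi>. (\<Sum>j<length L. \<phi> j * u j) \<noteq> 0) \<Longrightarrow> vec_general (length L) (insert m (I m)) ((?V q)(m := u))"
      using vec_general_extend[OF fI(1) q(3) fI(2)] by auto
    let ?e = "\<lambda>i. 2 ^ fst (L ! i) + 2 ^ snd (L ! i) :: nat"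
    have "inj_on ?e {..<length L}"
    proof (rule inj_onI)
      fix i i' assume i: "i \<in> {..<length L}" "i' \<in> {..<length L}" "?e i = ?e i'"
      have "L ! i \<in> sym_pairs {..s}" "L ! i' \<in> sym_pairs {..s}" using i(1,2) assms(2) nth_mem by auto
      then have "L ! i = L ! i'" using power_two_sums_inj[OF i(3)] by (auto simp: sym_pairs_def)
      then show "i = i'" using assms(3) i(1,2) by (simp add: nth_eq_iff_index_eq)
    qed
    then have "finite {t. \<exists>\<phi>\<in>\<Psi>. (\<Sum>i<length L. \<phi> i * t ^ ?e i) = 0}"
      by (intro finite_curve_zeros[OF \<Psi>(1,2)]) auto
    moreover have "finite {t. \<exists>\<phi>\<in>\<Phi>. (\<Sum>j<Suc s. \<phi> j * t ^ (2 ^ j)) = 0}"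
      by (rule finite_curve_zeros[OF \<Phi>(1,2), of "\<lambda>j. 2 ^ j"]) (auto simp: inj_on_def)
    ultimately have "finite ({t. \<exists>\<phi>\<in>\<Psi>. (\<Sum>i<length L. \<phi> i * t ^ ?e i) = 0} \<union> {t. \<exists>\<phi>\<in>\<Phi>. (\<Sum>j<Suc s. \<phi> j * t ^ (2 ^ j)) = 0})"
      by simp
    then obtain t where t: "t \<notin> {t. \<exists>\<phi>\<in>\<Psi>. (\<Sum>i<length L. \<phi> i * t ^ ?e i) = 0} \<union> {t. \<exists>\<phi>\<in>\<Phi>. (\<Sum>j<Suc s. \<phi> j * t ^ (2 ^ j)) = 0}"
      using ex_new_if_finite[OF assms(1)] by blast
    define q' where "q' = q(m := (\<lambda>j. t ^ (2 ^ j)))"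
    have "vec_general (Suc s) (I (Suc m)) q'"
      unfolding fI(3) q'_def by (rule \<Phi>(3)) (use t in blast)
    moreover have "?V q' = (?V q)(m := (\<lambda>i. t ^ ?e i))"
      by (auto simp: q'_def fun_eq_iff power_add)
    then have "vec_general (length L) (I (Suc m)) (?V q')"
      unfolding fI(3) by (simp only:) (rule \<Psi>(3), use t in blast)
    moreover have "\<forall>j\<le>s. \<forall>k\<le>s. q' (r + 1 + j) k = (if j = k then 1 else 0)"
      using q(1) Suc.prems by (simp add: q'_def)
    ultimately show ?case by blast
  qed
  from this[of "Suc r"] have "\<exists>q :: nat \<Rightarrow> nat \<Rightarrow> 'a. (\<forall>j\<le>s. \<forall>k\<le>s. q (r + 1 + j) k = (if j = k then 1 else 0)) \<and>
    vec_general (Suc s) (I (Suc r)) q \<and> vec_general (length L) (I (Suc r)) (?V q)" by simp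
  moreover have "I (Suc r) = {..<r + s + 2}" by (auto simp: I_def)
  ultimately show ?thesis by simp
qed

text \<open>Gale duality backwards: general position is arranged for the dual points, and the
  original points are recovered from them.\<close>

lemma quadric_general_exists:
  fixes \<iota> :: "'k::field \<Rightarrow> 'a::field"
  assumes "infinite (UNIV :: 'a set)" "field_embedding \<iota>"
  shows "\<exists>y :: nat \<Rightarrow> nat \<Rightarrow> 'a. lin_general r (r + s + 2) y \<and> (\<forall>p. \<forall>l>r. y p l = 0) \<and>
    mpoly_eval \<iota> (\<lambda>(p, l). y p l) (quadric_general_poly r s) \<noteq> 0"
proof -
  let ?\<gamma> = "r + s + 2"
  obtain L where L: "set L = sym_pairs {..s}" "distinct L"
    using finite_distinct_list[OF finite_sym_pairs, of "{..s}"] by auto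
  have len: "length L = (s + 1) * (s + 2) div 2"
  proof -
    have "2 * card (sym_pairs {..s}) = (s + 1) * (s + 2)" by (subst card_sym_pairs) simp_all
    then show ?thesis using distinct_card[OF L(2)] L(1) by simp
  qed
  obtain q :: "nat \<Rightarrow> nat \<Rightarrow> 'a" where q: "\<And>j k. j \<le> s \<Longrightarrow> k \<le> s \<Longrightarrow> q (r + 1 + j) k = (if j = k then 1 else 0)"
    "vec_general (Suc s) {..<?\<gamma>} q" "vec_general (length L) {..<?\<gamma>} (\<lambda>p i. q p (fst (L ! i)) * q p (snd (L ! i)))"
    using gale_points_exist[OF assms(1) L] by blast
  \<comment> \<open>The coordinate matrix is an identity block next to the negative transpose of q.
    A relation between the points is thus given by its last s + 1 entries, and q expresses its other
    entries in them.\<close>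
  define y where "y = (\<lambda>p l. if p \<le> r then (if l = p then 1 else 0) else if l \<le> r then - q l (p - r - 1) else 0)"
  have split: "{..<?\<gamma>} = {..<Suc r} \<union> (\<lambda>j. r + 1 + j) ` {..<Suc s}"
  proof (intro equalityI subsetI)
    fix p assume p: "p \<in> {..<?\<gamma>}"
    show "p \<in> {..<Suc r} \<union> (\<lambda>j. r + 1 + j) ` {..<Suc s}"
    proof (cases "p \<le> r")
      case False
      then have "p = r + 1 + (p - r - 1)" "p - r - 1 \<in> {..<Suc s}" using p by auto
      then show ?thesis by blast
    qed auto
  qed auto
  have gale_eq: "w p = (\<Sum>j<Suc s. q p j * w (r + 1 + j))" if w: "w \<in> gale r ?\<gamma> y" and p: "p < ?\<gamma>" for w p
  proof (cases "p \<le> r")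
    case True
    have "0 = (\<Sum>p'<?\<gamma>. y p' p * w p')" using w True by (simp add: gale_def)
    also have "\<dots> = (\<Sum>p'<Suc r. y p' p * w p') + (\<Sum>j<Suc s. y (r + 1 + j) p * w (r + 1 + j))"
      unfolding split by (subst sum.union_disjoint) (auto simp: sum.reindex inj_on_def simp del: sum.lessThan_Suc)
    also have "(\<Sum>p'<Suc r. y p' p * w p') = (\<Sum>p'<Suc r. if p' = p then w p else 0)"
      by (intro sum.cong) (auto simp: y_def)
    also have "\<dots> = w p" using True by (simp del: sum.lessThan_Suc)
    also have "(\<Sum>j<Suc s. y (r + 1 + j) p * w (r + 1 + j)) = - (\<Sum>j<Suc s. q p j * w (r + 1 + j))"
      unfolding sum_negf[symmetric] using True by (intro sum.cong) (auto simp: y_def)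
    finally show ?thesis by (simp del: sum.lessThan_Suc)
  next
    case False
    define k where "k = p - r - 1"
    have k: "p = r + 1 + k" "k \<le> s" using False p by (auto simp: k_def)
    have "(\<Sum>j<Suc s. q p j * w (r + 1 + j)) = (\<Sum>j<Suc s. if j = k then w p else 0)"
      using q(1)[OF k(2)] by (intro sum.cong) (auto simp: k(1))
    then show ?thesis using k(2) by (simp del: sum.lessThan_Suc)
  qed
  have gen: "lin_general r ?\<gamma> y"
  proof (rule lin_generalI)
    fix J w assume J: "J \<subseteq> {..<?\<gamma>}" "card J = Suc r" and w: "\<And>l. l < Suc r \<Longrightarrow> (\<Sum>p\<in>J. y p l * w p) = 0"
    define w' where "w' = (\<lambda>p. if p \<in> J then w p else 0)"
    have "(\<Sum>p<?\<gamma>. y p l * w' p) = (\<Sum>p\<in>J. y p l * w p)" for l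
      using J(1) by (intro sum.mono_neutral_cong_right) (auto simp: w'_def)
    then have w'g: "w' \<in> gale r ?\<gamma> y" using w by (simp add: gale_def)
    define K where "K = {..<?\<gamma>} - J"
    have fJ: "finite J" using J(1) finite_subset by blast
    have K: "K \<subseteq> {..<?\<gamma>}" "finite K" "card K = Suc s" using J fJ by (auto simp: K_def card_Diff_subset)
    \<comment> \<open>A relation supported on \<open>J\<close> is a linear form vanishing at the s +
      1 Gale dual points outside \<open>J\<close>, which are independent.\<close>
    have "\<forall>j\<in>{..<Suc s}. w' (r + 1 + j) = 0"
    proof (rule transposed_injective[of "{..<Suc s}" K "\<lambda>j p. q p j"])
      show "\<forall>p\<in>K. c p = 0" if "\<And>j. j \<in> {..<Suc s} \<Longrightarrow> (\<Sum>p\<in>K. q p j * c p) = 0" for c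
        using q(2) K that unfolding vec_general_def by simp
      show "(\<Sum>j\<in>{..<Suc s}. q p j * w' (r + 1 + j)) = 0" if "p \<in> K" for p
        using gale_eq[OF w'g, of p] that by (auto simp: K_def w'_def simp del: sum.lessThan_Suc)
    qed (use K in auto)
    then have "w' p = 0" if "p < ?\<gamma>" for p
      using gale_eq[OF w'g that] by (simp del: sum.lessThan_Suc)
    then show "\<forall>p\<in>J. w p = 0" using J(1) unfolding w'_def by (metis lessThan_iff subsetD)
  qed
  \<comment> \<open>The Cramer relation of r + 1 + j is a nonzero multiple of coordinate j of q, so
    passing from q to \<open>y\<close> only rescales the equations.\<close>
  have cramer: "\<exists>d. d \<noteq> 0 \<and> (\<forall>p<?\<gamma>. cramer r y (r + 1 + j) p = d * q p j)" if j: "j \<le> s" for j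
  proof -
    define d where "d = cramer r y (r + 1 + j) (r + 1 + j)"
    have cg: "cramer r y (r + 1 + j) \<in> gale r ?\<gamma> y" "d \<noteq> 0"
      using cramer_gale[OF gen, of "r + 1 + j"] j by (simp_all add: d_def)
    have "cramer r y (r + 1 + j) p = d * q p j" if p: "p < ?\<gamma>" for p
    proof -
      have "(\<Sum>k<Suc s. q p k * cramer r y (r + 1 + j) (r + 1 + k)) = (\<Sum>k<Suc s. if k = j then d * q p j else 0)"
        by (intro sum.cong) (auto simp: d_def, auto simp: cramer_def)
      then show ?thesis using gale_eq[OF cg(1) p] j by (simp del: sum.lessThan_Suc)
    qed
    then show ?thesis using cg(2) by blast
  qed
  have "mpoly_eval \<iota> (\<lambda>(p, l). y p l) (quadric_general_poly r s) \<noteq> 0"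
    unfolding quadric_general_poly_eval[OF assms(2)]
  proof (intro allI impI)
    fix J c assume J: "J \<subseteq> {..<?\<gamma>}" "card J = (s + 1) * (s + 2) div 2"
      and c: "\<forall>(j, k)\<in>sym_pairs {Suc r..r + s + 1}. (\<Sum>p\<in>J. cramer r y j p * cramer r y k p * c p) = 0"
    have "(\<Sum>p\<in>J. (q p (fst (L ! i)) * q p (snd (L ! i))) * c p) = 0" if i: "i < length L" for i
    proof -
      obtain j k where jk: "L ! i = (j, k)" by force
      have "(j, k) \<in> sym_pairs {..s}" using nth_mem[OF i] L(1) jk by simp
      then have jk': "j \<le> s" "k \<le> s" "(r + 1 + j, r + 1 + k) \<in> sym_pairs {Suc r..r + s + 1}" by (auto simp: sym_pairs_def)
      obtain d where d: "d \<noteq> 0" "\<forall>p<?\<gamma>. cramer r y (r + 1 + j) p = d * q p j" using cramer[OF jk'(1)] by blast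
      obtain d' where d': "d' \<noteq> 0" "\<forall>p<?\<gamma>. cramer r y (r + 1 + k) p = d' * q p k" using cramer[OF jk'(2)] by blast
      have "0 = (\<Sum>p\<in>J. cramer r y (r + 1 + j) p * cramer r y (r + 1 + k) p * c p)" using bspec[OF c jk'(3)] by simp
      also have "\<dots> = (\<Sum>p\<in>J. (d * d') * ((q p j * q p k) * c p))"
        using J(1) d(2) d'(2) by (intro sum.cong) (auto simp: mult_ac)
      also have "\<dots> = (d * d') * (\<Sum>p\<in>J. (q p j * q p k) * c p)" by (simp only: sum_distrib_left)
      finally show ?thesis using d(1) d'(1) by (simp add: jk)
    qed
    then show "\<forall>p\<in>J. c p = 0" using q(3) J len unfolding vec_general_def by simp
  qed
  moreover have "\<forall>p. \<forall>l>r. y p l = 0" by (simp add: y_def)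
  ultimately show ?thesis using gen by blast
qed

text \<open>Otherwise the product of all X - a, increased by 1, would be a polynomial of positive
  degree without a root.\<close>

lemma infinite_alg_closure: "infinite (UNIV :: 'k::field alg_closure set)"
proof
  assume fin: "finite (UNIV :: 'k alg_closure set)"
  define p where "p = (\<Prod>a\<in>(UNIV :: 'k alg_closure set). [:- a, 1:])"
  have "Polynomial.degree p = card (UNIV :: 'k alg_closure set)"
    unfolding p_def by (subst degree_prod_eq_sum_degree) auto
  then have deg: "0 < Polynomial.degree p" using fin by (simp add: card_gt_0_iff)
  then have "0 < Polynomial.degree (p + 1)" by (simp add: degree_add_eq_left)
  then obtain x where x: "poly (p + 1) x = 0" using alg_closed_imp_poly_has_root by blast
  have "poly p x = 0" unfolding p_def poly_prod using fin by (auto simp: prod_zero_iff)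
  then show False using x by simp
qed

section \<open>The expected Betti numbers\<close>

lemma fps_one_minus_X_power_nth: "fps_nth ((1 - fps_X) ^ r :: int fps) k = (-1) ^ k * int (r choose k)"
proof (induction r arbitrary: k)
  case 0
  show ?case by (cases k) auto
next
  case (Suc r)
  have *: "(1 - fps_X) ^ Suc r = (1 - fps_X) ^ r - fps_X * (1 - fps_X :: int fps) ^ r"
    by (simp only: power_Suc left_diff_distrib mult_1_left)
  have "fps_nth ((1 - fps_X) ^ Suc r :: int fps) k = (-1) ^ k * int (r choose k) - (if k = 0 then 0 else (-1) ^ (k - 1) * int (r choose (k - 1)))"
    unfolding * fps_sub_nth fps_X_mult_nth Suc.IH by (cases k) simp_all
  then show ?case by (cases k) (auto simp: algebra_simps)
qed

text \<open>The h-vector is (1, r, s + 1): one factor 1 - X turns the Hilbert series into this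
  polynomial, and the other r factors expand binomially.\<close>

lemma hilbert_numerator_eq:
  assumes "\<And>t. hilbert_fun r I t = (if t = 0 then 1 else if t = 1 then Suc r else r + s + 2)"
  shows "hilbert_numerator r I (k + 2) = 
    (-1) ^ k * (int (r choose (k + 2)) - int r * int (r choose (k + 1)) + (int s + 1) * int (r choose k))"
proof -
  define G where "G = Abs_fps (\<lambda>t. int (hilbert_fun r I t))"
  define P where "P = ((1 - fps_X) ^ r :: int fps)"
  have "fps_nth (G - fps_X * G) t = fps_nth (1 + fps_const (int r) * fps_X + fps_const (int s + 1) * fps_X ^ 2) t" for t
    using assms by (auto simp: G_def fps_X_mult_nth fps_X_power_iff)
  then have G: "G - fps_X * G = 1 + fps_const (int r) * fps_X + fps_const (int s + 1) * fps_X ^ 2"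
    by (intro fps_ext)
  have "G * (1 - fps_X) ^ (r + 1) = (G - fps_X * G) * P" by (simp add: P_def algebra_simps)
  also have "\<dots> = P + fps_const (int r) * (fps_X * P) + fps_const (int s + 1) * (fps_X ^ 2 * P)"
    unfolding G by (simp add: algebra_simps)
  finally have *: "G * (1 - fps_X) ^ (r + 1) = P + fps_const (int r) * (fps_X * P) + fps_const (int s + 1) * (fps_X ^ 2 * P)" .
  have "hilbert_numerator r I (k + 2) = fps_nth P (k + 2) + int r * fps_nth P (k + 1) + (int s + 1) * fps_nth P k"
    unfolding hilbert_numerator_def G_def[symmetric] *
    by (simp add: fps_X_mult_nth fps_X_power_mult_nth)
  then show ?thesis unfolding P_def fps_one_minus_X_power_nth by (simp add: algebra_simps)
qed

text \<open>Put m = r - s. After multiplication by m + 1 and m + 2 the three neighbouring binomials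
  become multiples of \<open>r choose s\<close>, and the sum is that binomial times m + 1 times r +
  2 - s^2.\<close>

lemma expected_nonpositive:
  assumes "r + 2 \<le> s\<^sup>2" "2 \<le> s" "s < r"
  shows "int (r choose (s - 2)) - int r * int (r choose (s - 1)) + (int s + 1) * int (r choose s) \<le> 0"
proof -
  define m where "m = int r - int s"
  define b where "b = (\<lambda>k. int (r choose k))"
  have rec: "int (Suc k) * b (Suc k) = (int r - int k) * b k" if "k \<le> r" for k
  proof -
    have "Suc k * (r choose Suc k) = (r - k) * (r choose k)"
      using binomial_absorption[of k r] binomial_absorb_comp[of r k] by simp
    then have "int (Suc k) * b (Suc k) = int (r - k) * b k" unfolding b_def by (metis of_nat_mult)
    then show ?thesis using that by (simp add: of_nat_diff)
  qed
  have b1: "int s * b s = (m + 1) * b (s - 1)"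
    using rec[of "s - 1"] assms by (simp add: m_def of_nat_diff algebra_simps)
  have "Suc (s - 2) = s - 1" using assms by simp
  then have b2: "(int s - 1) * b (s - 1) = (m + 2) * b (s - 2)"
    using rec[of "s - 2"] assms by (simp add: m_def of_nat_diff algebra_simps)
  define E where "E = b (s - 2) - int r * b (s - 1) + (int s + 1) * b s"
  have "(m + 1) * (m + 2) * E = (m + 1) * ((m + 2) * b (s - 2)) - int r * (m + 2) * ((m + 1) * b (s - 1)) + (int s + 1) * (m + 1) * (m + 2) * b s"
    unfolding E_def by (simp add: algebra_simps)
  also have "(m + 1) * ((m + 2) * b (s - 2)) = (int s - 1) * ((m + 1) * b (s - 1))"
    unfolding b2[symmetric] by (simp add: algebra_simps)
  also have "\<dots> = (int s - 1) * (int s * b s)" unfolding b1 ..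
  also have "int r * (m + 2) * ((m + 1) * b (s - 1)) = int r * (m + 2) * (int s * b s)" unfolding b1 ..
  also have "(int s - 1) * (int s * b s) - int r * (m + 2) * (int s * b s) + (int s + 1) * (m + 1) * (m + 2) * b s
    = b s * ((m + 1) * (m + int s + 2 - (int s)\<^sup>2))"
    unfolding m_def by (simp add: algebra_simps power2_eq_square power3_eq_cube)
  also have "\<dots> \<le> 0"
  proof (rule mult_nonneg_nonpos)
    have "int (r + 2) \<le> int (s\<^sup>2)" using assms(1) of_nat_le_iff by blast
    then show "(m + 1) * (m + int s + 2 - (int s)\<^sup>2) \<le> 0"
      using assms(3) by (intro mult_nonneg_nonpos) (auto simp: m_def)
  qed (simp add: b_def)
  finally have "(m + 1) * (m + 2) * E \<le> 0" .
  moreover have "0 < (m + 1) * (m + 2)" using assms(3) by (simp add: m_def)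
  ultimately have "E \<le> 0" by (meson mult_pos_pos not_le)
  then show ?thesis by (simp add: E_def b_def)
qed

section \<open>From lower bounds for Betti numbers to the failure of the conjecture\<close>

lemma exceeds_expected_bettiI:
  fixes x :: "nat \<Rightarrow> nat \<Rightarrow> 'l::field"
  assumes p: "\<And>q. q < \<gamma> \<Longrightarrow> p q \<in> proj_space r" "\<And>q. q < \<gamma> \<Longrightarrow> x q \<in> p q"
    and gen: "lin_general r \<gamma> x"
    and num: "\<gamma> = r + s + 2" "s < r" "\<gamma> \<le> 2 * r + 1" "2 \<le> s"
    and betti: "N \<le> betti r (points_ideal r \<gamma> x) (r - s) (r - s + 2)" "0 < N"
      "int (r choose (s - 2)) - int r * int (r choose (s - 1)) + (int s + 1) * int (r choose s) < int N"
  shows "exceeds_expected_betti r \<gamma> (p ` {..<\<gamma>})"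
proof -
  \<comment> \<open>As \<open>\<gamma>\<close> is at least r + 1 but smaller than the number of
    quadric monomials, d = 2, and j = i + 2 is the upper one of the two permitted indices.\<close>
  have d: "(LEAST d. \<gamma> < (r + d) choose r) = 2"
  proof (rule Least_equality)
    have "(r + 2) choose r = (r + 2) choose 2" using binomial_symmetric[of r "r + 2"] by simp
    also have "\<dots> = (r + 2) * (r + 1) div 2" by (simp add: choose_two)
    finally have "2 * ((r + 2) choose r) = (r + 2) * (r + 1)" by simp
    moreover have "4 * (r + 1) \<le> (r + 2) * (r + 1)" using num by (intro mult_right_mono) auto
    ultimately have "2 * (r + 1) \<le> (r + 2) choose r" by simp
    then show "\<gamma> < (r + 2) choose r" using num(3) by simp
  next
    fix d assume "\<gamma> < (r + d) choose r"
    moreover have "d = 0 \<or> d = 1 \<or> 2 \<le> d" by linarith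
    ultimately show "2 \<le> d" using num by (auto simp: binomial_eq_0)
  qed
  define i where "i = r - s"
  have "hilbert_numerator r (points_ideal r \<gamma> x) (i + 2) =
    (-1) ^ i * (int (r choose (i + 2)) - int r * int (r choose (i + 1)) + (int s + 1) * int (r choose i))"
    by (rule hilbert_numerator_eq) (use hilbert_fun_points[OF gen] num in auto)
  moreover have "r choose (i + 2) = r choose (s - 2)" "r choose (i + 1) = r choose (s - 1)" "r choose i = r choose s"
    using num binomial_symmetric[of "s - 2" r] binomial_symmetric[of "s - 1" r] binomial_symmetric[of s r] by (simp_all add: i_def Suc_diff_le)
  moreover have "(-1) ^ i * ((-1) ^ i * z) = (z :: int)" for z by (simp flip: mult.assoc power_add)
  ultimately have "(-1) ^ i * hilbert_numerator r (points_ideal r \<gamma> x) (i + 2) < int N" using betti(3) by simp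
  then have "max 0 ((-1) ^ i * hilbert_numerator r (points_ideal r \<gamma> x) (i + 2)) < int (betti r (points_ideal r \<gamma> x) i (i + 2))"
    using betti(1,2) by (simp add: i_def)
  moreover have "vanishing_ideal r (p ` {..<\<gamma>}) = points_ideal r \<gamma> x"
    by (rule vanishing_ideal_eq_points_ideal[OF p])
  ultimately show ?thesis
    unfolding exceeds_expected_betti_def Let_def d using num(2) by (intro exI[of _ i] conjI bexI[of _ "i + 2"]) (auto simp: i_def)
qed

lemma lin_general_nonzero:
  assumes "lin_general r \<gamma> x" "Suc r \<le> \<gamma>" "q < \<gamma>"
  shows "\<exists>l<Suc r. x q l \<noteq> 0"
proof (rule ccontr)
  assume 0: "\<not> (\<exists>l<Suc r. x q l \<noteq> 0)"
  obtain J where J: "{q} \<subseteq> J" "J \<subseteq> {..<\<gamma>}" "card J = Suc r"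
    using exists_subset_between[of "{q}" "Suc r" "{..<\<gamma>}"] assms(2,3) by auto
  have "(\<Sum>s\<in>J. x s l * (if s = q then 1 else 0)) = 0" if "l < Suc r" for l
    using 0 that by (intro sum.neutral) auto
  then have "\<forall>s\<in>J. (if s = q then 1 else 0) = (0 :: 'a)" by (rule relation_unique[OF assms(1) J(2,3)])
  then show False using J(1) by auto
qed

lemma open_points_nonempty:
  fixes f :: "(nat \<times> nat, 'k::field) mpoly" and y :: "nat \<Rightarrow> nat \<Rightarrow> 'k alg_closure"
  assumes "lin_general r \<gamma> y" "\<forall>s. \<forall>l>r. y s l = 0" "Suc r \<le> \<gamma>" "mpoly_eval to_ac (\<lambda>(s, l). y s l) f \<noteq> 0"
  shows "open_points to_ac r \<gamma> {f} \<noteq> {}"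
proof -
  define p where "p = (\<lambda>s\<in>{..<\<gamma>}. {fun_scale c (y s) | c. c \<noteq> 0})"
  have "p s \<in> proj_space r" if "s < \<gamma>" for s
    using lin_general_nonzero[OF assms(1,3) that] assms(2) that unfolding proj_space_def p_def
    by (auto simp: less_Suc_eq_le intro!: exI[of _ "y s"])
  moreover have "y s \<in> p s" if "s < \<gamma>" for s
    using that by (auto simp: p_def fun_scale_def intro!: exI[of _ 1])
  ultimately have "p \<in> open_points to_ac r \<gamma> {f}"
    unfolding open_points_def using assms(4) by (auto simp: p_def intro!: exI[of _ y])
  then show ?thesis by blast
qed

lemma field_embedding_to_ac: "field_embedding (to_ac :: 'k::field \<Rightarrow> 'k alg_closure)"
  by (simp add: field_embedding_def)

text \<open>The same polynomial over k serves twice: its value at one point over the algebraic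
  closure shows that the open set is nonempty, and its nonvanishing over the second field yields the
  property.\<close>

lemma MRC_failsI:
  fixes \<iota> :: "'k::field \<Rightarrow> 'l::field" and f :: "(nat \<times> nat, 'k) mpoly" and y :: "nat \<Rightarrow> nat \<Rightarrow> 'k alg_closure"
  assumes "multi_homog r \<gamma> e f" "Suc r \<le> \<gamma>"
    and "lin_general r \<gamma> y" "\<forall>s. \<forall>l>r. y s l = 0" "mpoly_eval to_ac (\<lambda>(s, l). y s l) f \<noteq> 0"
    and "\<And>p x. (\<And>q. q < \<gamma> \<Longrightarrow> p q \<in> proj_space r) \<Longrightarrow> (\<And>q. q < \<gamma> \<Longrightarrow> x q \<in> p q) \<Longrightarrow> 
      mpoly_eval \<iota> (\<lambda>(s, l). x s l) f \<noteq> 0 \<Longrightarrow> exceeds_expected_betti r \<gamma> (p ` {..<\<gamma>})"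
  shows "MRC_fails \<iota> r \<gamma>"
  unfolding MRC_fails_def general_points_def
proof (intro exI[of _ "{f}"] conjI ballI)
  show "{f} \<subseteq> multihomogeneous r \<gamma>" using multi_homog_multihomogeneous[OF assms(1)] by simp
  show "open_points to_ac r \<gamma> {f} \<noteq> {}" by (rule open_points_nonempty[OF assms(3,4,2,5)])
  fix p assume "p \<in> open_points \<iota> r \<gamma> {f}"
  then obtain x where "p \<in> {..<\<gamma>} \<rightarrow>\<^sub>E proj_space r" "\<forall>s<\<gamma>. x s \<in> p s" "mpoly_eval \<iota> (\<lambda>(s, l). x s l) f \<noteq> 0"
    by (auto simp: open_points_def)
  then show "exceeds_expected_betti r \<gamma> (p ` {..<\<gamma>})" by (intro assms(6)[of p x]) auto
qed

lemma MRC_fails_range: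
  fixes \<iota> :: "'k::field \<Rightarrow> 'l::field"
  assumes "field_embedding \<iota>" "\<gamma> = r + s + 2" "s * (s + 1) \<le> 2 * r" "r + 2 \<le> s\<^sup>2" "3 \<le> s"
  shows "MRC_fails \<iota> r \<gamma>"
proof -
  \<comment> \<open>With s (s + 1) \<le> 2 r this gives 2 s \<le> r, which leaves room for both s <
    r and \<open>\<gamma> \<le> 2 * r + 1\<close>.\<close>
  have "4 * s \<le> s * (s + 1)" using assms(5) mult_le_mono2[of 4 "s + 1" s] by (simp add: mult.commute)
  then have sr: "2 * s \<le> r" using assms(3) by linarith
  have num: "s < r" "\<gamma> \<le> 2 * r + 1" "2 \<le> s" "Suc r \<le> \<gamma>" using sr assms(2,5) by auto
  \<comment> \<open>The left side is s (s + 1) / 2 + s + 1, hence at most r + s + 1.\<close>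
  have quad: "(s + 1) * (s + 2) div 2 < \<gamma>" using assms(2,3) by (simp add: algebra_simps) 
  obtain e where e: "multi_homog r \<gamma> e (lin_general_poly r \<gamma> :: (nat \<times> nat, 'k) mpoly)"
    using lin_general_poly_multi_homog by blast
  obtain y :: "nat \<Rightarrow> nat \<Rightarrow> 'k alg_closure" where y: "lin_general r \<gamma> y" "\<forall>s. \<forall>l>r. y s l = 0"
    using lin_general_exists[OF infinite_alg_closure] by blast
  show ?thesis
  proof (rule MRC_failsI[OF e num(4) y])
    show "mpoly_eval to_ac (\<lambda>(s, l). y s l) (lin_general_poly r \<gamma>) \<noteq> 0"
      using lin_general_poly_eval[OF field_embedding_to_ac] y(1) by blast
    fix p :: "nat \<Rightarrow> (nat \<Rightarrow> 'l) set" and x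
    assume p: "\<And>q. q < \<gamma> \<Longrightarrow> p q \<in> proj_space r" "\<And>q. q < \<gamma> \<Longrightarrow> x q \<in> p q"
      and "mpoly_eval \<iota> (\<lambda>(s, l). x s l) (lin_general_poly r \<gamma>) \<noteq> 0"
    then have gen: "lin_general r \<gamma> x" using lin_general_poly_eval[OF assms(1)] by blast
    show "exceeds_expected_betti r \<gamma> (p ` {..<\<gamma>})"
      by (rule exceeds_expected_bettiI[OF p gen assms(2) num(1-3) 
            betti_positive[OF gen assms(2) num(1,2) lin_general_nonzero[OF gen num(4)] quad]])
        (use expected_nonpositive[OF assms(4) num(3,1)] in auto)
  qed
qed

text \<open>Here k + 1 is the excess of \<open>\<gamma>\<close> over the number of quadrics in s + 1
  variables, the expected dimension of the space of quadric relations.\<close>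

lemma MRC_fails_sporadic:
  fixes \<iota> :: "'k::field \<Rightarrow> 'l::field"
  assumes "field_embedding \<iota>" "\<gamma> = r + s + 2" "s < r" "\<gamma> \<le> 2 * r + 1" "2 \<le> s"
    and "\<gamma> = (s + 1) * (s + 2) div 2 + k + 1" "k + s \<le> \<gamma>"
    and "int (r choose (s - 2)) - int r * int (r choose (s - 1)) + (int s + 1) * int (r choose s) < int ((k + s) choose k)"
  shows "MRC_fails \<iota> r \<gamma>"
proof -
  have num: "Suc r \<le> \<gamma>" using assms(2) by simp
  obtain e e' where e: "multi_homog r \<gamma> e (lin_general_poly r \<gamma> :: (nat \<times> nat, 'k) mpoly)"
    "multi_homog r \<gamma> e' (quadric_general_poly r s :: (nat \<times> nat, 'k) mpoly)"
    using lin_general_poly_multi_homog quadric_general_poly_multi_homog unfolding assms(2) by blast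
  obtain y :: "nat \<Rightarrow> nat \<Rightarrow> 'k alg_closure" where y: "lin_general r \<gamma> y" "\<forall>s. \<forall>l>r. y s l = 0"
    "mpoly_eval to_ac (\<lambda>(p, l). y p l) (quadric_general_poly r s) \<noteq> 0"
    using quadric_general_exists[OF infinite_alg_closure field_embedding_to_ac] unfolding assms(2) by blast
  show ?thesis
  proof (rule MRC_failsI[OF multi_homog_mult[OF e] num y(1,2)])
    show "mpoly_eval to_ac (\<lambda>(s, l). y s l) (lin_general_poly r \<gamma> * quadric_general_poly r s) \<noteq> 0"
      unfolding eval_mult[OF field_embedding_to_ac] 
      by (rule no_zero_divisors) (use lin_general_poly_eval[OF field_embedding_to_ac] y(1,3) in blast)+
    fix p :: "nat \<Rightarrow> (nat \<Rightarrow> 'l) set" and x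
    assume p: "\<And>q. q < \<gamma> \<Longrightarrow> p q \<in> proj_space r" "\<And>q. q < \<gamma> \<Longrightarrow> x q \<in> p q"
      and "mpoly_eval \<iota> (\<lambda>(s, l). x s l) (lin_general_poly r \<gamma> * quadric_general_poly r s) \<noteq> 0"
    then have "mpoly_eval \<iota> (\<lambda>(s, l). x s l) (lin_general_poly r \<gamma>) \<noteq> 0"
      and q: "mpoly_eval \<iota> (\<lambda>(s, l). x s l) (quadric_general_poly r s) \<noteq> 0"
      unfolding eval_mult[OF assms(1)] by auto
    then have gen: "lin_general r \<gamma> x" using lin_general_poly_eval[OF assms(1)] by blast
    have qg: "quadric_general ((s + 1) * (s + 2) div 2) r \<gamma> x"
      using quadric_generalI[OF assms(1) _ q] gen unfolding assms(2) by blast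
    show "exceeds_expected_betti r \<gamma> (p ` {..<\<gamma>})"
      by (rule exceeds_expected_bettiI[OF p gen assms(2-5) 
            betti_binomial[OF gen assms(2-4) lin_general_nonzero[OF gen num] qg assms(6,7)] _ assms(8)])
        auto
  qed
qed

theorem theorem1p1:
  fixes \<iota> :: "'k::field \<Rightarrow> 'l::field" and r \<gamma> :: nat
  assumes "field_embedding \<iota>"
    and "(r \<ge> 6 \<and> r \<noteq> 9 \<and>
           real r + 2 + sqrt (real r + 2) \<le> real \<gamma> \<and>
           real \<gamma> \<le> real r + (3 + sqrt (8 * real r + 1)) / 2)
         \<or> (r, \<gamma>) = (8, 13) \<or> (r, \<gamma>) = (15, 21)"
  shows "MRC_fails \<iota> r \<gamma>"
proof -
  consider (range) "r \<ge> 6" "real r + 2 + sqrt (real r + 2) \<le> real \<gamma>" "real \<gamma> \<le> real r + (3 + sqrt (8 * real r + 1)) / 2"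
    | (8) "r = 8" "\<gamma> = 13" | (15) "r = 15" "\<gamma> = 21"
    using assms(2) by auto
  then show ?thesis
  proof cases
    case range
    define s where "s = \<gamma> - r - 2"
    have "0 \<le> sqrt (real r + 2)" by simp
    then have "real r + 2 \<le> real \<gamma>" using range(2) by linarith
    then have \<gamma>: "\<gamma> = r + s + 2" unfolding s_def by linarith
    have "sqrt (real r + 2) \<le> real s" using range(2) \<gamma> by simp
    then have "real r + 2 \<le> (real s)\<^sup>2" using real_sqrt_le_iff sqrt_le_D by blast
    then have "real (r + 2) \<le> real (s\<^sup>2)" by simp
    then have 1: "r + 2 \<le> s\<^sup>2" by (simp only: of_nat_le_iff)
    \<comment> \<open>Squaring this form of the upper bound on \<open>\<gamma>\<close> gives s (s +
      1) \<le> 2 r.\<close>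
    have "2 * real s + 1 \<le> sqrt (8 * real r + 1)" using range(3) \<gamma> by (simp add: field_simps)
    then have "(2 * real s + 1)\<^sup>2 \<le> 8 * real r + 1" using real_le_rsqrt real_sqrt_ge_0_iff by (smt (verit) of_nat_0_le_iff power_mono real_sqrt_pow2)
    then have "real (s * (s + 1)) \<le> real (2 * r)" by (simp add: power2_eq_square algebra_simps)
    then have 2: "s * (s + 1) \<le> 2 * r" by (simp only: of_nat_le_iff)
    have "3 \<le> s"
    proof (rule ccontr)
      assume "\<not> 3 \<le> s"
      then have "s\<^sup>2 \<le> 2\<^sup>2" by (intro power_mono) auto
      then show False using 1 range(1) by simp
    qed
    then show ?thesis by (rule MRC_fails_range[OF assms(1) \<gamma> 2 1])
  next
    case 8
    \<comment> \<open>In both sporadic cases r + 1 = s^2, so the last two terms cancel and the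
      expected value is \<open>r choose (s - 2)\<close>.\<close>
    have "int (8 choose (3 - 2)) - int 8 * int (8 choose (3 - 1)) + (int 3 + 1) * int (8 choose 3) < int ((2 + 3) choose 2)"
      by (simp add: numeral_eq_Suc)
    then show ?thesis unfolding 8 
      by (intro MRC_fails_sporadic[OF assms(1), where s = 3 and k = 2]) simp_all
  next
    case 15
    have "int (15 choose (4 - 2)) - int 15 * int (15 choose (4 - 1)) + (int 4 + 1) * int (15 choose 4) < int ((5 + 4) choose 5)"
      by (simp add: numeral_eq_Suc)
    then show ?thesis unfolding 15 
      by (intro MRC_fails_sporadic[OF assms(1), where s = 4 and k = 5]) simp_all
  qed
qed

end
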